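(* There is a constant $c>0$ depending only on $n$ and $d$ such that for every matrix $A_2$ weight $W:\mathbb{R}^d\to\mathcal{M}_n(\mathbb{C})$ and every dyadic grid $\mathscr{D}$, the maximal function $$M_W\vec f(x)=\sup_{\mathscr{D}\ni I\ni x}\frac1{|I|}\int_I|W^{1/2}(x)W^{-1/2}(y)\vec f(y)|\,dy$$ is bounded from $L^2(\mathbb{R}^d;\mathbb{C}^n)$ to $L^2(\mathbb{R}^d)$, with $$\|M_W\|_{L^2\to L^2}\le c\,\|W\|_{A_2}.$$
   Context: $n,d\ge1$ are integers; $\mathcal{M}_n(\mathbb{C})$ is the algebra of $n\times n$ complex matrices with operator norm $\|\cdot\|$; $|\cdot|$ is the Euclidean norm on $\mathbb{C}^n$; cubes have sides parallel to the axes. A measurable a.e. positive definite $W:\mathbb{R}^d\to\mathcal{M}_n(\mathbb{C})$ is a matrix $A_2$ weight if $$\|W\|_{A_2}:=\sup_{I\text{ cube}}\frac1{|I|}\int_I\frac1{|I|}\int_I\|W^{1/2}(x)W^{-1/2}(t)\|^{2}\,dt\,dx<\infty.$$ A dyadic grid is a nested family of half-open cubes of side lengths $2^k$, $k\in\mathbb{Z}$, such that for each $k$ the cubes of side length $2^k$ partition $\mathbb{R}^d$. $\|M_W\|_{L^2\to L^2}$ is the least constant $C$ with $\|M_W\vec f\|_{L^2}\le C\|\vec f\|_{L^2}$ (unweighted norms) for all $\vec f\in L^2(\mathbb{R}^d;\mathbb{C}^n)$. *)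

theory Defs
  imports "HOL-Analysis.Analysis"
begin

definition hermitian :: "complex^'n^'n \<Rightarrow> bool" where
  "hermitian A \<longleftrightarrow> (\<forall>i j. A $ i $ j = cnj (A $ j $ i))"

definition quad_form :: "complex^'n^'n \<Rightarrow> complex^'n \<Rightarrow> complex" where
  "quad_form A v = (\<Sum>i\<in>UNIV. (A *v v) $ i * cnj (v $ i))"

text \<open>The quadratic form of a Hermitian matrix is real-valued, so taking the real part below
  loses nothing.\<close>

definition pos_semidef :: "complex^'n^'n \<Rightarrow> bool" where
  "pos_semidef A \<longleftrightarrow> hermitian A \<and> (\<forall>v. 0 \<le> Re (quad_form A v))"

definition pos_def :: "complex^'n^'n \<Rightarrow> bool" where
  "pos_def A \<longleftrightarrow> hermitian A \<and> (\<forall>v. v \<noteq> 0 \<longrightarrow> 0 < Re (quad_form A v))"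

text \<open>The square root is only meaningful for positive semidefinite arguments. A weight is
  positive definite almost everywhere, so the unspecified values occur on a null set only.\<close>

definition mat_sqrt :: "complex^'n^'n \<Rightarrow> complex^'n^'n" where
  "mat_sqrt A = (THE B. pos_semidef B \<and> B ** B = A)"

definition mat_inv_sqrt :: "complex^'n^'n \<Rightarrow> complex^'n^'n" where
  "mat_inv_sqrt A = matrix_inv (mat_sqrt A)"

text \<open>\<^term>\<open>norm\<close> on \<^typ>\<open>complex^'n\<close> is the Euclidean norm, but \<^term>\<open>norm\<close> on
  \<^typ>\<open>complex^'n^'n\<close> is the Frobenius norm; hence the operator norm is \<^term>\<open>onorm\<close>.\<close>

definition op_norm :: "complex^'n^'n \<Rightarrow> real" where
  "op_norm A = onorm (\<lambda>v. A *v v)"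

definition cube :: "real^'d \<Rightarrow> real \<Rightarrow> (real^'d) set" where
  "cube a l = {x. \<forall>i. a $ i \<le> x $ i \<and> x $ i < a $ i + l}"

definition avg :: "(real^'d) set \<Rightarrow> (real^'d \<Rightarrow> ennreal) \<Rightarrow> ennreal" where
  "avg I g = (\<integral>\<^sup>+x\<in>I. g x \<partial>lebesgue) / emeasure lebesgue I"

text \<open>Replacing half-open cubes by closed or open ones does not affect the averages, since the
  faces of a cube are null sets.\<close>

definition A2_char :: "(real^'d \<Rightarrow> complex^'n^'n) \<Rightarrow> ennreal" where
  "A2_char W = (SUP I\<in>{cube a l |a l. 0 < l}.
     avg I (\<lambda>x. avg I (\<lambda>t. ennreal ((op_norm (mat_sqrt (W x) ** mat_inv_sqrt (W t)))\<^sup>2))))"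

definition matrix_A2_weight :: "(real^'d \<Rightarrow> complex^'n^'n) \<Rightarrow> bool" where
  "matrix_A2_weight W \<longleftrightarrow>
     W \<in> borel_measurable lebesgue \<and> (AE x in lebesgue. pos_def (W x)) \<and> A2_char W < \<infinity>"

definition dyadic_grid :: "(real^'d) set set \<Rightarrow> bool" where
  "dyadic_grid D \<longleftrightarrow>
     (\<forall>I\<in>D. \<exists>a (k::int). I = cube a (2 powi k)) \<and>
     (\<forall>I\<in>D. \<forall>J\<in>D. I \<inter> J = {} \<or> I \<subseteq> J \<or> J \<subseteq> I) \<and>
     (\<forall>k::int. partition_on UNIV {I\<in>D. \<exists>a. I = cube a (2 powi k)})"

definition maximal_fn ::
  "(real^'d) set set \<Rightarrow> (real^'d \<Rightarrow> complex^'n^'n) \<Rightarrow> (real^'d \<Rightarrow> complex^'n) \<Rightarrow> real^'d \<Rightarrow> ennreal" where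
  "maximal_fn D W f x =
     (SUP I\<in>{I\<in>D. x \<in> I}. avg I (\<lambda>y. ennreal (norm ((mat_sqrt (W x) ** mat_inv_sqrt (W y)) *v f y))))"

definition ennsqrt :: "ennreal \<Rightarrow> ennreal" where
  "ennsqrt r = (if r = \<infinity> then \<infinity> else ennreal (sqrt (enn2real r)))"

text \<open>Maximal functions may a priori take the value \<open>\<infinity>\<close>, so the scalar \<open>L\<^sup>2\<close> norm is defined for
  functions into \<^typ>\<open>ennreal\<close>; finiteness of the norm makes them finite almost everywhere.\<close>

definition L2_norm :: "(real^'d \<Rightarrow> ennreal) \<Rightarrow> ennreal" where
  "L2_norm g = ennsqrt (\<integral>\<^sup>+x. (g x)\<^sup>2 \<partial>lebesgue)"

definition L2_scalar :: "(real^'d \<Rightarrow> ennreal) set" where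
  "L2_scalar = {g \<in> borel_measurable lebesgue. L2_norm g < \<infinity>}"

definition L2_vec_norm :: "(real^'d \<Rightarrow> complex^'n) \<Rightarrow> ennreal" where
  "L2_vec_norm f = L2_norm (\<lambda>x. ennreal (norm (f x)))"

definition L2_vec :: "(real^'d \<Rightarrow> complex^'n) set" where
  "L2_vec = {f \<in> borel_measurable lebesgue. L2_vec_norm f < \<infinity>}"

definition L2_op_norm :: "((real^'d \<Rightarrow> complex^'n) \<Rightarrow> real^'d \<Rightarrow> ennreal) \<Rightarrow> ennreal" where
  "L2_op_norm T = Inf {C. \<forall>f\<in>L2_vec. L2_norm (T f) \<le> C * L2_vec_norm f}"

definition L2_bounded :: "((real^'d \<Rightarrow> complex^'n) \<Rightarrow> real^'d \<Rightarrow> ennreal) \<Rightarrow> bool" where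
  "L2_bounded T \<longleftrightarrow> (\<forall>f\<in>L2_vec. T f \<in> L2_scalar) \<and>
     (\<exists>C::real. \<forall>f\<in>L2_vec. L2_norm (T f) \<le> ennreal C * L2_vec_norm f)"

end

theory Submission
  imports Defs
begin

text \<open>Write \<open>S = W\<^sup>1\<^sup>/\<^sup>2\<close>, \<open>R = W\<^sup>-\<^sup>1\<^sup>/\<^sup>2\<close> and \<open>A\<close> for the \<open>A\<^sub>2\<close> characteristic of \<open>W\<close>. To every cube \<open>I\<close>
belongs its reducing matrix \<open>red I\<close>, the square root of the mean of \<open>W\<^sup>-\<^sup>1\<close> over \<open>I\<close>; equivalently,
\<open>|red I u|\<^sup>2\<close> is the mean of \<open>|R u|\<^sup>2\<close> over \<open>I\<close>. Inserting \<open>red I\<close> and its inverse gives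
\<open>|S(x) R(y) f(y)| \<le> \<parallel>S(x) red I\<parallel> \<cdot> \<parallel>(red I)\<^sup>-\<^sup>1 R(y)\<parallel> |f(y)|\<close>, so the average in the maximal function is at
most \<open>\<parallel>S(x) red I\<parallel> a\<^sub>I\<close>, where \<open>a\<^sub>I\<close> is the mean over \<open>I\<close> of \<open>\<parallel>(red I)\<^sup>-\<^sup>1 R\<parallel> |f|\<close>. Each of the two
factors contributes \<open>A\<^sup>1\<^sup>/\<^sup>2\<close> to the operator norm.

The first factor (\<open>nn_integral_full_max\<close>): for a fixed cube \<open>Q\<close> the supremum of \<open>\<parallel>S(x) red I\<parallel>\<^sup>2\<close> over all
dyadic \<open>I\<close> with \<open>x \<in> I \<subseteq> Q\<close> has integral at most a dimensional multiple of \<open>A |Q|\<close>. As long as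
\<open>\<parallel>red I (red Q)\<^sup>-\<^sup>1\<parallel>\<^sup>2\<close> stays below \<open>2n\<close>, the cube \<open>I\<close> can be replaced by \<open>Q\<close>, and the \<open>A\<^sub>2\<close> condition
applies to \<open>Q\<close>. The cubes where this fails cover at most half of \<open>Q\<close>, because
\<open>\<parallel>R (red Q)\<^sup>-\<^sup>1\<parallel>\<^sup>2\<close> has mean \<open>n\<close> over \<open>Q\<close>; iterating inside them produces a geometric series.

The second factor (\<open>reduced_weak_bound\<close>): every function \<open>|R u|\<^sup>2\<close> is a scalar dyadic \<open>A\<^sub>2\<close> weight with
constant at most \<open>A\<close>, hence satisfies a reverse Hoelder inequality with an exponent \<open>1 + \<delta>\<close>, where
\<open>\<delta>\<close> is proportional to \<open>1 / A\<close> and the constant does not depend on \<open>A\<close> (\<open>reverse_Holder\<close>). By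
Young's inequality \<open>a\<^sub>I\<close> is then controlled by means of \<open>|f|\<^sup>q\<close> with an exponent \<open>q < 2\<close> for which
\<open>2 - q\<close> is comparable to \<open>\<delta>\<close>; a maximal function of this kind is bounded on \<open>L\<^sup>2\<close> with squared norm of the
order \<open>1 / (2 - q)\<close>, which is comparable to \<open>A\<close>.

The two estimates combine without loss because the first one is localized. If \<open>2\<^sup>k < a\<^sub>I \<le> 2\<^sup>k\<^sup>+\<^sup>1\<close>, then
\<open>I\<close> lies in a maximal cube \<open>Q\<close> with \<open>a\<^sub>Q > 2\<^sup>k\<close>, so the square of the maximal function is dominated by the
sum over \<open>k\<close> and over these \<open>Q\<close> of \<open>4 \<cdot> 4\<^sup>k\<close> times the localized supremum on \<open>Q\<close>. Integration turns the
latter into \<open>A |Q|\<close>, and the second estimate sums the measures of the \<open>Q\<close>.\<close>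

section \<open>Complex matrices: Frobenius norm and operator norm\<close>

lemma inner_complex_Re: "(a::complex) \<bullet> b = Re (a * cnj b)"
  by (simp add: inner_complex_def)

text \<open>The real inner product of \<^typ>\<open>complex^'n\<close> is the real part of the Hermitian one, and it determines
definiteness of Hermitian matrices. All estimates below therefore use the real inner product.\<close>

lemma Re_quad_form: "Re (quad_form A v) = (A *v v) \<bullet> v"
  by (simp add: quad_form_def inner_vec_def inner_complex_Re Re_sum)

definition conj_transpose :: "complex^'n^'n \<Rightarrow> complex^'n^'n" where
  "conj_transpose A = (\<chi> i j. cnj (A $ j $ i))"

lemma hermitian_iff_conj_transpose: "hermitian A \<longleftrightarrow> conj_transpose A = A"
  unfolding hermitian_def conj_transpose_def vec_eq_iff vec_lambda_beta by metis

lemma conj_transpose_mult: "conj_transpose (A ** B) = conj_transpose B ** conj_transpose A"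
  unfolding conj_transpose_def matrix_matrix_mult_def vec_eq_iff
  by (simp add: mult.commute[of "cnj (A $ _ $ _)"])

lemma inner_conj_transpose: "(A *v u) \<bullet> w = u \<bullet> (conj_transpose A *v w)"
proof -
  have "(A *v u) \<bullet> w = (\<Sum>i\<in>UNIV. \<Sum>j\<in>UNIV. Re (A$i$j * u$j * cnj (w$i)))"
    by (simp add: inner_vec_def inner_complex_Re matrix_vector_mult_def sum_distrib_right Re_sum)
  also have "\<dots> = (\<Sum>j\<in>UNIV. \<Sum>i\<in>UNIV. Re (A$i$j * u$j * cnj (w$i)))"
    by (rule sum.swap)
  also have "\<dots> = u \<bullet> (conj_transpose A *v w)"
    by (simp add: inner_vec_def inner_complex_Re matrix_vector_mult_def sum_distrib_left Re_sum
        conj_transpose_def algebra_simps del: times_complex.sel)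
  finally show ?thesis .
qed

lemma hermitian_inner: "hermitian A \<Longrightarrow> (A *v u) \<bullet> w = u \<bullet> (A *v w)"
  unfolding hermitian_iff_conj_transpose by (subst inner_conj_transpose) (erule ssubst, rule refl)

lemma matrix_mult_axis_nth: "((A :: complex^'n^'n) *v axis j 1) $ i = A $ i $ j"
  by (simp add: matrix_vector_mult_def axis_def if_distrib[of "\<lambda>x. _ * x"] cong: if_cong)

text \<open>The norm of \<^typ>\<open>complex^'n^'n\<close> is the Frobenius norm. Reading it off the columns reduces statements
about matrices to statements about the vectors \<open>A *v axis j 1\<close>.\<close>

lemma inner_matrix_columns:
  "(A :: complex^'n^'n) \<bullet> B = (\<Sum>j\<in>UNIV. (A *v axis j 1) \<bullet> (B *v axis j 1))"
proof -
  have "A \<bullet> B = (\<Sum>i\<in>UNIV. \<Sum>j\<in>UNIV. A$i$j \<bullet> B$i$j)"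
    by (simp add: inner_vec_def)
  also have "\<dots> = (\<Sum>j\<in>UNIV. \<Sum>i\<in>UNIV. A$i$j \<bullet> B$i$j)" by (rule sum.swap)
  finally show ?thesis
    by (simp add: inner_vec_def matrix_mult_axis_nth)
qed

lemma norm_matrix_columns:
  "(norm (A :: complex^'n^'n))\<^sup>2 = (\<Sum>j\<in>UNIV. (norm (A *v axis j 1))\<^sup>2)"
  unfolding power2_norm_eq_inner inner_matrix_columns ..

lemma inner_conj_transpose_both: "conj_transpose A \<bullet> conj_transpose B = A \<bullet> B"
proof -
  have "conj_transpose A \<bullet> conj_transpose B = (\<Sum>i\<in>UNIV. \<Sum>j\<in>UNIV. A$j$i \<bullet> B$j$i)"
    by (simp add: inner_vec_def conj_transpose_def inner_complex_def)
  also have "\<dots> = (\<Sum>j\<in>UNIV. \<Sum>i\<in>UNIV. A$j$i \<bullet> B$j$i)" by (rule sum.swap)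
  finally show ?thesis by (simp add: inner_vec_def)
qed

lemma norm_conj_transpose: "norm (conj_transpose A) = norm A"
  by (simp add: norm_eq_sqrt_inner inner_conj_transpose_both)

text \<open>The two products are conjugate transposes of each other.\<close>

lemma norm_hermitian_mult_commute:
  assumes "hermitian A" "hermitian B"
  shows "norm (A ** B) = norm (B ** A)"
  using assms norm_conj_transpose[of "A ** B"]
  by (simp add: conj_transpose_mult hermitian_iff_conj_transpose)

lemma norm_matrix_mult_bound:
  fixes A B :: "complex^'n^'n"
  assumes "\<And>v. norm (A *v v) \<le> c * norm v" "0 \<le> c"
  shows "norm (A ** B) \<le> c * norm B"
proof (rule power2_le_imp_le)
  have "(norm (A ** B))\<^sup>2 = (\<Sum>j\<in>UNIV. (norm (A *v (B *v axis j 1)))\<^sup>2)"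
    by (simp add: norm_matrix_columns matrix_vector_mul_assoc)
  also have "\<dots> \<le> (\<Sum>j\<in>UNIV. (c * norm (B *v axis j 1))\<^sup>2)"
    by (intro sum_mono power_mono assms) auto
  also have "\<dots> = (c * norm B)\<^sup>2"
    by (simp add: norm_matrix_columns power_mult_distrib sum_distrib_left)
  finally show "(norm (A ** B))\<^sup>2 \<le> (c * norm B)\<^sup>2" .
qed (use assms in auto)

lemma norm_matrix_vector_le: "norm ((A :: complex^'n^'n) *v v) \<le> norm A * norm v"
proof (rule power2_le_imp_le)
  have *: "cmod ((A *v v) $ i) \<le> norm (A $ i) * norm v" for i
  proof -
    have "cmod ((A *v v) $ i) \<le> (\<Sum>j\<in>UNIV. cmod (A$i$j) * cmod (v$j))"
      by (simp add: matrix_vector_mult_def) (rule order_trans[OF norm_sum], simp add: norm_mult)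
    also have "\<dots> \<le> L2_set (\<lambda>j. cmod (A$i$j)) UNIV * L2_set (\<lambda>j. cmod (v$j)) UNIV"
      using L2_set_mult_ineq[of "\<lambda>j. cmod (A$i$j)" "\<lambda>j. cmod (v$j)" UNIV] by simp
    finally show ?thesis by (simp add: norm_vec_def)
  qed
  have "(norm (A *v v))\<^sup>2 = (\<Sum>i\<in>UNIV. (cmod ((A *v v) $ i))\<^sup>2)"
    by (simp add: norm_vec_def L2_set_def sum_nonneg)
  also have "\<dots> \<le> (\<Sum>i\<in>UNIV. (norm (A $ i) * norm v)\<^sup>2)"
    by (intro sum_mono power_mono *) auto
  also have "\<dots> = (norm A * norm v)\<^sup>2"
    by (simp add: norm_vec_def[of A] L2_set_def sum_nonneg power_mult_distrib sum_distrib_right)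
  finally show "(norm (A *v v))\<^sup>2 \<le> (norm A * norm v)\<^sup>2" .
qed auto

lemma norm_matrix_mult_le: "norm ((A :: complex^'n^'n) ** (B :: complex^'n^'n)) \<le> norm A * norm B"
  by (rule norm_matrix_mult_bound[OF norm_matrix_vector_le]) auto

lemma bounded_bilinear_matrix_mult: "bounded_bilinear ((**) :: complex^'n^'n \<Rightarrow> complex^'n^'n \<Rightarrow> _)"
proof
  show "\<exists>K. \<forall>(a::complex^'n^'n) (b::complex^'n^'n). norm (a ** b) \<le> norm a * norm b * K"
    using norm_matrix_mult_le by (intro exI[of _ 1]) auto
qed (simp_all add: matrix_matrix_mult_def vec_eq_iff sum.distrib distrib_left distrib_right scaleR_sum_right)

lemma bounded_bilinear_matrix_vector: "bounded_bilinear ((*v) :: complex^'n^'n \<Rightarrow> _ \<Rightarrow> _)"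
proof
  show "\<exists>K. \<forall>(a::complex^'n^'n) b. norm (a *v b) \<le> norm a * norm b * K"
    using norm_matrix_vector_le by (intro exI[of _ 1]) auto
qed (simp_all add: matrix_vector_mult_def vec_eq_iff sum.distrib distrib_left distrib_right scaleR_sum_right)

lemma op_norm_bound: "norm ((A :: complex^'n^'n) *v v) \<le> op_norm A * norm v"
  unfolding op_norm_def by (rule onorm) simp

lemma op_norm_nonneg: "0 \<le> op_norm (A :: complex^'n^'n)"
  unfolding op_norm_def by (rule onorm_pos_le) simp

lemma op_norm_le: "(\<And>v. norm ((A :: complex^'n^'n) *v v) \<le> c * norm v) \<Longrightarrow> op_norm A \<le> c"
  unfolding op_norm_def by (rule onorm_le)

lemma norm_axis_complex: "norm (axis j 1 :: complex^'n) = 1"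
  unfolding norm_eq_sqrt_inner inner_axis_axis by (simp add: inner_complex_def)

lemma norm_le_op_norm: "(norm (A :: complex^'n^'n))\<^sup>2 \<le> CARD('n) * (op_norm A)\<^sup>2"
proof -
  have "(norm (A *v axis j 1))\<^sup>2 \<le> (op_norm A)\<^sup>2" for j
    using op_norm_bound[of A "axis j 1"] by (intro power_mono) (auto simp: norm_axis_complex)
  then show ?thesis
    unfolding norm_matrix_columns by (intro sum_bounded_above) auto
qed

lemma op_norm_conj_transpose_le: "op_norm (conj_transpose A) \<le> op_norm A"
proof (rule op_norm_le)
  fix v
  let ?w = "conj_transpose A *v v"
  have "(norm ?w)\<^sup>2 = (A *v ?w) \<bullet> v"
    by (simp add: inner_conj_transpose power2_norm_eq_inner)
  also have "\<dots> \<le> norm (A *v ?w) * norm v" by (rule norm_cauchy_schwarz)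
  also have "\<dots> \<le> op_norm A * norm ?w * norm v" by (intro mult_right_mono op_norm_bound) auto
  finally have "norm ?w * norm ?w \<le> (op_norm A * norm v) * norm ?w"
    by (simp add: power2_eq_square algebra_simps)
  then show "norm ?w \<le> op_norm A * norm v"
    using op_norm_nonneg[of A] by (cases "norm ?w = 0") (auto simp: mult_le_cancel_right)
qed

lemma op_norm_hermitian_mult_commute:
  assumes "hermitian A" "hermitian B"
  shows "op_norm (A ** B) \<le> op_norm (B ** A)"
  using op_norm_conj_transpose_le[of "B ** A"] assms
  by (simp add: conj_transpose_mult hermitian_iff_conj_transpose)

lemma op_norm_Lipschitz: "\<bar>op_norm A - op_norm B\<bar> \<le> norm (A - B :: complex^'n^'n)"
proof -
  have *: "op_norm A \<le> op_norm B + norm (A - B)" for A B :: "complex^'n^'n"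
  proof (rule op_norm_le)
    fix v
    have "norm (A *v v) \<le> norm (B *v v) + norm ((A - B) *v v)"
      using norm_triangle_ineq[of "B *v v" "(A - B) *v v"]
      by (simp add: matrix_vector_mult_diff_rdistrib)
    also have "\<dots> \<le> (op_norm B + norm (A - B)) * norm v"
      using op_norm_bound[of B v] norm_matrix_vector_le[of "A - B" v] by (simp add: algebra_simps)
    finally show "norm (A *v v) \<le> (op_norm B + norm (A - B)) * norm v" .
  qed
  show ?thesis using *[of A B] *[of B A] by (simp add: norm_minus_commute)
qed

lemma continuous_op_norm: "continuous_on UNIV (op_norm :: complex^'n^'n \<Rightarrow> real)"
  unfolding continuous_on_iff dist_norm
  using op_norm_Lipschitz by (metis le_less_trans real_norm_def)

section \<open>The positive definite square root\<close>

interpretation mm: bounded_bilinear "(**) :: complex^'n^'n \<Rightarrow> complex^'n^'n \<Rightarrow> _"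
  by (rule bounded_bilinear_matrix_mult)

interpretation mv: bounded_bilinear "(*v) :: complex^'n^'n \<Rightarrow> complex^'n \<Rightarrow> _"
  by (rule bounded_bilinear_matrix_vector)

lemma pos_def_iff: "pos_def A \<longleftrightarrow> hermitian A \<and> (\<forall>v. v \<noteq> 0 \<longrightarrow> 0 < (A *v v) \<bullet> v)"
  by (simp add: pos_def_def Re_quad_form)

lemma pos_semidef_iff: "pos_semidef A \<longleftrightarrow> hermitian A \<and> (\<forall>v. 0 \<le> (A *v v) \<bullet> v)"
  by (simp add: pos_semidef_def Re_quad_form)

lemma pos_def_imp_pos_semidef: "pos_def A \<Longrightarrow> pos_semidef A"
  unfolding pos_def_iff pos_semidef_iff
  by (metis inner_zero_right less_imp_le order_refl)

lemma pos_defI_coercive: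
  fixes A :: "complex^'n^'n"
  assumes "hermitian A" "0 < m" "\<And>v. m * (norm v)\<^sup>2 \<le> (A *v v) \<bullet> v"
  shows "pos_def A"
  unfolding pos_def_iff
proof (intro conjI allI impI assms)
  fix v :: "complex^'n" assume "v \<noteq> 0"
  then have "0 < m * (norm v)\<^sup>2" using assms(2) by simp
  then show "0 < (A *v v) \<bullet> v" using assms(3)[of v] by linarith
qed

lemma pos_def_coercive:
  assumes "pos_def (A :: complex^'n^'n)"
  obtains m where "0 < m" "\<And>v. m * (norm v)\<^sup>2 \<le> (A *v v) \<bullet> v"
proof -
  have ne: "sphere (0::complex^'n) 1 \<noteq> {}"
    using norm_axis_complex[where 'n='n] by (metis dist_0_norm empty_iff mem_sphere)
  have "continuous_on (sphere 0 1) (\<lambda>v. (A *v v) \<bullet> v)"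
    by (intro continuous_intros mv.continuous_on)
  then obtain w where w: "w \<in> sphere 0 1" "\<And>v. v \<in> sphere 0 1 \<Longrightarrow> (A *v w) \<bullet> w \<le> (A *v v) \<bullet> v"
    using continuous_attains_inf[OF compact_sphere ne] by blast
  have "w \<noteq> 0" using w(1) by auto
  then have pos: "0 < (A *v w) \<bullet> w" using assms unfolding pos_def_iff by blast
  have "(A *v w) \<bullet> w * (norm v)\<^sup>2 \<le> (A *v v) \<bullet> v" for v
  proof (cases "v = 0")
    case False
    define u where "u = (1 / norm v) *\<^sub>R v"
    have u: "u \<in> sphere 0 1" "v = norm v *\<^sub>R u" using False by (auto simp: u_def)
    have "(A *v v) \<bullet> v = (norm v)\<^sup>2 * ((A *v u) \<bullet> u)"
      by (subst (1 2) u(2)) (simp add: mv.scaleR_right power2_eq_square)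
    moreover have "(norm v)\<^sup>2 * ((A *v w) \<bullet> w) \<le> (norm v)\<^sup>2 * ((A *v u) \<bullet> u)"
      by (intro mult_left_mono w u) auto
    ultimately show ?thesis by (simp add: mult.commute)
  qed auto
  with pos that show ?thesis by blast
qed

lemma bounded_linear_conj_transpose: "bounded_linear conj_transpose"
proof (rule bounded_linear_intro[where K=1])
  show "norm (conj_transpose A) \<le> norm A * 1" for A :: "complex^'a^'a"
    by (simp add: norm_conj_transpose)
qed (simp_all add: conj_transpose_def vec_eq_iff)

lemma hermitian_add: "hermitian A \<Longrightarrow> hermitian B \<Longrightarrow> hermitian (A + B)"
  unfolding hermitian_iff_conj_transpose
  by (simp add: linear_add[OF bounded_linear.linear[OF bounded_linear_conj_transpose]])

lemma hermitian_diff: "hermitian A \<Longrightarrow> hermitian B \<Longrightarrow> hermitian (A - B)"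
  unfolding hermitian_iff_conj_transpose
  by (simp add: linear_diff[OF bounded_linear.linear[OF bounded_linear_conj_transpose]])

lemma hermitian_scaleR: "hermitian A \<Longrightarrow> hermitian (r *\<^sub>R A)"
  unfolding hermitian_iff_conj_transpose
  by (simp add: linear_cmul[OF bounded_linear.linear[OF bounded_linear_conj_transpose]])

lemma hermitian_mat_1: "hermitian (mat 1)"
  by (auto simp: hermitian_def mat_def)

lemma hermitian_square: "hermitian A \<Longrightarrow> hermitian (A ** A)"
  by (simp add: hermitian_iff_conj_transpose conj_transpose_mult)

lemma closed_hermitian: "closed {A. hermitian A}"
  unfolding hermitian_iff_conj_transpose
  by (intro closed_Collect_eq continuous_intros
      linear_continuous_on[OF bounded_linear_conj_transpose])

text \<open>This is the Cauchy--Schwarz inequality for the semidefinite form of \<open>C\<close>, obtained by expanding the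
form at \<open>c v - C v\<close>.\<close>

lemma norm_le_of_quadratic_form_le:
  fixes C :: "complex^'n^'n"
  assumes "hermitian C" and nonneg: "\<And>v. 0 \<le> (C *v v) \<bullet> v"
    and le: "\<And>v. (C *v v) \<bullet> v \<le> c * (norm v)\<^sup>2" and "0 < c"
  shows "norm (C *v v) \<le> c * norm v"
proof (rule power2_le_imp_le)
  define w where "w = C *v v"
  have vw: "(C *v w) \<bullet> v = w \<bullet> w" "(C *v v) \<bullet> w = w \<bullet> w"
    using hermitian_inner[OF assms(1), of w v] by (auto simp: w_def inner_commute)
  have "0 \<le> (C *v (c *\<^sub>R v - w)) \<bullet> (c *\<^sub>R v - w)" by (rule nonneg)
  also have "\<dots> = c\<^sup>2 * ((C *v v) \<bullet> v) - 2 * c * (w \<bullet> w) + (C *v w) \<bullet> w"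
    unfolding mv.diff_right mv.scaleR_right inner_diff_left inner_diff_right
      inner_scaleR_left inner_scaleR_right vw by (simp add: power2_eq_square algebra_simps)
  also have "\<dots> \<le> c\<^sup>2 * (c * (norm v)\<^sup>2) - 2 * c * (norm w)\<^sup>2 + c * (norm w)\<^sup>2"
    unfolding power2_norm_eq_inner[symmetric]
    by (intro add_mono diff_mono mult_left_mono le order_refl) auto
  also have "\<dots> = c * ((c * norm v)\<^sup>2 - (norm w)\<^sup>2)"
    by (simp add: power2_eq_square algebra_simps)
  finally show "(norm (C *v v))\<^sup>2 \<le> (c * norm v)\<^sup>2"
    using \<open>0 < c\<close> by (simp add: zero_le_mult_iff w_def)
qed (use \<open>0 < c\<close> in auto)

text \<open>The equation \<open>2 Y = C + Y\<^sup>2\<close> says \<open>(1 - Y)\<^sup>2 = 1 - C\<close>. Since \<open>Y\<^sup>2 - Z\<^sup>2 = Y (Y - Z) + (Y - Z) Z\<close>, the map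
\<open>Y \<mapsto> (C + Y\<^sup>2) / 2\<close> contracts the Hermitian matrices of operator norm at most \<open>c\<close> by the factor
\<open>c\<close>, measured in the Frobenius norm.\<close>

lemma contraction_square_fixpoint:
  fixes C :: "complex^'n^'n"
  assumes "hermitian C" and C: "\<And>v. norm (C *v v) \<le> c * norm v" and c: "0 \<le> c" "c < 1"
  obtains Y where "hermitian Y" "\<And>v. norm (Y *v v) \<le> c * norm v" "2 *\<^sub>R Y = C + Y ** Y"
proof -
  define s where "s = {Y :: complex^'n^'n. hermitian Y} \<inter> {Y. \<forall>v. norm (Y *v v) \<le> c * norm v}"
  define f where "f Y = (1/2) *\<^sub>R (C + Y ** Y)" for Y :: "complex^'n^'n"
  have "closed s"
    unfolding s_def
    by (intro closed_Int closed_hermitian closed_Collect_all closed_Collect_le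
        continuous_intros mv.continuous_on)
  then have "complete s" by (simp add: complete_eq_closed)
  moreover have "0 \<in> s"
    using c by (auto simp: s_def hermitian_def)
  moreover have "f Y \<in> s" if "Y \<in> s" for Y
  proof -
    have Y: "norm (Y *v v) \<le> c * norm v" for v using that by (simp add: s_def)
    have "norm (f Y *v v) \<le> c * norm v" for v
    proof -
      have "norm (Y *v (Y *v v)) \<le> c * (c * norm v)"
        using Y[of "Y *v v"] mult_left_mono[OF Y[of v] c(1)] by linarith
      also have "\<dots> \<le> 1 * (c * norm v)"
        using c by (intro mult_right_mono) auto
      finally have "norm (C *v v) + norm (Y *v (Y *v v)) \<le> 2 * (c * norm v)"
        using C[of v] by simp
      moreover have "f Y *v v = (1/2) *\<^sub>R (C *v v + Y *v (Y *v v))"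
        by (simp add: f_def mv.scaleR_left mv.add_left matrix_vector_mul_assoc)
      ultimately show ?thesis
        using norm_triangle_ineq[of "C *v v" "Y *v (Y *v v)"] by simp
    qed
    then show ?thesis
      using that assms(1)
      by (auto simp: s_def f_def intro!: hermitian_scaleR hermitian_add hermitian_square)
  qed
  moreover have "dist (f Y) (f Z) \<le> c * dist Y Z" if "Y \<in> s" "Z \<in> s" for Y Z
  proof -
    have Y: "hermitian Y" "\<And>v. norm (Y *v v) \<le> c * norm v"
      and Z: "hermitian Z" "\<And>v. norm (Z *v v) \<le> c * norm v" using that by (auto simp: s_def)
    have "f Y - f Z = (1/2) *\<^sub>R (Y ** (Y - Z) + (Y - Z) ** Z)"
      by (simp add: f_def mm.diff_left mm.diff_right scaleR_diff_right scaleR_add_right)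
    moreover have "norm (Y ** (Y - Z)) \<le> c * norm (Y - Z)"
      by (rule norm_matrix_mult_bound[OF Y(2) c(1)])
    moreover have "norm ((Y - Z) ** Z) \<le> c * norm (Y - Z)"
      using norm_matrix_mult_bound[OF Z(2) c(1), of "Y - Z"]
        norm_hermitian_mult_commute[OF hermitian_diff[OF Y(1) Z(1)] Z(1)] by simp
    ultimately show ?thesis
      using norm_triangle_ineq[of "Y ** (Y - Z)" "(Y - Z) ** Z"] by (simp add: dist_norm)
  qed
  ultimately obtain Y where Y: "Y \<in> s" "f Y = Y"
    using Banach_fix[of s c f] c by blast
  have "2 *\<^sub>R f Y = C + Y ** Y" by (simp add: f_def)
  with Y that show ?thesis by (auto simp: s_def)
qed

text \<open>Divide \<open>A\<close> by an upper bound \<open>t\<close> of its quadratic form; then \<open>C = 1 - A / t\<close> has operator norm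
below \<open>1\<close>, and the fixed point \<open>Y\<close> for \<open>C\<close> yields the root \<open>\<surd>t (1 - Y)\<close>.\<close>

lemma pos_def_sqrt_exists:
  fixes A :: "complex^'n^'n"
  assumes "pos_def A"
  obtains S where "pos_def S" "S ** S = A"
proof -
  obtain m where m: "0 < m" "\<And>v. m * (norm v)\<^sup>2 \<le> (A *v v) \<bullet> v"
    using pos_def_coercive[OF assms] by blast
  define t where "t = norm A + m"
  have t: "0 < t" "m \<le> t" using m(1) by (auto simp: t_def add_nonneg_pos)
  \<comment> \<open>The factor 2 makes \<open>c\<close> positive knowing only \<open>m \<le> t\<close>.\<close>
  define c where "c = 1 - m / (2 * t)"
  have c: "0 < c" "c < 1" using m(1) t by (auto simp: c_def field_simps)
  define C where "C = mat 1 - (1/t) *\<^sub>R A"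
  have hA: "hermitian A" using assms by (simp add: pos_def_iff)
  have hC: "hermitian C"
    unfolding C_def by (intro hermitian_diff hermitian_mat_1 hermitian_scaleR hA)
  have Cv: "(C *v v) \<bullet> v = (norm v)\<^sup>2 - ((A *v v) \<bullet> v) / t" for v
    by (simp add: C_def mv.diff_left mv.scaleR_left inner_diff_left power2_norm_eq_inner)
  have up: "(A *v v) \<bullet> v \<le> t * (norm v)\<^sup>2" for v
  proof -
    have "(A *v v) \<bullet> v \<le> norm (A *v v) * norm v" by (rule norm_cauchy_schwarz)
    also have "\<dots> \<le> (norm A * norm v) * norm v" by (intro mult_right_mono norm_matrix_vector_le) auto
    also have "\<dots> \<le> t * (norm v)\<^sup>2"
      using m(1) by (auto simp: power2_eq_square t_def mult.assoc intro!: mult_right_mono)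
    finally show ?thesis .
  qed
  have "norm (C *v v) \<le> c * norm v" for v
  proof (rule norm_le_of_quadratic_form_le[OF hC _ _ c(1)])
    show "0 \<le> (C *v v) \<bullet> v" for v
      using up[of v] t(1) by (simp add: Cv field_simps)
    have "m * (norm v)\<^sup>2 \<le> 2 * ((A *v v) \<bullet> v)" for v
      using m(2)[of v] mult_nonneg_nonneg[OF less_imp_le[OF m(1)] zero_le_power2[of "norm v"]] by linarith
    then show "(C *v v) \<bullet> v \<le> c * (norm v)\<^sup>2" for v
      using t(1) by (simp add: Cv c_def field_simps)
  qed
  then obtain Y where Y: "hermitian Y" "\<And>v. norm (Y *v v) \<le> c * norm v" "2 *\<^sub>R Y = C + Y ** Y"
    using contraction_square_fixpoint[OF hC] c by (metis less_imp_le)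
  define S where "S = sqrt t *\<^sub>R (mat 1 - Y)"
  have hS: "hermitian S"
    unfolding S_def by (intro hermitian_diff hermitian_mat_1 hermitian_scaleR Y)
  have "(mat 1 - Y) ** (mat 1 - Y) = mat 1 - 2 *\<^sub>R Y + Y ** Y"
    by (simp add: mm.diff_left mm.diff_right scaleR_2)
  also have "\<dots> = (1/t) *\<^sub>R A" using Y(3) by (simp add: C_def)
  finally have "S ** S = A"
    using t(1) by (simp add: S_def mm.scaleR_left mm.scaleR_right)
  moreover have "pos_def S"
  proof (rule pos_defI_coercive[OF hS])
    show "0 < sqrt t * (1 - c)" using t c by simp
    fix v
    have "(Y *v v) \<bullet> v \<le> c * norm v * norm v"
      using norm_cauchy_schwarz[of "Y *v v" v] mult_right_mono[OF Y(2)[of v], of "norm v"] by simp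
    then have "(1 - c) * (norm v)\<^sup>2 \<le> v \<bullet> v - (Y *v v) \<bullet> v"
      by (simp add: algebra_simps power2_norm_eq_inner[symmetric] power2_eq_square)
    then have "sqrt t * ((1 - c) * (norm v)\<^sup>2) \<le> sqrt t * (v \<bullet> v - (Y *v v) \<bullet> v)"
      using t(1) by (intro mult_left_mono) auto
    then show "sqrt t * (1 - c) * (norm v)\<^sup>2 \<le> (S *v v) \<bullet> v"
      by (simp add: S_def mv.diff_left mv.scaleR_left inner_diff_left mult.assoc)
  qed
  ultimately show ?thesis using that by blast
qed

text \<open>With \<open>D = S - T\<close> one has \<open>S\<^sup>2 - T\<^sup>2 = S D + D T\<close>. Pairing this with \<open>D\<close> in the Frobenius inner product
leaves the sum of the forms of \<open>S\<close> and of \<open>T\<close> on the columns of \<open>D\<close>. This gives at once the uniqueness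
of the square root and its continuity.\<close>

lemma sqrt_difference_bound:
  fixes S T :: "complex^'n^'n"
  assumes "hermitian S" "hermitian T" and S: "\<And>v. m * (norm v)\<^sup>2 \<le> (S *v v) \<bullet> v"
    and T: "\<And>v. 0 \<le> (T *v v) \<bullet> v"
  shows "m * norm (S - T) \<le> norm (S ** S - T ** T)"
proof -
  define D where "D = S - T"
  have hD: "hermitian D" unfolding D_def by (intro hermitian_diff assms)
  have "m * (norm D)\<^sup>2 = (\<Sum>j\<in>UNIV. m * (norm (D *v axis j 1))\<^sup>2)"
    by (simp add: norm_matrix_columns sum_distrib_left)
  also have "\<dots> \<le> (\<Sum>j\<in>UNIV. (S *v (D *v axis j 1)) \<bullet> (D *v axis j 1))"
    by (intro sum_mono S)
  also have "\<dots> = (S ** D) \<bullet> D"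
    by (simp add: inner_matrix_columns matrix_vector_mul_assoc)
  also have "\<dots> \<le> (S ** D) \<bullet> D + (T ** D) \<bullet> D"
    using T by (auto simp: inner_matrix_columns[of "T ** D"] matrix_vector_mul_assoc[symmetric]
        intro!: sum_nonneg)
  also have "(T ** D) \<bullet> D = (D ** T) \<bullet> D"
    using inner_conj_transpose_both[of "T ** D" D] hD assms(2)
    by (simp add: conj_transpose_mult hermitian_iff_conj_transpose)
  also have "(S ** D) \<bullet> D + (D ** T) \<bullet> D = (S ** S - T ** T) \<bullet> D"
    by (simp add: D_def mm.diff_left mm.diff_right inner_diff_left)
  also have "\<dots> \<le> norm (S ** S - T ** T) * norm D" by (rule norm_cauchy_schwarz)
  finally have "(m * norm D) * norm D \<le> norm (S ** S - T ** T) * norm D"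
    by (simp add: power2_eq_square mult.assoc)
  then show ?thesis
    unfolding D_def[symmetric] by (cases "D = 0") (auto simp: mult_le_cancel_right)
qed

lemma
  fixes A :: "complex^'n^'n"
  assumes "pos_def A"
  shows pos_def_mat_sqrt: "pos_def (mat_sqrt A)" and mat_sqrt_square: "mat_sqrt A ** mat_sqrt A = A"
proof -
  obtain S where S: "pos_def S" "S ** S = A" using pos_def_sqrt_exists[OF assms] by blast
  obtain m where m: "0 < m" "\<And>v. m * (norm v)\<^sup>2 \<le> (S *v v) \<bullet> v"
    using pos_def_coercive[OF S(1)] by blast
  have "T = S" if "pos_semidef T \<and> T ** T = A" for T
  proof -
    have "m * norm (S - T) \<le> norm (S ** S - T ** T)"
      using that S by (intro sqrt_difference_bound m) (auto simp: pos_def_iff pos_semidef_iff)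
    then show ?thesis using m(1) that S by (auto simp: mult_le_0_iff)
  qed
  then have "mat_sqrt A = S"
    unfolding mat_sqrt_def using S by (intro the_equality) (auto intro: pos_def_imp_pos_semidef)
  with S show "pos_def (mat_sqrt A)" "mat_sqrt A ** mat_sqrt A = A" by auto
qed

lemma pos_def_matrix_inv:
  fixes S :: "complex^'n^'n"
  assumes "pos_def S"
  shows "S ** matrix_inv S = mat 1" "matrix_inv S ** S = mat 1" "hermitian (matrix_inv S)"
proof -
  have "inj ((*v) S)"
  proof (rule injI)
    fix x y assume "S *v x = S *v y"
    then have "(S *v (x - y)) \<bullet> (x - y) = 0" by (simp add: mv.diff_right)
    then show "x = y" using assms unfolding pos_def_iff by (metis eq_iff_diff_eq_0 less_irrefl)
  qed
  then obtain B where "B ** S = mat 1" using matrix_left_invertible_injective by blast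
  then have "invertible S" unfolding invertible_def using matrix_left_right_inverse by blast
  then have *: "S ** matrix_inv S = mat 1 \<and> matrix_inv S ** S = mat 1"
    unfolding invertible_def matrix_inv_def by (rule someI_ex)
  then show "S ** matrix_inv S = mat 1" "matrix_inv S ** S = mat 1" by auto
  have "hermitian S" using assms by (simp add: pos_def_iff)
  then have "conj_transpose (matrix_inv S) ** S = mat 1"
    using arg_cong[OF conjunct1[OF *], of conj_transpose] hermitian_mat_1
    by (simp add: conj_transpose_mult hermitian_iff_conj_transpose)
  then have "conj_transpose (matrix_inv S) ** (S ** matrix_inv S) = matrix_inv S"
    by (simp add: matrix_mul_assoc)
  then show "hermitian (matrix_inv S)" by (simp add: * hermitian_iff_conj_transpose)
qed

lemma mat_inv_sqrt:
  fixes A :: "complex^'n^'n"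
  assumes "pos_def A"
  shows "mat_sqrt A ** mat_inv_sqrt A = mat 1" "mat_inv_sqrt A ** mat_sqrt A = mat 1"
    "hermitian (mat_inv_sqrt A)" "hermitian (mat_sqrt A)"
  using pos_def_matrix_inv[OF pos_def_mat_sqrt[OF assms]] pos_def_mat_sqrt[OF assms]
  by (auto simp: mat_inv_sqrt_def pos_def_iff)

lemma continuous_on_mat_sqrt: "continuous_on {A :: complex^'n^'n. pos_def A} mat_sqrt"
  unfolding continuous_on_iff
proof (intro ballI allI impI, unfold mem_Collect_eq)
  fix A :: "complex^'n^'n" and e :: real assume A: "pos_def A" and "0 < e"
  obtain m where m: "0 < m" "\<And>v. m * (norm v)\<^sup>2 \<le> (mat_sqrt A *v v) \<bullet> v"
    using pos_def_coercive[OF pos_def_mat_sqrt[OF A]] by blast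
  have "dist (mat_sqrt B) (mat_sqrt A) < e" if B: "pos_def B" "dist B A < m * e" for B
  proof -
    have "m * norm (mat_sqrt A - mat_sqrt B) \<le> norm (A - B)"
      using sqrt_difference_bound[OF _ _ m(2), of "mat_sqrt B"] A B(1)
        pos_def_imp_pos_semidef[OF pos_def_mat_sqrt[OF B(1)]]
      by (simp add: mat_inv_sqrt mat_sqrt_square pos_semidef_iff)
    also have "\<dots> < m * e" using B(2) by (simp add: dist_norm norm_minus_commute)
    finally show ?thesis using m(1) by (simp add: dist_norm norm_minus_commute)
  qed
  then show "\<exists>d>0. \<forall>x'\<in>{A. pos_def A}. dist x' A < d \<longrightarrow> dist (mat_sqrt x') (mat_sqrt A) < e"
    using m(1) \<open>0 < e\<close> by (intro exI[of _ "m * e"]) auto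
qed

text \<open>The resolvent identity \<open>S\<^sup>-\<^sup>1 - T\<^sup>-\<^sup>1 = S\<^sup>-\<^sup>1 (T - S) T\<^sup>-\<^sup>1\<close> first bounds \<open>S\<^sup>-\<^sup>1\<close> near \<open>T\<close> and then the
difference.\<close>

lemma tendsto_matrix_inv_pos_def:
  fixes S :: "'a \<Rightarrow> complex^'n^'n"
  assumes lim: "(S \<longlongrightarrow> T) F" and T: "pos_def T" and S: "\<And>x. pos_def (S x)"
  shows "((\<lambda>x. matrix_inv (S x)) \<longlongrightarrow> matrix_inv T) F"
proof -
  define K where "K = norm (matrix_inv T)"
  have diff: "matrix_inv (S x) - matrix_inv T = matrix_inv (S x) ** ((T - S x) ** matrix_inv T)" for x
    using pos_def_matrix_inv[OF T] pos_def_matrix_inv[OF S, of x]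
    by (simp add: mm.diff_left mm.diff_right matrix_mul_assoc)
  have le: "norm (matrix_inv (S x) - matrix_inv T) \<le> norm (matrix_inv (S x)) * (norm (T - S x) * K)" for x
    unfolding diff K_def
    by (intro order_trans[OF norm_matrix_mult_le] mult_left_mono norm_matrix_mult_le) auto
  have d0: "((\<lambda>x. norm (T - S x) * K) \<longlongrightarrow> norm (T - T) * K) F"
    by (intro tendsto_intros lim)
  then have "\<forall>\<^sub>F x in F. norm (T - S x) * K < 1/2"
    by (rule order_tendstoD) simp
  then have "\<forall>\<^sub>F x in F. norm (matrix_inv (S x) - matrix_inv T) \<le> 2 * K * (norm (T - S x) * K)"
  proof (rule eventually_mono)
    fix x assume x: "norm (T - S x) * K < 1/2"
    have "norm (matrix_inv (S x)) \<le> K + norm (matrix_inv (S x) - matrix_inv T)"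
      using norm_triangle_ineq[of "matrix_inv T" "matrix_inv (S x) - matrix_inv T"] by (simp add: K_def)
    also have "\<dots> \<le> K + norm (matrix_inv (S x)) * (1/2)"
      using le[of x] mult_left_mono[OF less_imp_le[OF x], of "norm (matrix_inv (S x))"] by simp
    finally have "norm (matrix_inv (S x)) \<le> 2 * K" by simp
    then show "norm (matrix_inv (S x) - matrix_inv T) \<le> 2 * K * (norm (T - S x) * K)"
      using le[of x] mult_right_mono[of _ "2 * K" "norm (T - S x) * K"] by (force simp: K_def)
  qed
  moreover have "((\<lambda>x. 2 * K * (norm (T - S x) * K)) \<longlongrightarrow> 0) F"
    using tendsto_mult_left[OF d0, of "2 * K"] by simp
  ultimately have "((\<lambda>x. matrix_inv (S x) - matrix_inv T) \<longlongrightarrow> 0) F"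
    by (rule Lim_null_comparison)
  then show ?thesis by (simp add: LIM_zero_iff)
qed

lemma continuous_on_mat_inv_sqrt: "continuous_on {A :: complex^'n^'n. pos_def A} mat_inv_sqrt"
  unfolding continuous_on_def mat_inv_sqrt_def
proof (intro ballI, unfold mem_Collect_eq)
  fix A :: "complex^'n^'n" assume A: "pos_def A"
  have "((\<lambda>B. if pos_def B then mat_sqrt B else mat_sqrt A) \<longlongrightarrow> mat_sqrt A) (at A within {A. pos_def A})"
    using continuous_on_mat_sqrt A unfolding continuous_on_def
    by (auto intro: Lim_transform_within[where d=1, rotated 2])
  then have "((\<lambda>B. matrix_inv (if pos_def B then mat_sqrt B else mat_sqrt A)) \<longlongrightarrow> matrix_inv (mat_sqrt A))
      (at A within {A. pos_def A})"
    by (rule tendsto_matrix_inv_pos_def) (auto simp: A pos_def_mat_sqrt)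
  then show "((\<lambda>B. matrix_inv (mat_sqrt B)) \<longlongrightarrow> matrix_inv (mat_sqrt A)) (at A within {A. pos_def A})"
    by (rule Lim_transform_within[where d=1]) auto
qed

text \<open>Coercivity exhibits the positive definite matrices as a countable union of closed sets.\<close>

lemma pos_def_borel: "{A :: complex^'n^'n. pos_def A} \<in> sets borel"
proof -
  let ?C = "\<lambda>k::nat. {A :: complex^'n^'n. hermitian A} \<inter>
    {A. \<forall>v. (1 / Suc k) * (norm v)\<^sup>2 \<le> (A *v v) \<bullet> v}"
  have "{A :: complex^'n^'n. pos_def A} = (\<Union>k. ?C k)"
  proof (intro equalityI subsetI)
    fix A :: "complex^'n^'n" assume "A \<in> {A. pos_def A}"
    then have A: "pos_def A" by simp
    obtain m where m: "0 < m" "\<And>v. m * (norm v)\<^sup>2 \<le> (A *v v) \<bullet> v"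
      using pos_def_coercive[OF A] by blast
    obtain k where "1 / real (Suc k) < m" using m(1) nat_approx_posE by blast
    then have "(1 / Suc k) * (norm v)\<^sup>2 \<le> (A *v v) \<bullet> v" for v
      using m(2)[of v] by (meson less_imp_le mult_right_mono order_trans zero_le_power2)
    then show "A \<in> (\<Union>k. ?C k)" using A by (auto simp: pos_def_iff)
  next
    fix A assume "A \<in> (\<Union>k. ?C k)"
    then show "A \<in> {A. pos_def A}"
      using pos_defI_coercive[of A "1 / real (Suc _)"] by (auto simp del: of_nat_Suc)
  qed
  moreover have "closed (?C k)" for k
    by (intro closed_Int closed_hermitian closed_Collect_all closed_Collect_le
        continuous_intros mv.continuous_on)
  ultimately show ?thesis by (simp only: borel_closed sets.countable_UN[OF image_subsetI])
qed

lemma borel_measurable_matrix_mult [measurable (raw)]: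
  fixes f g :: "'a \<Rightarrow> complex^'n^'n"
  assumes [measurable]: "f \<in> borel_measurable M" "g \<in> borel_measurable M"
  shows "(\<lambda>x. f x ** g x) \<in> borel_measurable M"
proof -
  have "(\<lambda>(a :: complex^'n^'n, b :: complex^'n^'n). a ** b) \<in> borel_measurable (borel \<Otimes>\<^sub>M borel)"
    unfolding borel_prod split_def
    by (intro borel_measurable_continuous_onI mm.continuous_on continuous_intros)
  from measurable_compose[OF _ this, of "\<lambda>x. (f x, g x)"] show ?thesis by simp
qed

lemma borel_measurable_matrix_vector_mult [measurable (raw)]:
  fixes f :: "'a \<Rightarrow> complex^'n^'n" and g :: "'a \<Rightarrow> complex^'n"
  assumes [measurable]: "f \<in> borel_measurable M" "g \<in> borel_measurable M"
  shows "(\<lambda>x. f x *v g x) \<in> borel_measurable M"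
proof -
  have "(\<lambda>(a :: complex^'n^'n, b :: complex^'n). a *v b) \<in> borel_measurable (borel \<Otimes>\<^sub>M borel)"
    unfolding borel_prod split_def
    by (intro borel_measurable_continuous_onI mv.continuous_on continuous_intros)
  from measurable_compose[OF _ this, of "\<lambda>x. (f x, g x)"] show ?thesis by simp
qed

section \<open>Dyadic cubes\<close>

text \<open>As a simplification rule this fact replaces the Lebesgue measure of a set by the Borel measure of its
main part, which hides the sets at hand.\<close>

declare emeasure_completion [simp del]

lemma two_powi_le_iff: "(2::real) powi k \<le> 2 powi l \<longleftrightarrow> k \<le> l"
  using power_int_increasing[of k l "2::real"] power_int_strict_increasing[of l k "2::real"]
  by (cases "k \<le> l") auto

lemma cube_borel: "cube a l \<in> sets borel"
proof -
  have "cube a l = (\<Inter>i\<in>UNIV. {x. a $ i \<le> x $ i} \<inter> {x. x $ i < a $ i + l})"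
    by (auto simp: cube_def)
  also have "\<dots> \<in> sets borel"
    by (intro sets.finite_INT sets.Int borel_closed borel_open closed_Collect_le open_Collect_less
        continuous_intros) auto
  finally show ?thesis .
qed

lemma cube_sets [measurable, simp]: "cube a l \<in> sets lebesgue"
  using cube_borel[of a l] by (simp add: sets_completionI_sets)

text \<open>A half-open cube lies between an open and a closed box of the same volume.\<close>

lemma emeasure_cube:
  fixes a :: "real^'d"
  assumes "0 \<le> l"
  shows "emeasure lebesgue (cube a l) = ennreal (l ^ CARD('d))"
proof -
  define b where "b = a + (\<chi> i. l)"
  have ab: "a $ i \<le> b $ i" "b $ i - a $ i = l" for i using assms by (auto simp: b_def)
  have basis: "Basis = (\<lambda>i. axis i 1 :: real^'d) ` UNIV" by (auto simp: Basis_vec_def)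
  have inj: "inj (\<lambda>i. axis i 1 :: real^'d)" by (auto simp: inj_on_def axis_eq_axis)
  have prod: "(\<Prod>i\<in>Basis. (b - a) \<bullet> i) = l ^ CARD('d)"
    unfolding basis using ab by (subst prod.reindex[OF inj]) (simp add: inner_axis)
  have le: "a \<bullet> i \<le> b \<bullet> i" if "i \<in> Basis" for i
    using that ab by (auto simp: basis inner_axis)
  have "emeasure lborel (box a b) \<le> emeasure lborel (cube a l)"
    using cube_borel by (intro emeasure_mono) (auto simp: mem_box_cart cube_def b_def intro: less_imp_le)
  moreover have "emeasure lborel (cube a l) \<le> emeasure lborel (cbox a b)"
    by (intro emeasure_mono) (auto simp: mem_box_cart cube_def b_def order.strict_implies_order)
  ultimately have "emeasure lborel (cube a l) = ennreal (l ^ CARD('d))"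
    using emeasure_lborel_box[OF le] emeasure_lborel_cbox[OF le] prod by (simp add: antisym)
  then show ?thesis using cube_borel[of a l] by (simp add: emeasure_completion)
qed

lemma cube_norm_le:
  fixes x :: "real^'d" and l :: real
  assumes "x \<in> cube a l" "y \<in> cube a l"
  shows "norm (x - y) \<le> CARD('d) * l"
proof -
  have "\<bar>(x - y) $ i\<bar> \<le> l" for i
  proof -
    have "a $ i \<le> x $ i" "x $ i < a $ i + l" "a $ i \<le> y $ i" "y $ i < a $ i + l"
      using assms by (auto simp: cube_def)
    then show ?thesis by simp
  qed
  note * = this
  have "norm (x - y) \<le> (\<Sum>i\<in>UNIV. \<bar>(x - y) $ i\<bar>)" by (rule norm_le_l1_cart)
  also have "\<dots> \<le> (\<Sum>i\<in>(UNIV::'d set). l)"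
    by (intro sum_mono *)
  finally show ?thesis by simp
qed

lemma nn_integral_disjoint_Union:
  assumes "countable G" "G \<subseteq> sets M" "disjoint G" and f: "f \<in> borel_measurable M"
  shows "(\<integral>\<^sup>+J. (\<integral>\<^sup>+x\<in>J. f x \<partial>M) \<partial>count_space G) = (\<integral>\<^sup>+x\<in>\<Union>G. f x \<partial>M)"
proof -
  have *: "(\<integral>\<^sup>+x\<in>J. f x \<partial>M) = emeasure (density M f) J" if "J \<in> sets M" for J
    using that f by (simp add: emeasure_density)
  have "emeasure (density M f) (\<Union>J\<in>G. J) = (\<integral>\<^sup>+J. emeasure (density M f) J \<partial>count_space G)"
    using assms by (intro emeasure_UN_countable) (auto simp: disjoint_family_on_disjoint_image disjoint_def disjoint_family_on_def)
  moreover have "\<Union>G \<in> sets M" using assms by (metis sets.countable_Union)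
  ultimately show ?thesis
    using assms(2) by (auto simp: * intro!: nn_integral_cong)
qed

lemma emeasure_disjoint_Union:
  assumes "countable G" "G \<subseteq> sets M" "disjoint G"
  shows "(\<integral>\<^sup>+J. emeasure M J \<partial>count_space G) = emeasure M (\<Union>G)"
proof -
  have "\<Union>G \<in> sets M" using assms by (metis sets.countable_Union)
  moreover have "(\<integral>\<^sup>+J. (\<integral>\<^sup>+x\<in>J. 1 \<partial>M) \<partial>count_space G) = (\<integral>\<^sup>+J. emeasure M J \<partial>count_space G)"
    using assms(2) by (intro nn_integral_cong) (auto simp: nn_integral_indicator)
  ultimately show ?thesis using nn_integral_disjoint_Union[OF assms, of "\<lambda>_. 1"] by simp
qed

locale dyadic =
  fixes D :: "(real^'d) set set"
  assumes grid: "dyadic_grid D"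
begin

definition gen :: "int \<Rightarrow> (real^'d) set set" where
  "gen k = {I\<in>D. \<exists>a. I = cube a (2 powi k)}"

definition lev :: "(real^'d) set \<Rightarrow> int" where
  "lev I = (THE k. I \<in> gen k)"

definition vol :: "(real^'d) set \<Rightarrow> real" where
  "vol I = (2 powi lev I) ^ CARD('d)"

definition maximal :: "(real^'d) set set \<Rightarrow> (real^'d) set set" where
  "maximal F = {J\<in>F. \<forall>J'\<in>F. J \<subseteq> J' \<longrightarrow> J' = J}"

lemma gen_subset: "I \<in> gen k \<Longrightarrow> I \<in> D"
  by (simp add: gen_def)

lemma gen_emeasure: "I \<in> gen k \<Longrightarrow> emeasure lebesgue I = ennreal ((2 powi k) ^ CARD('d))"
  by (auto simp: gen_def emeasure_cube)

lemma gen_unique: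
  assumes "I \<in> gen k" "I \<in> gen l" shows "k = l"
proof -
  have "ennreal ((2 powi k) ^ CARD('d)) = ennreal ((2 powi l) ^ CARD('d))"
    using gen_emeasure[OF assms(1)] gen_emeasure[OF assms(2)] by simp
  then have "(2 powi k) ^ CARD('d) = ((2::real) powi l) ^ CARD('d)" by simp
  then have "(2::real) powi k = 2 powi l"
    by (rule power_eq_imp_eq_base) auto
  then show ?thesis by (intro antisym) (simp_all flip: two_powi_le_iff)
qed

lemma gen_ex: "I \<in> D \<Longrightarrow> \<exists>k. I \<in> gen k"
  using conjunct1[OF grid[unfolded dyadic_grid_def]] unfolding gen_def by fast

lemma gen_lev: "I \<in> D \<Longrightarrow> I \<in> gen (lev I)"
  using gen_ex gen_unique unfolding lev_def by (metis the_equality)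

lemma lev_gen: "I \<in> gen k \<Longrightarrow> lev I = k"
  using gen_lev gen_subset gen_unique by blast

lemma partition_gen: "partition_on UNIV (gen k)"
  using conjunct2[OF conjunct2[OF grid[unfolded dyadic_grid_def]]] unfolding gen_def by blast

lemma emeasure_D: "I \<in> D \<Longrightarrow> emeasure lebesgue I = ennreal (vol I)"
  using gen_emeasure[OF gen_lev] by (simp add: vol_def)

lemma vol_pos: "0 < vol I" by (simp add: vol_def)

lemma vol_nonneg [simp]: "0 \<le> vol I" using vol_pos[of I] by simp

lemma sets_D: "I \<in> D \<Longrightarrow> I \<in> sets lebesgue"
proof -
  assume "I \<in> D"
  then obtain a where a: "I = cube a (2 powi lev I)" using gen_lev[of I] by (auto simp: gen_def)
  show ?thesis by (subst a) (rule cube_sets)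
qed

lemma nested: "I \<in> D \<Longrightarrow> J \<in> D \<Longrightarrow> I \<inter> J = {} \<or> I \<subseteq> J \<or> J \<subseteq> I"
  using conjunct1[OF conjunct2[OF grid[unfolded dyadic_grid_def]]] by blast

lemma lev_mono:
  assumes "I \<in> D" "J \<in> D" "I \<subseteq> J" shows "lev I \<le> lev J"
proof -
  have "ennreal (vol I) \<le> ennreal (vol J)"
    using emeasure_mono[OF assms(3) sets_D[OF assms(2)]]
    unfolding emeasure_D[OF assms(1)] emeasure_D[OF assms(2)] .
  then have "(2 powi lev I) ^ CARD('d) \<le> ((2::real) powi lev J) ^ CARD('d)"
    by (simp add: vol_def)
  then have "(2::real) powi lev I \<le> 2 powi lev J"
    by (subst (asm) power_mono_iff) auto
  then show ?thesis by (simp add: two_powi_le_iff)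
qed

lemma same_lev_eq:
  assumes "I \<in> D" "J \<in> D" "lev I = lev J" "I \<inter> J \<noteq> {}" shows "I = J"
  using partition_gen[of "lev I"] gen_lev[OF assms(1)] gen_lev[OF assms(2)] assms(3,4)
  by (auto simp: partition_on_def disjoint_def)

lemma D_nonempty: "I \<in> D \<Longrightarrow> I \<noteq> {}"
  using partition_gen[of "lev I"] gen_lev[of I] by (auto simp: partition_on_def)

lemma subset_if_lev_le:
  assumes "I \<in> D" "J \<in> D" "lev I \<le> lev J" "I \<inter> J \<noteq> {}" shows "I \<subseteq> J"
proof -
  have "I = J" if "J \<subseteq> I"
  proof (rule same_lev_eq[OF assms(1,2) _ assms(4)])
    show "lev I = lev J" by (rule antisym[OF assms(3) lev_mono[OF assms(2,1) that]])
  qed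
  with nested[OF assms(1,2)] assms(4) show ?thesis by blast
qed

lemma lev_less:
  assumes "I \<in> D" "J \<in> D" "I \<subset> J" shows "lev I < lev J"
proof -
  have "I \<subseteq> J" "I \<noteq> J" "I \<inter> J \<noteq> {}" using assms(3) D_nonempty[OF assms(1)] by auto
  then show ?thesis
    using lev_mono[OF assms(1,2)] same_lev_eq[OF assms(1,2)] by (metis order_le_imp_less_or_eq)
qed

lemma ex_cube_at: obtains I where "I \<in> D" "lev I = k" "x \<in> I"
  using partition_gen[of k] gen_subset lev_gen unfolding partition_on_def by (metis UNIV_I UnionE)

lemma ex_ancestor:
  assumes "I \<in> D" "lev I \<le> k"
  obtains J where "J \<in> D" "lev J = k" "I \<subseteq> J"
proof -
  obtain x where x: "x \<in> I" using D_nonempty[OF assms(1)] by auto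
  obtain J where J: "J \<in> D" "lev J = k" "x \<in> J" using ex_cube_at by blast
  have "I \<subseteq> J" using subset_if_lev_le[OF assms(1) J(1)] J assms(2) x by auto
  with J that show ?thesis by blast
qed

text \<open>A stopping cube \<open>I\<close> inside \<open>Q\<close> has a predecessor that is still inside \<open>Q\<close>; if \<open>I\<close> is maximal, this
predecessor does not satisfy the stopping condition, so averages over \<open>I\<close> exceed the threshold by at most
the ratio of the volumes.\<close>

lemma parent:
  assumes "I \<in> D" "Q \<in> D" "I \<subset> Q"
  obtains J where "J \<in> D" "I \<subset> J" "J \<subseteq> Q" "vol J = 2 ^ CARD('d) * vol I"
proof -
  have less: "lev I < lev Q" using assms by (rule lev_less)
  obtain J where J: "J \<in> D" "lev J = lev I + 1" "I \<subseteq> J"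
    using ex_ancestor[OF assms(1), of "lev I + 1"] by auto
  have "J \<subseteq> Q"
    using subset_if_lev_le[OF J(1) assms(2)] J less assms D_nonempty[OF assms(1)] by auto
  moreover have "vol J = 2 ^ CARD('d) * vol I"
    by (simp add: vol_def J power_int_add power_mult_distrib)
  moreover have "I \<noteq> J" using J(2) by auto
  ultimately show ?thesis using that J by blast
qed

text \<open>A cube is determined by its size and by any of its points, and every cube contains a point of a fixed
countable dense set.\<close>

lemma countable_D: "countable D"
proof -
  obtain S :: "(real^'d) set" where S: "countable S" "\<And>U. open U \<Longrightarrow> U \<noteq> {} \<Longrightarrow> \<exists>s\<in>S. s \<in> U"
    using countable_dense_exists[where 'a="real^'d"] by metis
  have "\<exists>s\<in>S. s \<in> I" if I: "I \<in> D" for I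
  proof -
    obtain a where a: "I = cube a (2 powi lev I)" using gen_lev[OF I] by (auto simp: gen_def)
    let ?b = "a + (\<chi> i. 2 powi lev I)"
    have "box a ?b \<noteq> {}" by (auto simp: box_ne_empty(2) Basis_vec_def inner_axis)
    then obtain s where "s \<in> S" "s \<in> box a ?b" using S(2)[of "box a ?b"] open_box by blast
    then show ?thesis by (subst a) (auto simp: cube_def mem_box_cart intro: less_imp_le)
  qed
  then obtain p where p: "\<And>I. I \<in> D \<Longrightarrow> p I \<in> S" "\<And>I. I \<in> D \<Longrightarrow> p I \<in> I" by metis
  have "inj_on (\<lambda>I. (lev I, p I)) D"
    using p(2) same_lev_eq by (intro inj_onI) (metis IntI Pair_inject empty_iff)
  moreover have "(\<lambda>I. (lev I, p I)) ` D \<subseteq> UNIV \<times> S" using p by auto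
  then have "countable ((\<lambda>I. (lev I, p I)) ` D)"
    by (rule countable_subset) (intro countable_SIGMA S, auto)
  ultimately show ?thesis by (simp add: countable_image_inj_eq)
qed

lemma maximal_subset: "maximal F \<subseteq> F" by (auto simp: maximal_def)

text \<open>Among the members of \<open>F\<close> that contain \<open>I\<close> one of greatest size is maximal.\<close>

lemma maximal_cover:
  assumes "F \<subseteq> D" "I \<in> F" "\<And>J. J \<in> F \<Longrightarrow> I \<subseteq> J \<Longrightarrow> lev J \<le> K"
  obtains J where "J \<in> maximal F" "I \<subseteq> J"
proof -
  have "\<exists>J. (J \<in> F \<and> I \<subseteq> J) \<and> (\<forall>J'. (J' \<in> F \<and> I \<subseteq> J') \<longrightarrow> nat (K - lev J) \<le> nat (K - lev J'))"
    using assms(2) by (intro ex_has_least_nat[of _ I]) auto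
  then obtain J where J: "J \<in> F" "I \<subseteq> J"
    and least: "\<And>J'. J' \<in> F \<Longrightarrow> I \<subseteq> J' \<Longrightarrow> nat (K - lev J) \<le> nat (K - lev J')" by blast
  have "J' = J" if J': "J' \<in> F" "J \<subseteq> J'" for J'
  proof (rule ccontr)
    assume "J' \<noteq> J"
    then have "lev J < lev J'" using lev_less[of J J'] J' J assms(1) by auto
    moreover have "lev J' \<le> K" using assms(3)[of J'] J' J by auto
    moreover have "nat (K - lev J) \<le> nat (K - lev J')" using least[of J'] J J' by blast
    ultimately show False by linarith
  qed
  with J have "J \<in> maximal F" by (auto simp: maximal_def)
  with J that show ?thesis by blast
qed

lemma maximal_disjoint: "F \<subseteq> D \<Longrightarrow> disjoint (maximal F)"
  unfolding disjoint_def
proof (intro ballI impI)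
  fix I J assume "F \<subseteq> D" and I: "I \<in> maximal F" and J: "J \<in> maximal F" and "I \<noteq> J"
  then have "I \<in> D" "J \<in> D" using maximal_subset by blast+
  from nested[OF this] show "I \<inter> J = {}"
    using I J \<open>I \<noteq> J\<close> unfolding maximal_def by blast
qed

lemma countable_maximal: "F \<subseteq> D \<Longrightarrow> countable (maximal F)"
  using countable_subset[OF order_trans[OF maximal_subset] countable_D] .

lemma maximal_sets: "F \<subseteq> D \<Longrightarrow> maximal F \<subseteq> sets lebesgue"
  using maximal_subset sets_D by blast

lemmas sum_emeasure_maximal =
  emeasure_disjoint_Union[OF countable_maximal maximal_sets maximal_disjoint]
lemmas sum_nn_integral_maximal =
  nn_integral_disjoint_Union[OF countable_maximal maximal_sets maximal_disjoint]

lemma sets_Union_maximal: "F \<subseteq> D \<Longrightarrow> \<Union>(maximal F) \<in> sets lebesgue"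
  using countable_maximal[of F] maximal_sets[of F] by (metis sets.countable_Union)

text \<open>Chebyshev's inequality on the disjoint maximal cubes. It bounds the part of \<open>Q\<close> that stopping cubes fill.\<close>

lemma emeasure_stopping_le:
  assumes F: "F \<subseteq> D" "\<And>J. J \<in> F \<Longrightarrow> J \<subseteq> Q"
    and big: "\<And>J. J \<in> F \<Longrightarrow> ennreal l * emeasure lebesgue J \<le> (\<integral>\<^sup>+x\<in>J. f x \<partial>lebesgue)"
    and f [measurable]: "f \<in> borel_measurable lebesgue"
  shows "ennreal l * emeasure lebesgue (\<Union>(maximal F)) \<le> (\<integral>\<^sup>+x\<in>Q. f x \<partial>lebesgue)"
proof -
  have "ennreal l * emeasure lebesgue (\<Union>(maximal F))
      = (\<integral>\<^sup>+J. ennreal l * emeasure lebesgue J \<partial>count_space (maximal F))"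
    by (subst sum_emeasure_maximal[OF F(1) F(1) F(1), symmetric]) (simp add: nn_integral_cmult)
  also have "\<dots> \<le> (\<integral>\<^sup>+J. (\<integral>\<^sup>+x\<in>J. f x \<partial>lebesgue) \<partial>count_space (maximal F))"
    using big maximal_subset by (intro nn_integral_mono) auto
  also have "\<dots> = (\<integral>\<^sup>+x\<in>\<Union>(maximal F). f x \<partial>lebesgue)"
    by (rule sum_nn_integral_maximal[OF F(1) F(1) F(1) f])
  also have "\<dots> \<le> (\<integral>\<^sup>+x\<in>Q. f x \<partial>lebesgue)"
    using F(2) maximal_subset by (intro nn_integral_mono) (auto split: split_indicator)
  finally show ?thesis .
qed

lemma ex_small_cube:
  assumes "open U" "x \<in> U" "Q \<in> D" "x \<in> Q"
  obtains I where "I \<in> D" "x \<in> I" "I \<subseteq> U \<inter> Q"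
proof -
  obtain e where e: "0 < e" "ball x e \<subseteq> U" using assms(1,2) open_contains_ball by blast
  obtain n where n: "CARD('d) / e < 2 ^ n" using real_arch_pow[of 2 "CARD('d) / e"] by auto
  define k where "k = min (lev Q) (- int n)"
  have "(2::real) powi k \<le> 2 powi (- int n)" by (simp add: k_def two_powi_le_iff)
  also have "\<dots> = inverse (2 ^ n)" by (simp add: power_int_minus)
  finally have "CARD('d) * (2::real) powi k \<le> CARD('d) * inverse (2 ^ n)" by (intro mult_left_mono) auto
  also have "\<dots> < e" using n e(1) by (simp add: field_simps)
  finally have small: "CARD('d) * (2::real) powi k < e" .
  obtain I where I: "I \<in> D" "lev I = k" "x \<in> I" using ex_cube_at by blast
  then obtain a where a: "I = cube a (2 powi k)" using gen_lev[of I] by (auto simp: gen_def)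
  have "I \<subseteq> ball x e"
    using cube_norm_le[of x a "2 powi k"] small I(3) by (fastforce simp: a dist_norm)
  moreover have "I \<subseteq> Q" using subset_if_lev_le[OF I(1) assms(3)] I assms(4) by (auto simp: k_def)
  ultimately show ?thesis using that I e by blast
qed

end

section \<open>Dyadic averages and the reverse Hoelder inequality\<close>

lemma ennreal_finiteE:
  fixes x :: ennreal
  assumes "x < \<infinity>"
  obtains r where "0 \<le> r" "x = ennreal r"
  using assms by (cases x) auto

lemma borel_measurable_nn_integral_count_space:
  assumes "countable G" and "\<And>J. J \<in> G \<Longrightarrow> f J \<in> borel_measurable M"
  shows "(\<lambda>x. \<integral>\<^sup>+J. f J x \<partial>count_space G) \<in> borel_measurable M"
proof -
  interpret sigma_finite_measure "count_space G"
    using assms(1) by (rule sigma_finite_measure_count_space_countable)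
  have "(\<lambda>(J, x). f J x) \<in> borel_measurable (count_space G \<Otimes>\<^sub>M M)"
    using assms by (intro measurable_pair_measure_countable1) auto
  from measurable_pair_swap[OF this] show ?thesis
    by (intro borel_measurable_nn_integral) simp
qed

lemma Cauchy_Schwarz_set_reciprocal:
  fixes v :: "'a \<Rightarrow> real"
  assumes [measurable]: "v \<in> borel_measurable M" "G \<in> sets M" and pos: "\<And>x. 0 < v x"
  shows "(emeasure M G)\<^sup>2 \<le> (\<integral>\<^sup>+x\<in>G. ennreal (v x) \<partial>M) * (\<integral>\<^sup>+x\<in>G. ennreal (1 / v x) \<partial>M)"
proof -
  let ?f = "\<lambda>x. ennreal (sqrt (v x)) * indicator G x"
  let ?g = "\<lambda>x. ennreal (sqrt (1 / v x)) * indicator G x"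
  have "(\<integral>\<^sup>+x. ?f x * ?g x \<partial>M)\<^sup>2 \<le> (\<integral>\<^sup>+x. (?f x)\<^sup>2 \<partial>M) * (\<integral>\<^sup>+x. (?g x)\<^sup>2 \<partial>M)"
    by (rule Cauchy_Schwarz_nn_integral) measurable
  moreover have "?f x * ?g x = indicator G x" for x
    using pos[of x] by (auto simp: ennreal_mult[symmetric] real_sqrt_mult[symmetric] split: split_indicator)
  moreover have "(?f x)\<^sup>2 = ennreal (v x) * indicator G x" for x
    using pos[of x] by (auto simp: ennreal_power split: split_indicator)
  moreover have "(?g x)\<^sup>2 = ennreal (1 / v x) * indicator G x" for x
    using pos[of x] by (auto simp: ennreal_power split: split_indicator)
  ultimately show ?thesis by simp
qed

context dyadic
begin

text \<open>One half of Lebesgue differentiation, which suffices here: if \<open>v \<ge> s\<close> on a set all of whose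
surrounding cubes have averages at most \<open>r < s\<close>, cover the set by the maximal cubes inside a slightly larger
open set. The integral of \<open>v\<close> over the set is at least \<open>s\<close> times and at most nearly \<open>r\<close> times its
measure, so the measure vanishes.\<close>

lemma null_if_averages_below:
  fixes v :: "real^'d \<Rightarrow> real"
  assumes [measurable]: "v \<in> borel_measurable lebesgue" and Q: "Q \<in> D" and rs: "0 \<le> r" "r < s"
  shows "{x\<in>Q. s \<le> v x \<and> (\<forall>I\<in>D. x \<in> I \<longrightarrow> I \<subseteq> Q \<longrightarrow>
      (\<integral>\<^sup>+y\<in>I. ennreal (v y) \<partial>lebesgue) \<le> ennreal (r * vol I))} \<in> null_sets lebesgue"
    proof -
  define Z where "Z = {x\<in>Q. s \<le> v x \<and> (\<forall>I\<in>D. x \<in> I \<longrightarrow> I \<subseteq> Q \<longrightarrow>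
      (\<integral>\<^sup>+y\<in>I. ennreal (v y) \<partial>lebesgue) \<le> ennreal (r * vol I))}"
  define B where "B = {I\<in>D. I \<subseteq> Q \<and> \<not> (\<integral>\<^sup>+y\<in>I. ennreal (v y) \<partial>lebesgue) \<le> ennreal (r * vol I)}"
  have [measurable]: "Q \<in> sets lebesgue" using Q by (rule sets_D)
  have [measurable]: "\<Union>B \<in> sets lebesgue"
    using countable_subset[OF _ countable_D, of B] sets_D by (intro sets.countable_Union) (auto simp: B_def)
  have Z_eq: "Z = (Q \<inter> {x\<in>space lebesgue. s \<le> v x}) - \<Union>B" by (auto simp: B_def Z_def)
  have [measurable]: "Z \<in> sets lebesgue" unfolding Z_eq by measurable
  have ZQ: "Z \<subseteq> Q" by (auto simp: Z_def)
  have "emeasure lebesgue Z \<le> emeasure lebesgue Q" using ZQ by (intro emeasure_mono) auto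
  also have "\<dots> < \<infinity>" by (simp add: emeasure_D[OF Q])
  finally have "emeasure lebesgue Z < \<infinity>" .
  then obtain z where z: "0 \<le> z" "emeasure lebesgue Z = ennreal z"
    by (rule ennreal_finiteE)
  have "(s - r) * z \<le> r * e" if "0 < e" for e
  proof -
    obtain U where U: "open U" "Z \<subseteq> U" "U - Z \<in> lmeasurable" "emeasure lebesgue (U - Z) < ennreal e"
      by (rule sets_lebesgue_outer_open[OF \<open>Z \<in> sets lebesgue\<close> \<open>0 < e\<close>])
    define F where "F = {I\<in>D. I \<subseteq> U \<inter> Q \<and> I \<inter> Z \<noteq> {}}"
    have F: "F \<subseteq> D" by (auto simp: F_def)
    have cover: "Z \<subseteq> \<Union>(maximal F)"
    proof
      fix x assume x: "x \<in> Z"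
      then obtain I where I: "I \<in> D" "x \<in> I" "I \<subseteq> U \<inter> Q"
        using ex_small_cube[OF U(1) _ Q, of x] U(2) ZQ by blast
      then have IF: "I \<in> F" using x unfolding F_def by blast
      have "lev J \<le> lev Q" if "J \<in> F" for J using that Q lev_mono[of J Q] by (auto simp: F_def)
      then obtain J where "J \<in> maximal F" "I \<subseteq> J" using maximal_cover[OF F IF] by blast
      then show "x \<in> \<Union>(maximal F)" using I by blast
    qed
    have small: "(\<integral>\<^sup>+y\<in>J. ennreal (v y) \<partial>lebesgue) \<le> ennreal r * emeasure lebesgue J" if "J \<in> maximal F" for J
    proof -
      have "J \<in> F" using that maximal_subset by blast
      then obtain x where "x \<in> Z" "x \<in> J" "J \<in> D" "J \<subseteq> Q" by (auto simp: F_def)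
      then show ?thesis using rs by (auto simp: Z_def emeasure_D ennreal_mult)
    qed
    have "emeasure lebesgue (\<Union>(maximal F)) \<le> emeasure lebesgue (Z \<union> (U - Z))"
      using maximal_subset[of F] U(1) by (intro emeasure_mono sets.Un sets.Diff) (auto simp: F_def)
    also have "\<dots> \<le> emeasure lebesgue Z + emeasure lebesgue (U - Z)"
      using U(1) by (intro emeasure_subadditive sets.Diff) auto
    also have "\<dots> \<le> ennreal z + ennreal e" using U(4) z by (intro add_mono) auto
    finally have small_union: "emeasure lebesgue (\<Union>(maximal F)) \<le> ennreal z + ennreal e" .
    have "ennreal (s * z) = (\<integral>\<^sup>+x\<in>Z. ennreal s \<partial>lebesgue)"
      using rs z by (simp add: nn_integral_cmult_indicator ennreal_mult)
    also have "\<dots> \<le> (\<integral>\<^sup>+x\<in>\<Union>(maximal F). ennreal (v x) \<partial>lebesgue)"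
      using cover by (intro nn_integral_mono) (auto simp: Z_def split: split_indicator intro: ennreal_leI)
    also have "\<dots> = (\<integral>\<^sup>+J. (\<integral>\<^sup>+x\<in>J. ennreal (v x) \<partial>lebesgue) \<partial>count_space (maximal F))"
      by (rule sum_nn_integral_maximal[OF F F F, symmetric]) measurable
    also have "\<dots> \<le> (\<integral>\<^sup>+J. ennreal r * emeasure lebesgue J \<partial>count_space (maximal F))"
      using small by (intro nn_integral_mono) auto
    also have "\<dots> = ennreal r * emeasure lebesgue (\<Union>(maximal F))"
      by (simp add: nn_integral_cmult sum_emeasure_maximal[OF F F F])
    also have "\<dots> \<le> ennreal r * (ennreal z + ennreal e)" by (intro mult_left_mono small_union) simp
    also have "ennreal r * (ennreal z + ennreal e) = ennreal (r * (z + e))"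
      using rs z that by (simp add: ennreal_mult flip: ennreal_plus)
    finally have "s * z \<le> r * (z + e)"
      using rs z that ennreal_le_iff[of "r * (z + e)" "s * z"] by simp
    then show ?thesis by (simp add: algebra_simps)
  qed
  then have "\<forall>\<^sub>F e in at_right 0. (s - r) * z \<le> r * e"
    by (auto simp: eventually_at_right_field intro: exI[of _ 1])
  moreover have "((\<lambda>e. r * e) \<longlongrightarrow> r * 0) (at_right 0)" by (intro tendsto_intros)
  ultimately have "(s - r) * z \<le> r * 0"
    by (intro tendsto_lowerbound[of _ _ "at_right 0"]) auto
  then have "z = 0" using rs z by (auto simp: mult_le_0_iff)
  with z \<open>Z \<in> sets lebesgue\<close> show ?thesis unfolding Z_def[symmetric] by (auto simp: null_sets_def)
qed

lemma AE_averages_exceed: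
  fixes v :: "real^'d \<Rightarrow> real"
  assumes [measurable]: "v \<in> borel_measurable lebesgue" and Q: "Q \<in> D"
  shows "AE x in lebesgue. \<forall>r\<ge>0. x \<in> Q \<longrightarrow> r < v x \<longrightarrow>
    (\<exists>I\<in>D. x \<in> I \<and> I \<subseteq> Q \<and> ennreal (r * vol I) < (\<integral>\<^sup>+y\<in>I. ennreal (v y) \<partial>lebesgue))"
proof -
  let ?Z = "\<lambda>r s. {x\<in>Q. s \<le> v x \<and> (\<forall>I\<in>D. x \<in> I \<longrightarrow> I \<subseteq> Q \<longrightarrow>
      (\<integral>\<^sup>+y\<in>I. ennreal (v y) \<partial>lebesgue) \<le> ennreal (r * vol I))}"
  define C where "C = {p \<in> \<rat> \<times> \<rat>. 0 \<le> fst p \<and> fst p < (snd p :: real)}"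
  have "countable C"
    by (rule countable_subset[of _ "\<rat> \<times> \<rat>"]) (auto simp: C_def countable_rat)
  moreover have "AE x in lebesgue. x \<notin> ?Z (fst p) (snd p)" if "p \<in> C" for p
    using that by (intro AE_not_in null_if_averages_below Q assms) (auto simp: C_def)
  ultimately have "AE x in lebesgue. \<forall>p\<in>C. x \<notin> ?Z (fst p) (snd p)"
    by (simp only: AE_ball_countable) blast
  then show ?thesis
  proof (rule AE_mp, intro AE_I2 impI allI)
    fix x and r :: real
    assume *: "\<forall>p\<in>C. x \<notin> ?Z (fst p) (snd p)"
      and r: "0 \<le> r" "x \<in> Q" "r < v x"
    obtain s where s: "s \<in> \<rat>" "r < s" "s < v x" using Rats_dense_in_real[OF r(3)] by blast
    obtain r' where r': "r' \<in> \<rat>" "r < r'" "r' < s" using Rats_dense_in_real[OF s(2)] by blast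
    have "x \<notin> ?Z r' s" using *[rule_format, of "(r', s)"] s r' r by (simp add: C_def)
    then obtain I where I: "I \<in> D" "x \<in> I" "I \<subseteq> Q"
      "ennreal (r' * vol I) < (\<integral>\<^sup>+y\<in>I. ennreal (v y) \<partial>lebesgue)"
      using s r(2) by (auto simp: not_le)
    moreover have "ennreal (r * vol I) \<le> ennreal (r' * vol I)"
      using r' by (intro ennreal_leI mult_right_mono) auto
    ultimately show "\<exists>I\<in>D. x \<in> I \<and> I \<subseteq> Q \<and> ennreal (r * vol I) < (\<integral>\<^sup>+y\<in>I. ennreal (v y) \<partial>lebesgue)"
      by (auto intro: le_less_trans)
  qed
qed

text \<open>The family is truncated to \<open>m\<close> generations so that suprema over dyadic subcubes can be estimated by
induction on \<open>m\<close>.\<close>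

definition below :: "nat \<Rightarrow> (real^'d) set \<Rightarrow> (real^'d) set set" where
  "below m Q = {I\<in>D. I \<subseteq> Q \<and> lev Q - int m \<le> lev I}"

lemma below_0: "Q \<in> D \<Longrightarrow> I \<in> below 0 Q \<Longrightarrow> I = Q"
  using lev_less[of I Q] by (auto simp: below_def)

lemma countable_below: "countable (below m Q)"
  by (rule countable_subset[OF _ countable_D]) (auto simp: below_def)

lemma below_mono: "m \<le> n \<Longrightarrow> below m Q \<subseteq> below n Q"
  by (auto simp: below_def)

lemma in_below: "Q \<in> D \<Longrightarrow> I \<in> D \<Longrightarrow> I \<subseteq> Q \<Longrightarrow> I \<in> below (nat (lev Q - lev I)) Q"
  using lev_mono[of I Q] by (auto simp: below_def)

end

locale scalar_A2 = dyadic D for D :: "(real^'d) set set" +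
  fixes v :: "real^'d \<Rightarrow> real" and A :: real
  assumes v_measurable [measurable]: "v \<in> borel_measurable lebesgue"
    and v_pos: "\<And>x. 0 < v x"
    and A2: "\<And>I. I \<in> D \<Longrightarrow> (\<integral>\<^sup>+x\<in>I. ennreal (v x) \<partial>lebesgue) * (\<integral>\<^sup>+x\<in>I. ennreal (1 / v x) \<partial>lebesgue)
      \<le> ennreal (A * (vol I)\<^sup>2)"
begin

definition mass :: "(real^'d) set \<Rightarrow> real" where
  "mass I = enn2real (\<integral>\<^sup>+x\<in>I. ennreal (v x) \<partial>lebesgue)"

definition mean :: "(real^'d) set \<Rightarrow> real" where
  "mean I = mass I / vol I"

lemma mass:
  assumes "I \<in> D"
  shows nn_integral_v: "(\<integral>\<^sup>+x\<in>I. ennreal (v x) \<partial>lebesgue) = ennreal (mass I)" and mass_pos: "0 < mass I"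
proof -
  have [measurable]: "I \<in> sets lebesgue" using assms by (rule sets_D)
  have nz: "(\<integral>\<^sup>+x\<in>I. ennreal (f x) \<partial>lebesgue) \<noteq> 0"
    if [measurable]: "f \<in> borel_measurable lebesgue" and "\<And>x. 0 < f x" for f :: "_ \<Rightarrow> real"
  proof
    assume "(\<integral>\<^sup>+x\<in>I. ennreal (f x) \<partial>lebesgue) = 0"
    then have "AE x in lebesgue. ennreal (f x) * indicator I x = 0"
      by (subst (asm) nn_integral_0_iff_AE) auto
    then have "AE x in lebesgue. x \<notin> I"
    proof (rule AE_mp, intro AE_I2 impI)
      fix x assume "ennreal (f x) * indicator I x = 0"
      with that(2)[of x] show "x \<notin> I" by (auto simp: ennreal_eq_0_iff)
    qed
    then have "emeasure lebesgue I = 0" by (simp add: AE_iff_measurable[OF _ refl])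
    then show False using assms vol_pos[of I] by (simp add: emeasure_D)
  qed
  have nz1: "(\<integral>\<^sup>+x\<in>I. ennreal (1 / v x) \<partial>lebesgue) \<noteq> 0" using v_pos by (intro nz) auto
  have "(\<integral>\<^sup>+x\<in>I. ennreal (v x) \<partial>lebesgue) \<noteq> \<infinity>"
  proof
    assume "(\<integral>\<^sup>+x\<in>I. ennreal (v x) \<partial>lebesgue) = \<infinity>"
    then show False using A2[OF assms] nz1 by (simp add: ennreal_top_mult top_unique)
  qed
  then show *: "(\<integral>\<^sup>+x\<in>I. ennreal (v x) \<partial>lebesgue) = ennreal (mass I)"
    by (simp add: mass_def less_top)
  show "0 < mass I"
    using nz[OF v_measurable v_pos] enn2real_nonneg unfolding * by (simp add: ennreal_eq_0_iff)
qed

lemma mean_pos: "I \<in> D \<Longrightarrow> 0 < mean I"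
  using mass_pos vol_pos by (simp add: mean_def)

lemma one_le_A: "1 \<le> A"
proof -
  obtain Q where Q: "Q \<in> D" using ex_cube_at by metis
  have "ennreal ((vol Q)\<^sup>2) = (emeasure lebesgue Q)\<^sup>2"
    by (simp add: emeasure_D[OF Q] ennreal_power)
  also have "\<dots> \<le> (\<integral>\<^sup>+x\<in>Q. ennreal (v x) \<partial>lebesgue) * (\<integral>\<^sup>+x\<in>Q. ennreal (1 / v x) \<partial>lebesgue)"
    using sets_D[OF Q] v_pos by (intro Cauchy_Schwarz_set_reciprocal) auto
  also have "\<dots> \<le> ennreal (A * (vol Q)\<^sup>2)" by (rule A2[OF Q])
  finally have "(vol Q)\<^sup>2 \<le> A * (vol Q)\<^sup>2"
    using vol_pos[of Q] by (subst (asm) ennreal_le_iff2) auto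
  then show ?thesis using vol_pos[of Q] by simp
qed

text \<open>The weight cannot concentrate on a set that omits half of \<open>Q\<close>: by Cauchy--Schwarz, \<open>|G|\<^sup>2\<close> is at
most \<open>v(G)\<close> times the integral of \<open>1 / v\<close> over \<open>Q\<close>, and the \<open>A\<^sub>2\<close> condition bounds the latter by
\<open>A |Q|\<^sup>2 / v(Q)\<close>.\<close>

lemma mass_good_part:
  assumes Q: "Q \<in> D" and [measurable]: "G \<in> sets lebesgue" and "G \<subseteq> Q"
    and half: "ennreal (vol Q / 2) \<le> emeasure lebesgue G"
  shows "ennreal (mass Q) \<le> ennreal (4 * A) * (\<integral>\<^sup>+x\<in>G. ennreal (v x) \<partial>lebesgue)"
proof -
  let ?g = "\<integral>\<^sup>+x\<in>G. ennreal (v x) \<partial>lebesgue"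
  have A: "0 \<le> A * (vol Q)\<^sup>2" using one_le_A by simp
  have "ennreal ((vol Q)\<^sup>2 / 4) = (ennreal (vol Q / 2))\<^sup>2"
    by (simp add: ennreal_power power_divide)
  also have "\<dots> \<le> (emeasure lebesgue G)\<^sup>2" by (intro power_mono half) auto
  also have "\<dots> \<le> ?g * (\<integral>\<^sup>+x\<in>G. ennreal (1 / v x) \<partial>lebesgue)"
    using v_pos by (intro Cauchy_Schwarz_set_reciprocal) auto
  also have "\<dots> \<le> ?g * (\<integral>\<^sup>+x\<in>Q. ennreal (1 / v x) \<partial>lebesgue)"
    using \<open>G \<subseteq> Q\<close> by (intro mult_left_mono nn_integral_mono) (auto split: split_indicator)
  finally have "ennreal ((vol Q)\<^sup>2 / 4) * ennreal (mass Q)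
      \<le> (?g * (\<integral>\<^sup>+x\<in>Q. ennreal (1 / v x) \<partial>lebesgue)) * (\<integral>\<^sup>+x\<in>Q. ennreal (v x) \<partial>lebesgue)"
    unfolding nn_integral_v[OF Q] by (rule mult_right_mono) simp
  also have "\<dots> \<le> ?g * ennreal (A * (vol Q)\<^sup>2)"
    using mult_left_mono[OF A2[OF Q], of ?g] by (simp add: ac_simps)
  finally have "ennreal (4 / (vol Q)\<^sup>2) * (ennreal ((vol Q)\<^sup>2 / 4) * ennreal (mass Q))
      \<le> ennreal (4 / (vol Q)\<^sup>2) * (?g * ennreal (A * (vol Q)\<^sup>2))"
    by (rule mult_left_mono) simp
  moreover have "ennreal (4 / (vol Q)\<^sup>2) * (ennreal ((vol Q)\<^sup>2 / 4) * ennreal (mass Q)) = ennreal (mass Q)"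
  proof -
    have "ennreal (4 / (vol Q)\<^sup>2) * ennreal ((vol Q)\<^sup>2 / 4) = 1"
      using vol_pos[of Q] by (simp flip: ennreal_mult)
    then show ?thesis by (simp only: mult.assoc[symmetric] mult_1_left)
  qed
  moreover have "ennreal (4 / (vol Q)\<^sup>2) * (?g * ennreal (A * (vol Q)\<^sup>2)) = ennreal (4 * A) * ?g"
  proof -
    have "ennreal (4 / (vol Q)\<^sup>2) * ennreal (A * (vol Q)\<^sup>2) = ennreal (4 * A)"
      using vol_pos[of Q] A by (simp flip: ennreal_mult)
    moreover have "ennreal (4 / (vol Q)\<^sup>2) * (?g * ennreal (A * (vol Q)\<^sup>2))
        = (ennreal (4 / (vol Q)\<^sup>2) * ennreal (A * (vol Q)\<^sup>2)) * ?g"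
      by (simp only: ac_simps)
    ultimately show ?thesis by (simp only:)
  qed
  ultimately show ?thesis by (simp only:)
qed

text \<open>A truncated dyadic maximal function of \<open>v\<close>, localized to \<open>Q\<close> and raised to the power \<open>dl\<close>.\<close>

definition max_mean :: "real \<Rightarrow> nat \<Rightarrow> (real^'d) set \<Rightarrow> real^'d \<Rightarrow> ennreal" where
  "max_mean dl m Q x = (SUP I\<in>below m Q. ennreal (mean I powr dl) * indicator I x)"

lemma max_mean_measurable [measurable]: "max_mean dl m Q \<in> borel_measurable lebesgue"
proof -
  have "(\<lambda>x. ennreal (mean I powr dl) * indicator I x) \<in> borel_measurable lebesgue"
    if "I \<in> below m Q" for I
    using sets_D that by (auto simp: below_def)
  then show ?thesis unfolding max_mean_def by (intro borel_measurable_SUP countable_below)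
qed

text \<open>Stop at the maximal cubes \<open>J\<close> whose mean exceeds twice the mean of \<open>Q\<close>. They fill at most half of
\<open>Q\<close>, so by \<open>mass_good_part\<close> a fraction of at least \<open>1 / (4 A)\<close> of the mass lies outside of them, where
the maximal function is at most twice the mean. Inside, the induction hypothesis applies to \<open>J\<close>, whose mean is
at most \<open>2 \<cdot> 2\<^sup>d\<close> times that of \<open>Q\<close>. The exponent \<open>dl\<close> is so small that the factor this costs is
outweighed by the mass lost, and the constant \<open>4\<close> reproduces itself. Proving a bound for
\<open>v\<close> times a power of its maximal function, instead of for a power of \<open>v\<close>, makes the truncated quantities
finite from the start.\<close>

lemma reverse_Holder_step:
  fixes dl :: real
  assumes dl: "0 < dl" "dl \<le> 1" and rho: "(2 * 2 ^ CARD('d)) powr dl \<le> 1 + 1 / (8 * A)"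
    and Q: "Q \<in> D"
  shows "(\<integral>\<^sup>+x\<in>Q. ennreal (v x) * max_mean dl m Q x \<partial>lebesgue)
    \<le> ennreal (4 * mean Q powr dl * mass Q)"
  using Q
proof (induction m arbitrary: Q)
  case (0 Q)
  have "max_mean dl 0 Q x \<le> ennreal (mean Q powr dl)" for x
    unfolding max_mean_def using below_0[OF 0] by (intro SUP_least) (auto split: split_indicator)
  then have "(\<integral>\<^sup>+x\<in>Q. ennreal (v x) * max_mean dl 0 Q x \<partial>lebesgue)
      \<le> (\<integral>\<^sup>+x. ennreal (mean Q powr dl) * (ennreal (v x) * indicator Q x) \<partial>lebesgue)"
    by (intro nn_integral_mono) (auto split: split_indicator simp: mult.commute intro: mult_left_mono)
  also have "\<dots> = ennreal (mean Q powr dl * mass Q)"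
    using sets_D[OF 0] mass_pos[OF 0]
    by (subst nn_integral_cmult) (auto simp: nn_integral_v[OF 0] ennreal_mult)
  also have "\<dots> \<le> ennreal (4 * mean Q powr dl * mass Q)"
    using mass_pos[OF 0] by (intro ennreal_leI) auto
  finally show ?case .
next
  case (Suc m Q)
  have A: "0 < A" using one_le_A by simp
  note Q = \<open>Q \<in> D\<close>
  have [measurable]: "Q \<in> sets lebesgue" using Q by (rule sets_D)
  define F where "F = {J \<in> below (Suc m) Q. 2 * mean Q < mean J}"
  have F: "F \<subseteq> D" by (auto simp: F_def below_def)
  define E where "E = \<Union>(maximal F)"
  have [measurable]: "E \<in> sets lebesgue" unfolding E_def using F by (rule sets_Union_maximal)
  have FQ: "J \<subseteq> Q" "lev J \<le> lev Q" "J \<noteq> Q" if "J \<in> F" for J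
    using that Q lev_mono[of J Q] mean_pos[OF Q] by (auto simp: F_def below_def)
  have EQ: "E \<subseteq> Q" using FQ maximal_subset unfolding E_def by blast
  have mxD: "J \<in> D" "J \<in> F" if "J \<in> maximal F" for J using that F maximal_subset by blast+
  let ?e = "\<integral>\<^sup>+x\<in>E. ennreal (v x) \<partial>lebesgue" and ?g = "\<integral>\<^sup>+x\<in>Q - E. ennreal (v x) \<partial>lebesgue"
  have split: "?e + ?g = ennreal (mass Q)"
    unfolding nn_integral_v[OF Q, symmetric]
    by (subst nn_integral_add[symmetric]) (use EQ in \<open>auto intro!: nn_integral_cong split: split_indicator\<close>)
  have "?e < \<infinity>" "?g < \<infinity>" using split by (auto simp: less_top[symmetric])
  then obtain e g where eg: "0 \<le> e" "?e = ennreal e" "0 \<le> g" "?g = ennreal g"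
    by (elim ennreal_finiteE)
  have sum: "e + g = mass Q" using split eg mass_pos[OF Q] by (simp flip: ennreal_plus)
  have "ennreal (2 * mean Q) * emeasure lebesgue E \<le> (\<integral>\<^sup>+x\<in>Q. ennreal (v x) \<partial>lebesgue)"
    unfolding E_def
  proof (rule emeasure_stopping_le[OF F FQ(1)])
    fix J assume J: "J \<in> F"
    then have JD: "J \<in> D" using F by blast
    have "2 * mean Q * vol J \<le> mass J"
      using J vol_pos[of J] by (simp add: F_def mean_def[of J] field_simps)
    then show "ennreal (2 * mean Q) * emeasure lebesgue J \<le> (\<integral>\<^sup>+x\<in>J. ennreal (v x) \<partial>lebesgue)"
      using mean_pos[OF Q]
      by (simp add: emeasure_D[OF JD] nn_integral_v[OF JD] ennreal_leI flip: ennreal_mult)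
  qed auto
  moreover have "emeasure lebesgue E \<le> ennreal (vol Q)"
    using emeasure_mono[OF EQ, of lebesgue] by (simp add: emeasure_D[OF Q])
  then have "emeasure lebesgue E < \<infinity>" by (rule le_less_trans) simp
  then obtain t where t: "0 \<le> t" "emeasure lebesgue E = ennreal t" by (rule ennreal_finiteE)
  ultimately have "2 * mean Q * t \<le> mass Q"
    using mean_pos[OF Q] mass_pos[OF Q] by (simp add: nn_integral_v[OF Q] flip: ennreal_mult)
  then have t2: "2 * t \<le> vol Q"
    using mass_pos[OF Q] vol_pos[of Q] by (simp add: mean_def field_simps)
  have "emeasure lebesgue (Q - E) = ennreal (vol Q - t)"
    using EQ t by (subst emeasure_Diff) (auto simp: emeasure_D[OF Q] ennreal_minus)
  then have "ennreal (mass Q) \<le> ennreal (4 * A) * ?g"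
    using t2 by (intro mass_good_part[OF Q]) (auto intro!: ennreal_leI)
  then have g: "mass Q \<le> 4 * A * g"
    using eg A by (simp flip: ennreal_mult)
  have notF: "mean I \<le> 2 * mean Q" if "I \<in> below (Suc m) Q" "I \<notin> F" for I
    using that by (auto simp: F_def)
  have out: "max_mean dl (Suc m) Q x \<le> ennreal ((2 * mean Q) powr dl)" if "x \<notin> E" for x
    unfolding max_mean_def
  proof (rule SUP_least)
    fix I assume I: "I \<in> below (Suc m) Q"
    show "ennreal (mean I powr dl) * indicator I x \<le> ennreal ((2 * mean Q) powr dl)"
    proof (cases "x \<in> I")
      case True
      have "I \<notin> F"
      proof
        assume "I \<in> F"
        then obtain J where "J \<in> maximal F" "I \<subseteq> J" using maximal_cover[OF F] FQ by metis
        then show False using True that by (auto simp: E_def)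
      qed
      then have "mean I powr dl \<le> (2 * mean Q) powr dl"
        using notF[OF I] mean_pos[of I] I dl by (intro powr_mono2) (auto simp: below_def)
      then show ?thesis by (auto split: split_indicator intro: ennreal_leI)
    qed auto
  qed
  \<comment> \<open>Cubes containing a stopping cube \<open>J\<close> have smaller means than \<open>J\<close> and do not affect the supremum on \<open>J\<close>.\<close>
  have inside: "max_mean dl (Suc m) Q x \<le> max_mean dl m J x" if J: "J \<in> maximal F" and x: "x \<in> J" for J x
    unfolding max_mean_def[of _ "Suc m"]
  proof (rule SUP_least)
    fix I assume I: "I \<in> below (Suc m) Q"
    have JF: "J \<in> F" "J \<in> D" using mxD[OF J] by auto
    have levJ: "lev J < lev Q" using lev_less[OF JF(2) Q] FQ[OF JF(1)] by auto
    have mono: "ennreal (mean I' powr dl) * indicator I' x \<le> max_mean dl m J x" if "I' \<in> below m J" for I'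
      unfolding max_mean_def using that by (rule SUP_upper)
    show "ennreal (mean I powr dl) * indicator I x \<le> max_mean dl m J x"
    proof (cases "x \<in> I")
      case True
      consider "I \<subseteq> J" | "J \<subseteq> I" "I \<noteq> J" using nested[of I J] I JF(2) True x by (auto simp: below_def)
      then show ?thesis
      proof cases
        case 1
        then have "I \<in> below m J" using I levJ by (auto simp: below_def)
        then show ?thesis by (rule mono)
      next
        case 2
        then have "I \<notin> F" using J by (auto simp: maximal_def)
        then have "mean I \<le> mean J" using notF[OF I] JF(1) by (auto simp: F_def)
        then have "ennreal (mean I powr dl) * indicator I x \<le> ennreal (mean J powr dl) * indicator J x"
          using x True mean_pos[of I] I dl by (auto simp: below_def intro!: ennreal_leI powr_mono2)
        also have "\<dots> \<le> max_mean dl m J x" using JF by (intro mono) (auto simp: below_def)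
        finally show ?thesis .
      qed
    qed auto
  qed
  have stop_mean: "mean J \<le> 2 * 2 ^ CARD('d) * mean Q" if J: "J \<in> maximal F" for J
  proof -
    have JF: "J \<in> F" "J \<in> D" using mxD[OF J] by auto
    have "J \<subset> Q" using FQ[OF JF(1)] by auto
    then obtain P where P: "P \<in> D" "J \<subset> P" "P \<subseteq> Q" "vol P = 2 ^ CARD('d) * vol J"
      using parent[OF JF(2) Q] by blast
    have "lev J \<le> lev P" using lev_mono[OF JF(2) P(1)] P(2) by auto
    then have "P \<in> below (Suc m) Q" using P JF(1) by (auto simp: below_def F_def)
    moreover have "P \<notin> F" using J P(2) by (auto simp: maximal_def)
    ultimately have "mean P \<le> 2 * mean Q" by (rule notF)
    moreover have "mass J \<le> mass P"
    proof -
      have "ennreal (mass J) \<le> ennreal (mass P)"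
        unfolding nn_integral_v[OF JF(2), symmetric] nn_integral_v[OF P(1), symmetric]
        using P(2) by (intro nn_integral_mono) (auto split: split_indicator)
      then show ?thesis using mass_pos[OF P(1)] by simp
    qed
    then have "mean J \<le> 2 ^ CARD('d) * mean P"
      using vol_pos[of J] by (simp add: mean_def P(4) field_simps)
    ultimately show ?thesis by (auto intro: order_trans mult_left_mono)
  qed
  let ?mQ = "mean Q powr dl"
  let ?rho = "(2 * 2 ^ CARD('d)) powr dl :: real"
  have "(\<integral>\<^sup>+J. (\<integral>\<^sup>+x\<in>J. ennreal (v x) * max_mean dl m J x \<partial>lebesgue) \<partial>count_space (maximal F))
     \<le> (\<integral>\<^sup>+J. ennreal (4 * ?rho * ?mQ) * (\<integral>\<^sup>+x\<in>J. ennreal (v x) \<partial>lebesgue) \<partial>count_space (maximal F))"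
  proof (rule nn_integral_mono)
    fix J assume "J \<in> space (count_space (maximal F))"
    then have J: "J \<in> maximal F" by simp
    note JD = mxD(1)[OF J]
    have "mean J powr dl \<le> (2 * 2 ^ CARD('d) * mean Q) powr dl"
      using stop_mean[OF J] mean_pos[OF JD] dl by (intro powr_mono2) auto
    also have "\<dots> = ?rho * ?mQ" using mean_pos[OF Q] by (simp add: powr_mult)
    finally have "4 * mean J powr dl * mass J \<le> 4 * (?rho * ?mQ) * mass J"
      using mass_pos[OF JD] by (intro mult_right_mono mult_left_mono) auto
    then have "ennreal (4 * mean J powr dl * mass J) \<le> ennreal (4 * ?rho * ?mQ) * ennreal (mass J)"
      using mass_pos[OF JD] by (simp add: ennreal_leI mult.assoc flip: ennreal_mult)
    with Suc.IH[OF JD] show "(\<integral>\<^sup>+x\<in>J. ennreal (v x) * max_mean dl m J x \<partial>lebesgue)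
        \<le> ennreal (4 * ?rho * ?mQ) * (\<integral>\<^sup>+x\<in>J. ennreal (v x) \<partial>lebesgue)"
      unfolding nn_integral_v[OF JD] by (rule order_trans)
  qed
  also have "\<dots> = ennreal (4 * ?rho * ?mQ) * ?e"
    unfolding E_def by (subst nn_integral_cmult) (simp_all add: sum_nn_integral_maximal[OF F F F])
  finally have stopped: "(\<integral>\<^sup>+J. (\<integral>\<^sup>+x\<in>J. ennreal (v x) * max_mean dl m J x \<partial>lebesgue) \<partial>count_space (maximal F))
      \<le> ennreal (4 * ?rho * ?mQ) * ?e" .
  have "(\<integral>\<^sup>+x\<in>Q. ennreal (v x) * max_mean dl (Suc m) Q x \<partial>lebesgue)
    \<le> (\<integral>\<^sup>+x. ennreal (2 * ?mQ) * (ennreal (v x) * indicator (Q - E) x)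
        + (\<integral>\<^sup>+J. ennreal (v x) * max_mean dl m J x * indicator J x \<partial>count_space (maximal F)) \<partial>lebesgue)"
  proof (rule nn_integral_mono)
    fix x
    have "(2 * mean Q) powr dl \<le> 2 * ?mQ"
    proof -
      have "(2::real) powr dl \<le> 2 powr 1" using dl by (intro powr_mono) auto
      then show ?thesis using mean_pos[OF Q] by (simp add: powr_mult mult_right_mono)
    qed
    then have out': "max_mean dl (Suc m) Q x \<le> ennreal (2 * ?mQ)" if "x \<notin> E"
      using out[OF that] by (meson ennreal_leI order_trans)
    show "ennreal (v x) * max_mean dl (Suc m) Q x * indicator Q x
      \<le> ennreal (2 * ?mQ) * (ennreal (v x) * indicator (Q - E) x)
        + (\<integral>\<^sup>+J. ennreal (v x) * max_mean dl m J x * indicator J x \<partial>count_space (maximal F))"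
    proof (cases "x \<in> E")
      case True
      then obtain J where J: "J \<in> maximal F" "x \<in> J" by (auto simp: E_def)
      have "ennreal (v x) * max_mean dl (Suc m) Q x * indicator Q x \<le> ennreal (v x) * max_mean dl m J x * indicator J x"
        using inside[OF J] J by (auto split: split_indicator intro: mult_left_mono)
      also have "\<dots> \<le> (\<integral>\<^sup>+J. ennreal (v x) * max_mean dl m J x * indicator J x \<partial>count_space (maximal F))"
        using J(1) by (rule nn_integral_ge_point)
      finally show ?thesis by (simp add: add_increasing)
    next
      case False
      have "ennreal (v x) * max_mean dl (Suc m) Q x * indicator Q x
          \<le> ennreal (2 * ?mQ) * (ennreal (v x) * indicator (Q - E) x)"
        using mult_left_mono[OF out'[OF False], of "ennreal (v x)"] False
        by (auto split: split_indicator simp: mult.commute)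
      then show ?thesis by (simp add: add_increasing2)
    qed
  qed
  also have "\<dots> = ennreal (2 * ?mQ) * ?g
      + (\<integral>\<^sup>+J. (\<integral>\<^sup>+x\<in>J. ennreal (v x) * max_mean dl m J x \<partial>lebesgue) \<partial>count_space (maximal F))"
  proof -
    have mJ: "(\<lambda>x. ennreal (v x) * max_mean dl m J x * indicator J x) \<in> borel_measurable lebesgue"
      if "J \<in> maximal F" for J using sets_D[OF mxD(1)[OF that]] by measurable
    have m2: "(\<lambda>x. \<integral>\<^sup>+J. ennreal (v x) * max_mean dl m J x * indicator J x \<partial>count_space (maximal F))
        \<in> borel_measurable lebesgue"
      using mJ countable_maximal[OF F] by (intro borel_measurable_nn_integral_count_space) auto
    show ?thesis
      by (subst nn_integral_add[OF _ m2], measurable, subst nn_integral_cmult, measurable,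
          subst nn_integral_count_space_nn_integral[OF countable_maximal[OF F] mJ], auto)
  qed
  also have "\<dots> \<le> ennreal (2 * ?mQ) * ?g + ennreal (4 * ?rho * ?mQ) * ?e" by (intro add_left_mono stopped)
  also have "ennreal (2 * ?mQ) * ?g + ennreal (4 * ?rho * ?mQ) * ?e = ennreal ((2 * g + 4 * ?rho * e) * ?mQ)"
    unfolding eg using eg(1,3) by (simp add: algebra_simps flip: ennreal_mult ennreal_plus)
  also have "\<dots> \<le> ennreal (4 * mass Q * ?mQ)"
  proof (intro ennreal_leI mult_right_mono)
    have "4 * ?rho * e \<le> 4 * (1 + 1 / (8 * A)) * e"
      using rho eg(1) by (intro mult_right_mono mult_left_mono) auto
    also have "\<dots> = 4 * e + e / (2 * A)" using A by (simp add: field_simps)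
    also have "e / (2 * A) \<le> 2 * g"
      using g sum eg A by (simp add: field_simps)
    finally show "2 * g + 4 * ?rho * e \<le> 4 * mass Q" unfolding sum[symmetric] by simp
  qed simp
  finally show ?case by (simp add: mult.commute mult.left_commute)
qed

text \<open>Almost everywhere \<open>v\<close> is dominated by its dyadic maximal function; let the truncation parameter tend
to infinity.\<close>

lemma reverse_Holder:
  fixes dl :: real
  assumes dl: "0 < dl" "dl \<le> 1" and rho: "(2 * 2 ^ CARD('d)) powr dl \<le> 1 + 1 / (8 * A)"
    and Q: "Q \<in> D"
  shows "(\<integral>\<^sup>+x\<in>Q. ennreal (v x powr (1 + dl)) \<partial>lebesgue) \<le> ennreal (4 * mean Q powr dl * mass Q)"
proof -
  have [measurable]: "Q \<in> sets lebesgue" using Q by (rule sets_D)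
  have inc: "max_mean dl m Q x \<le> max_mean dl n Q x" if "m \<le> n" for m n x
    unfolding max_mean_def using below_mono[OF that] by (intro SUP_subset_mono) auto
  have "AE x in lebesgue. x \<in> Q \<longrightarrow> ennreal (v x powr dl) \<le> (SUP m. max_mean dl m Q x)"
    using AE_averages_exceed[OF v_measurable Q]
  proof (rule AE_mp, intro AE_I2 impI)
    fix x assume *: "\<forall>r\<ge>0. x \<in> Q \<longrightarrow> r < v x \<longrightarrow>
      (\<exists>I\<in>D. x \<in> I \<and> I \<subseteq> Q \<and> ennreal (r * vol I) < (\<integral>\<^sup>+y\<in>I. ennreal (v y) \<partial>lebesgue))" and x: "x \<in> Q"
    show "ennreal (v x powr dl) \<le> (SUP m. max_mean dl m Q x)"
    proof (rule ccontr)
      assume "\<not> ?thesis"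
      then have less: "(SUP m. max_mean dl m Q x) < ennreal (v x powr dl)" by simp
      then have "(SUP m. max_mean dl m Q x) < \<infinity>" by (rule less_trans) simp
      then obtain t where t: "0 \<le> t" "(SUP m. max_mean dl m Q x) = ennreal t"
        by (rule ennreal_finiteE)
      define r where "r = t powr (1 / dl)"
      have tr: "t = r powr dl" using dl t(1) by (simp add: r_def powr_powr)
      have "t < v x powr dl" using less t by (simp add: ennreal_less_iff)
      then have "r < v x"
        using v_pos[of x] dl by (metis less_imp_le not_less powr_mono2 tr)
      then obtain I where I: "I \<in> D" "x \<in> I" "I \<subseteq> Q" "ennreal (r * vol I) < ennreal (mass I)"
        using * x nn_integral_v by (metis powr_ge_zero r_def)
      have "r < mean I"
        using I(4) mass_pos[OF I(1)] vol_pos[of I] by (auto simp: mean_def r_def ennreal_less_iff field_simps)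
      then have "t < mean I powr dl" unfolding tr using dl by (intro powr_less_mono2) (auto simp: r_def)
      moreover have "I \<in> below (nat (lev Q - lev I)) Q"
        using I(1,3) by (rule in_below[OF Q])
      then have "ennreal (mean I powr dl) * indicator I x \<le> max_mean dl (nat (lev Q - lev I)) Q x"
        unfolding max_mean_def by (rule SUP_upper)
      then have "ennreal (mean I powr dl) \<le> (SUP m. max_mean dl m Q x)"
        using I(2) by (auto intro: SUP_upper2)
      ultimately show False using t by simp
    qed
  qed
  then have "(\<integral>\<^sup>+x\<in>Q. ennreal (v x powr (1 + dl)) \<partial>lebesgue)
      \<le> (\<integral>\<^sup>+x. (SUP m. ennreal (v x) * max_mean dl m Q x * indicator Q x) \<partial>lebesgue)"
  proof (intro nn_integral_mono_AE, rule AE_mp, intro AE_I2 impI)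
    fix x assume x: "x \<in> Q \<longrightarrow> ennreal (v x powr dl) \<le> (SUP m. max_mean dl m Q x)"
    show "ennreal (v x powr (1 + dl)) * indicator Q x
        \<le> (SUP m. ennreal (v x) * max_mean dl m Q x * indicator Q x)"
    proof (cases "x \<in> Q")
      case True
      have "ennreal (v x powr (1 + dl)) = ennreal (v x) * ennreal (v x powr dl)"
        using v_pos[of x] by (simp add: powr_add flip: ennreal_mult)
      also have "\<dots> \<le> ennreal (v x) * (SUP m. max_mean dl m Q x)"
        using x True by (intro mult_left_mono) auto
      also have "\<dots> = (SUP m. ennreal (v x) * max_mean dl m Q x)"
        by (simp add: SUP_mult_left_ennreal)
      finally show ?thesis using True by simp
    qed simp
  qed
  also have "\<dots> = (SUP m. \<integral>\<^sup>+x. ennreal (v x) * max_mean dl m Q x * indicator Q x \<partial>lebesgue)"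
    by (intro nn_integral_monotone_convergence_SUP incseq_SucI le_funI mult_right_mono mult_left_mono inc) auto
  also have "\<dots> \<le> ennreal (4 * mean Q powr dl * mass Q)"
    by (intro SUP_least reverse_Holder_step assms)
  finally show ?thesis .
qed

end

section \<open>Reducing matrices and the localized maximal function\<close>

lemma sigma_finite_lebesgue: "sigma_finite_measure (lebesgue :: 'a::euclidean_space measure)"
proof
  obtain C :: "'a set set" where C: "countable C" "C \<subseteq> sets lborel" "\<Union>C = space lborel"
      "\<forall>a\<in>C. emeasure lborel a \<noteq> \<infinity>"
    using lborel.sigma_finite_countable by blast
  have "emeasure lebesgue a \<noteq> \<infinity>" if "a \<in> C" for a
    using C(2,4) that by (subst emeasure_completion) auto
  then show "\<exists>A::'a set set. countable A \<and> A \<subseteq> sets lebesgue \<and> \<Union>A = space lebesgue \<and>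
      (\<forall>a\<in>A. emeasure lebesgue a \<noteq> \<infinity>)"
    using C by (intro exI[of _ C]) auto
qed

text \<open>Here \<open>S\<close> and \<open>R\<close> stand for \<open>W\<^sup>1\<^sup>/\<^sup>2\<close> and \<open>W\<^sup>-\<^sup>1\<^sup>/\<^sup>2\<close>, modified on a null set so that they are mutually inverse
Hermitian matrices at every point.\<close>

locale matrix_A2 = dyadic D for D :: "(real^'d) set set" +
  fixes S R :: "real^'d \<Rightarrow> complex^'n^'n" and A :: real
  assumes S_measurable [measurable]: "S \<in> borel_measurable lebesgue"
    and R_measurable [measurable]: "R \<in> borel_measurable lebesgue"
    and hermitian_S: "\<And>x. hermitian (S x)" and hermitian_R: "\<And>x. hermitian (R x)"
    and SR: "\<And>x. S x ** R x = mat 1"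
    and A2: "\<And>I. I \<in> D \<Longrightarrow> (\<integral>\<^sup>+x\<in>I. (\<integral>\<^sup>+t\<in>I. ennreal ((op_norm (S x ** R t))\<^sup>2) \<partial>lebesgue) \<partial>lebesgue)
      \<le> ennreal (A * (vol I)\<^sup>2)"
begin

lemma R_nonzero: "u \<noteq> 0 \<Longrightarrow> R t *v u \<noteq> 0"
  using SR[of t] by (metis matrix_vector_mul_assoc matrix_vector_mul_lid matrix_vector_mult_0_right)

text \<open>Writing \<open>R(t) u = R(t) S(x) (R(x) u)\<close> gives \<open>|R(t) u|\<^sup>2 / |R(x) u|\<^sup>2 \<le> \<parallel>S(x) R(t)\<parallel>\<^sup>2\<close> in operator norm,
and averaging in both variables turns the matrix condition into the scalar one.\<close>

lemma scalar_A2: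
  assumes "u \<noteq> 0"
  shows "scalar_A2 D (\<lambda>t. (norm (R t *v u))\<^sup>2) A"
proof unfold_locales
  let ?v = "\<lambda>t. (norm (R t *v u))\<^sup>2"
  show [measurable]: "?v \<in> borel_measurable lebesgue" by measurable
  show "0 < ?v t" for t using R_nonzero[OF assms] by simp
  fix I assume I: "I \<in> D"
  have [measurable]: "I \<in> sets lebesgue" using I by (rule sets_D)
  have quot: "?v t * (1 / ?v x) \<le> (op_norm (S x ** R t))\<^sup>2" for x t
  proof -
    have "R t *v u = (R t ** S x) *v (R x *v u)"
      using SR[of x] by (simp add: matrix_vector_mul_assoc matrix_mul_assoc[symmetric])
    then have "norm (R t *v u) \<le> op_norm (R t ** S x) * norm (R x *v u)"
      using op_norm_bound[of "R t ** S x" "R x *v u"] by simp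
    also have "\<dots> \<le> op_norm (S x ** R t) * norm (R x *v u)"
      by (intro mult_right_mono op_norm_hermitian_mult_commute hermitian_R hermitian_S) simp
    finally have "?v t \<le> (op_norm (S x ** R t) * norm (R x *v u))\<^sup>2" by (intro power_mono) auto
    then show ?thesis using R_nonzero[OF assms, of x] by (simp add: power_mult_distrib field_simps)
  qed
  have "(\<integral>\<^sup>+x\<in>I. ennreal (?v x) \<partial>lebesgue) * (\<integral>\<^sup>+x\<in>I. ennreal (1 / ?v x) \<partial>lebesgue)
      = (\<integral>\<^sup>+x. (\<integral>\<^sup>+t\<in>I. ennreal (?v t) \<partial>lebesgue) * (ennreal (1 / ?v x) * indicator I x) \<partial>lebesgue)"
    by (subst nn_integral_cmult) auto
  also have "\<dots> = (\<integral>\<^sup>+x\<in>I. (\<integral>\<^sup>+t\<in>I. ennreal (?v t * (1 / ?v x)) \<partial>lebesgue) \<partial>lebesgue)"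
    by (intro nn_integral_cong, subst nn_integral_multc[symmetric], measurable)
       (auto intro!: nn_integral_cong split: split_indicator simp flip: ennreal_mult)
  also have "\<dots> \<le> (\<integral>\<^sup>+x\<in>I. (\<integral>\<^sup>+t\<in>I. ennreal ((op_norm (S x ** R t))\<^sup>2) \<partial>lebesgue) \<partial>lebesgue)"
    by (intro nn_integral_mono mult_right_mono ennreal_leI quot) auto
  also have "\<dots> \<le> ennreal (A * (vol I)\<^sup>2)" by (rule A2[OF I])
  finally show "(\<integral>\<^sup>+x\<in>I. ennreal (?v x) \<partial>lebesgue) * (\<integral>\<^sup>+x\<in>I. ennreal (1 / ?v x) \<partial>lebesgue)
      \<le> ennreal (A * (vol I)\<^sup>2)" .
qed

lemma axis_1_nonzero: "axis j 1 \<noteq> (0 :: complex^'n)"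
  using norm_axis_complex[of j] by (metis norm_zero zero_neq_one)

lemma one_le_A: "1 \<le> A"
  using scalar_A2.one_le_A[OF scalar_A2[OF axis_1_nonzero]] .

text \<open>Take the square root of the mean of \<open>R(t)\<^sup>2\<close> over \<open>I\<close>. The mean exists because the columns of \<open>R\<close> are
square integrable over \<open>I\<close>, being scalar \<open>A\<^sub>2\<close> weights.\<close>

lemma ex_reducing_matrix:
  assumes I: "I \<in> D"
  shows "\<exists>B. pos_def B \<and>
    (\<forall>u. (\<integral>\<^sup>+t\<in>I. ennreal ((norm (R t *v u))\<^sup>2) \<partial>lebesgue) = ennreal (vol I * (norm (B *v u))\<^sup>2))"
proof -
  have [measurable]: "I \<in> sets lebesgue" using I by (rule sets_D)
  define f where "f t = (indicator I t :: real) *\<^sub>R (R t ** R t)" for t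
  have [measurable]: "f \<in> borel_measurable lebesgue" unfolding f_def by measurable
  have fin: "(\<integral>\<^sup>+t\<in>I. ennreal ((norm (R t *v u))\<^sup>2) \<partial>lebesgue) < \<infinity>" if "u \<noteq> 0" for u
    using scalar_A2.nn_integral_v[OF scalar_A2[OF that] I] by simp
  have intf: "integrable lebesgue f"
  proof (rule integrableI_bounded)
    have "(\<integral>\<^sup>+t. ennreal (norm (f t)) \<partial>lebesgue)
        \<le> (\<integral>\<^sup>+t. (\<Sum>j\<in>UNIV. ennreal ((norm (R t *v axis j 1))\<^sup>2) * indicator I t) \<partial>lebesgue)"
    proof (rule nn_integral_mono)
      fix t
      have "norm (R t ** R t) \<le> (norm (R t))\<^sup>2"
        using norm_matrix_mult_le[of "R t" "R t"] by (simp add: power2_eq_square)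
      then show "ennreal (norm (f t)) \<le> (\<Sum>j\<in>UNIV. ennreal ((norm (R t *v axis j 1))\<^sup>2) * indicator I t)"
        by (auto simp: f_def norm_matrix_columns sum_ennreal split: split_indicator intro: ennreal_leI)
    qed
    also have "\<dots> = (\<Sum>j\<in>UNIV. \<integral>\<^sup>+t\<in>I. ennreal ((norm (R t *v axis j 1))\<^sup>2) \<partial>lebesgue)"
      by (rule nn_integral_sum) measurable
    also have "\<dots> < \<infinity>" using fin[OF axis_1_nonzero] by (simp add: less_top)
    finally show "(\<integral>\<^sup>+t. ennreal (norm (f t)) \<partial>lebesgue) < \<infinity>" .
  qed measurable
  define T where "T = (1 / vol I) *\<^sub>R integral\<^sup>L lebesgue f"
  have form: "ennreal (vol I * ((T *v u) \<bullet> u)) = (\<integral>\<^sup>+t\<in>I. ennreal ((norm (R t *v u))\<^sup>2) \<partial>lebesgue)" for u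
  proof -
    have bl: "bounded_linear (\<lambda>M::complex^'n^'n. (M *v u) \<bullet> u)"
      by (intro bounded_linear_compose[OF bounded_linear_inner_left] mv.bounded_linear_left)
    have fu: "(f t *v u) \<bullet> u = indicator I t * (norm (R t *v u))\<^sup>2" for t
      using hermitian_inner[OF hermitian_R, of t "R t *v u" u]
      by (simp add: f_def mv.scaleR_left power2_norm_eq_inner matrix_vector_mul_assoc[symmetric])
    have "vol I * ((T *v u) \<bullet> u) = integral\<^sup>L lebesgue (\<lambda>t. (f t *v u) \<bullet> u)"
      using integral_bounded_linear[OF bl intf] vol_pos[of I] by (simp add: T_def mv.scaleR_left)
    moreover have "ennreal (integral\<^sup>L lebesgue (\<lambda>t. (f t *v u) \<bullet> u)) = (\<integral>\<^sup>+t. ennreal ((f t *v u) \<bullet> u) \<partial>lebesgue)"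
      using integrable_bounded_linear[OF bl intf]
      by (intro nn_integral_eq_integral[symmetric]) (auto simp: fu)
    moreover have "(\<integral>\<^sup>+t. ennreal ((f t *v u) \<bullet> u) \<partial>lebesgue) = (\<integral>\<^sup>+t\<in>I. ennreal ((norm (R t *v u))\<^sup>2) \<partial>lebesgue)"
      unfolding fu by (intro nn_integral_cong) (auto split: split_indicator)
    ultimately show ?thesis by simp
  qed
  have "hermitian T"
  proof -
    have "conj_transpose (f t) = f t" for t
      using hermitian_scaleR[OF hermitian_square[OF hermitian_R]]
      by (simp add: f_def hermitian_iff_conj_transpose)
    then have conj_f: "(\<lambda>t. conj_transpose (f t)) = f" by (intro ext)
    have "conj_transpose (integral\<^sup>L lebesgue f) = integral\<^sup>L lebesgue f"
      by (subst (2) conj_f[symmetric])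
        (rule integral_bounded_linear[OF bounded_linear_conj_transpose intf, symmetric])
    then show ?thesis
      unfolding T_def by (intro hermitian_scaleR) (simp only: hermitian_iff_conj_transpose)
  qed
  moreover have "0 < (T *v u) \<bullet> u" if "u \<noteq> 0" for u
  proof -
    note A2u = scalar_A2[OF that]
    have "ennreal (vol I * ((T *v u) \<bullet> u)) > 0"
      unfolding form scalar_A2.nn_integral_v[OF A2u I] using scalar_A2.mass_pos[OF A2u I] by simp
    then show ?thesis using vol_pos[of I] by (simp add: zero_less_mult_iff)
  qed
  ultimately have T: "pos_def T" by (simp add: pos_def_iff)
  have "(norm (mat_sqrt T *v u))\<^sup>2 = (T *v u) \<bullet> u" for u
    using hermitian_inner[OF mat_inv_sqrt(4)[OF T], of "mat_sqrt T *v u" u] mat_sqrt_square[OF T]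
    by (simp add: power2_norm_eq_inner matrix_vector_mul_assoc)
  then show ?thesis using pos_def_mat_sqrt[OF T] form by (intro exI[of _ "mat_sqrt T"]) auto
qed

definition red :: "(real^'d) set \<Rightarrow> complex^'n^'n" where
  "red I = (SOME B. pos_def B \<and>
    (\<forall>u. (\<integral>\<^sup>+t\<in>I. ennreal ((norm (R t *v u))\<^sup>2) \<partial>lebesgue) = ennreal (vol I * (norm (B *v u))\<^sup>2)))"

definition redinv :: "(real^'d) set \<Rightarrow> complex^'n^'n" where
  "redinv I = matrix_inv (red I)"

lemma red:
  assumes "I \<in> D"
  shows "pos_def (red I)"
    and nn_integral_red: "(\<integral>\<^sup>+t\<in>I. ennreal ((norm (R t *v u))\<^sup>2) \<partial>lebesgue) = ennreal (vol I * (norm (red I *v u))\<^sup>2)"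
  using someI_ex[OF ex_reducing_matrix[OF assms]] unfolding red_def[symmetric] by auto

lemma redinv:
  assumes "I \<in> D"
  shows "red I ** redinv I = mat 1" "redinv I ** red I = mat 1" "hermitian (redinv I)" "hermitian (red I)"
  using pos_def_matrix_inv[OF red(1)[OF assms]] red(1)[OF assms] by (auto simp: redinv_def pos_def_iff)

lemma nn_integral_red_matrix:
  fixes X :: "complex^'n^'n"
  assumes I: "I \<in> D"
  shows "(\<integral>\<^sup>+t\<in>I. ennreal ((norm (R t ** X))\<^sup>2) \<partial>lebesgue) = ennreal (vol I * (norm (red I ** X))\<^sup>2)"
proof -
  have [measurable]: "I \<in> sets lebesgue" using I by (rule sets_D)
  have "(\<integral>\<^sup>+t\<in>I. ennreal ((norm (R t ** X))\<^sup>2) \<partial>lebesgue)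
      = (\<integral>\<^sup>+t. (\<Sum>j\<in>UNIV. ennreal ((norm (R t *v (X *v axis j 1)))\<^sup>2) * indicator I t) \<partial>lebesgue)"
  proof (rule nn_integral_cong)
    fix t
    have "(norm (R t ** X))\<^sup>2 = (\<Sum>j\<in>UNIV. (norm (R t *v (X *v axis j 1)))\<^sup>2)"
      by (simp only: norm_matrix_columns matrix_vector_mul_assoc)
    then show "ennreal ((norm (R t ** X))\<^sup>2) * indicator I t
        = (\<Sum>j\<in>UNIV. ennreal ((norm (R t *v (X *v axis j 1)))\<^sup>2) * indicator I t)"
      by (auto simp: sum_ennreal split: split_indicator)
  qed
  also have "\<dots> = (\<Sum>j\<in>UNIV. ennreal (vol I * (norm (red I *v (X *v axis j 1)))\<^sup>2))"
    by (subst nn_integral_sum) (auto simp: nn_integral_red[OF I])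
  also have "\<dots> = ennreal (vol I * (norm (red I ** X))\<^sup>2)"
    by (subst sum_ennreal) (simp_all only: norm_matrix_columns sum_distrib_left matrix_vector_mul_assoc
        vol_nonneg mult_nonneg_nonneg zero_le_power2)
  finally show ?thesis .
qed

text \<open>In Frobenius norm \<open>\<parallel>red Q S(x)\<parallel>\<^sup>2\<close> is the mean over \<open>t \<in> Q\<close> of \<open>\<parallel>R(t) S(x)\<parallel>\<^sup>2\<close>, so \<open>|Q|\<close> times
the left-hand side is the double integral of the \<open>A\<^sub>2\<close> condition, up to the comparison of norms.\<close>

lemma nn_integral_red_S:
  assumes Q: "Q \<in> D"
  shows "(\<integral>\<^sup>+x\<in>Q. ennreal ((norm (red Q ** S x))\<^sup>2) \<partial>lebesgue) \<le> ennreal (CARD('n) * A * vol Q)"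
proof -
  have [measurable]: "Q \<in> sets lebesgue" using Q by (rule sets_D)
  have "ennreal (vol Q) * (\<integral>\<^sup>+x\<in>Q. ennreal ((norm (red Q ** S x))\<^sup>2) \<partial>lebesgue)
      = (\<integral>\<^sup>+x\<in>Q. (\<integral>\<^sup>+t\<in>Q. ennreal ((norm (R t ** S x))\<^sup>2) \<partial>lebesgue) \<partial>lebesgue)"
    unfolding nn_integral_red_matrix[OF Q]
    by (subst nn_integral_cmult[symmetric])
      (auto intro!: nn_integral_cong split: split_indicator simp flip: ennreal_mult)
  also have "\<dots> \<le> (\<integral>\<^sup>+x\<in>Q. ennreal CARD('n) * (\<integral>\<^sup>+t\<in>Q. ennreal ((op_norm (S x ** R t))\<^sup>2) \<partial>lebesgue) \<partial>lebesgue)"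
  proof (intro nn_integral_mono mult_right_mono)
    fix x
    have le: "(norm (R t ** S x))\<^sup>2 \<le> CARD('n) * (op_norm (S x ** R t))\<^sup>2" for t
      using norm_le_op_norm[of "S x ** R t"] norm_hermitian_mult_commute[OF hermitian_S hermitian_R, of x t] by simp
    have [measurable]: "(\<lambda>t. op_norm (S x ** R t)) \<in> borel_measurable lebesgue"
      by (intro measurable_compose[OF _ borel_measurable_continuous_onI[OF continuous_op_norm]]) measurable
    show "(\<integral>\<^sup>+t\<in>Q. ennreal ((norm (R t ** S x))\<^sup>2) \<partial>lebesgue)
        \<le> ennreal CARD('n) * (\<integral>\<^sup>+t\<in>Q. ennreal ((op_norm (S x ** R t))\<^sup>2) \<partial>lebesgue)"
      using le by (subst nn_integral_cmult[symmetric])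
        (auto intro!: nn_integral_mono split: split_indicator simp: ennreal_leI simp flip: ennreal_mult)
  qed simp
  also have "\<dots> \<le> ennreal CARD('n) * (\<integral>\<^sup>+x\<in>Q. (\<integral>\<^sup>+t\<in>Q. ennreal ((op_norm (S x ** R t))\<^sup>2) \<partial>lebesgue) \<partial>lebesgue)"
  proof -
    have [measurable]: "(\<lambda>(x, t). op_norm (S x ** R t)) \<in> borel_measurable (lebesgue \<Otimes>\<^sub>M lebesgue)"
      unfolding split_def
      by (intro measurable_compose[OF _ borel_measurable_continuous_onI[OF continuous_op_norm]]) measurable
    interpret L: sigma_finite_measure "lebesgue :: (real^'d) measure" by (rule sigma_finite_lebesgue)
    have "(\<lambda>x. \<integral>\<^sup>+t\<in>Q. ennreal ((op_norm (S x ** R t))\<^sup>2) \<partial>lebesgue) \<in> borel_measurable lebesgue"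
      by (rule L.borel_measurable_nn_integral) measurable
    then show ?thesis by (subst nn_integral_cmult[symmetric]) (auto simp: mult.assoc)
  qed
  also have "\<dots> \<le> ennreal CARD('n) * ennreal (A * (vol Q)\<^sup>2)" by (intro mult_left_mono A2[OF Q]) simp
  also have "\<dots> = ennreal (vol Q) * ennreal (CARD('n) * A * vol Q)"
    using one_le_A by (simp add: power2_eq_square mult_ac flip: ennreal_mult)
  finally show ?thesis using vol_pos[of Q] by (subst (asm) ennreal_mult_le_mult_iff) auto
qed

text \<open>As products of Hermitian matrices, \<open>red I ** S x\<close> and \<open>S x ** red I\<close> have equal Frobenius norms.\<close>

definition local_max :: "nat \<Rightarrow> (real^'d) set \<Rightarrow> real^'d \<Rightarrow> ennreal" where
  "local_max m Q x = (SUP I\<in>below m Q. ennreal ((norm (red I ** S x))\<^sup>2) * indicator I x)"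

lemma local_max_measurable [measurable]: "local_max m Q \<in> borel_measurable lebesgue"
proof -
  have "(\<lambda>x. ennreal ((norm (red I ** S x))\<^sup>2) * indicator I x) \<in> borel_measurable lebesgue"
    if "I \<in> below m Q" for I
  proof -
    have [measurable]: "I \<in> sets lebesgue" using sets_D that by (auto simp: below_def)
    show ?thesis by measurable
  qed
  then show ?thesis unfolding local_max_def by (intro borel_measurable_SUP countable_below)
qed

text \<open>Stop at the maximal cubes \<open>J\<close> with \<open>\<parallel>red J (red Q)\<^sup>-\<^sup>1\<parallel>\<^sup>2 > 2 n\<close>. They fill at most half of \<open>Q\<close>, and by
induction they contribute at most half of the claimed bound. Any other cube \<open>I\<close> satisfies
\<open>\<parallel>red I S(x)\<parallel>\<^sup>2 \<le> 2 n \<parallel>red Q S(x)\<parallel>\<^sup>2\<close>, and the integral of the right-hand side is the other half.\<close>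

lemma nn_integral_local_max_step:
  assumes "Q \<in> D"
  shows "(\<integral>\<^sup>+x. local_max m Q x \<partial>lebesgue) \<le> ennreal (4 * (real CARD('n))\<^sup>2 * A * vol Q)"
  using assms
proof (induction m arbitrary: Q)
  let ?N = "real CARD('n)"
  have N: "1 \<le> ?N" by (simp add: Suc_leI)
  have N2: "?N \<le> 4 * ?N\<^sup>2"
  proof -
    have "?N * 1 \<le> ?N * ?N" using N by (intro mult_left_mono) auto
    then show ?thesis unfolding power2_eq_square using N by linarith
  qed
  {
    case (0 Q)
    have "(\<integral>\<^sup>+x. local_max 0 Q x \<partial>lebesgue) \<le> (\<integral>\<^sup>+x\<in>Q. ennreal ((norm (red Q ** S x))\<^sup>2) \<partial>lebesgue)"
      unfolding local_max_def using below_0[OF 0] by (intro nn_integral_mono SUP_least) auto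
    also have "\<dots> \<le> ennreal (?N * A * vol Q)" by (rule nn_integral_red_S[OF 0])
    also have "\<dots> \<le> ennreal (4 * ?N\<^sup>2 * A * vol Q)"
      using one_le_A by (intro ennreal_leI mult_right_mono N2) auto
    finally show ?case .
  next
    case (Suc m Q)
    note Q = \<open>Q \<in> D\<close>
    have [measurable]: "Q \<in> sets lebesgue" using Q by (rule sets_D)
    define F where "F = {J \<in> below (Suc m) Q. 2 * ?N < (norm (red J ** redinv Q))\<^sup>2}"
    have F: "F \<subseteq> D" by (auto simp: F_def below_def)
    have nQ: "(norm (red Q ** redinv Q))\<^sup>2 = ?N"
      unfolding redinv(1)[OF Q] norm_matrix_columns by (simp add: norm_axis_complex)
    have FQ: "J \<subseteq> Q" "lev J \<le> lev Q" "J \<noteq> Q" if "J \<in> F" for J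
      using that Q lev_mono[of J Q] nQ N by (auto simp: F_def below_def)
    have mxD: "J \<in> D" "J \<in> F" if "J \<in> maximal F" for J using that F maximal_subset by blast+
    have "ennreal (2 * ?N) * emeasure lebesgue (\<Union>(maximal F))
        \<le> (\<integral>\<^sup>+t\<in>Q. ennreal ((norm (R t ** redinv Q))\<^sup>2) \<partial>lebesgue)"
    proof (rule emeasure_stopping_le[OF F FQ(1)])
      fix J assume J: "J \<in> F"
      then have JD: "J \<in> D" using F by blast
      have "2 * ?N * vol J \<le> vol J * (norm (red J ** redinv Q))\<^sup>2"
        unfolding mult.commute[of _ "vol J"] using J by (intro mult_left_mono) (auto simp: F_def)
      then show "ennreal (2 * ?N) * emeasure lebesgue J \<le> (\<integral>\<^sup>+t\<in>J. ennreal ((norm (R t ** redinv Q))\<^sup>2) \<partial>lebesgue)"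
        unfolding nn_integral_red_matrix[OF JD] by (simp add: emeasure_D[OF JD] ennreal_leI flip: ennreal_mult)
    qed auto
    also have "\<dots> = ennreal (2 * ?N) * ennreal (vol Q / 2)"
      unfolding nn_integral_red_matrix[OF Q] nQ by (simp add: mult.commute flip: ennreal_mult)
    finally have half: "emeasure lebesgue (\<Union>(maximal F)) \<le> ennreal (vol Q / 2)"
      using N by (subst (asm) ennreal_mult_le_mult_iff) auto
    have mon: "(norm (red I ** S x))\<^sup>2 \<le> 2 * ?N * (norm (red Q ** S x))\<^sup>2"
      if "I \<in> below (Suc m) Q" "I \<notin> F" for I x
    proof -
      have "red I ** S x = (red I ** redinv Q) ** (red Q ** S x)"
        by (metis matrix_mul_assoc matrix_mul_lid redinv(2)[OF Q])
      then have "norm (red I ** S x) \<le> norm (red I ** redinv Q) * norm (red Q ** S x)"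
        using norm_matrix_mult_le by metis
      then have "(norm (red I ** S x))\<^sup>2 \<le> (norm (red I ** redinv Q) * norm (red Q ** S x))\<^sup>2"
        by (intro power_mono) auto
      also have "\<dots> \<le> 2 * ?N * (norm (red Q ** S x))\<^sup>2"
        using that unfolding power_mult_distrib by (intro mult_right_mono) (auto simp: F_def)
      finally show ?thesis .
    qed
    have "(\<integral>\<^sup>+x. local_max (Suc m) Q x \<partial>lebesgue)
      \<le> (\<integral>\<^sup>+x. ennreal (2 * ?N) * (ennreal ((norm (red Q ** S x))\<^sup>2) * indicator Q x)
        + (\<integral>\<^sup>+J. local_max m J x \<partial>count_space (maximal F)) \<partial>lebesgue)"
    proof (rule nn_integral_mono)
      fix x
      show "local_max (Suc m) Q x \<le> ennreal (2 * ?N) * (ennreal ((norm (red Q ** S x))\<^sup>2) * indicator Q x)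
        + (\<integral>\<^sup>+J. local_max m J x \<partial>count_space (maximal F))"
        unfolding local_max_def[of "Suc m"]
      proof (rule SUP_least)
        fix I assume I: "I \<in> below (Suc m) Q"
        show "ennreal ((norm (red I ** S x))\<^sup>2) * indicator I x
          \<le> ennreal (2 * ?N) * (ennreal ((norm (red Q ** S x))\<^sup>2) * indicator Q x)
            + (\<integral>\<^sup>+J. local_max m J x \<partial>count_space (maximal F))"
        proof (cases "I \<in> F")
          case True
          then obtain J where J: "J \<in> maximal F" "I \<subseteq> J" using maximal_cover[OF F] FQ by metis
          have "J \<subset> Q" using FQ[OF mxD(2)[OF J(1)]] by auto
          then have "lev J < lev Q" using lev_less[OF mxD(1)[OF J(1)] Q] by simp
          then have "I \<in> below m J" using I J(2) by (auto simp: below_def)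
          then have "ennreal ((norm (red I ** S x))\<^sup>2) * indicator I x \<le> local_max m J x"
            unfolding local_max_def by (rule SUP_upper)
          also have "\<dots> \<le> (\<integral>\<^sup>+J. local_max m J x \<partial>count_space (maximal F))"
            using J(1) by (rule nn_integral_ge_point)
          finally show ?thesis by (simp add: add_increasing)
        next
          case False
          have "I \<subseteq> Q" using I by (simp add: below_def)
          then have "ennreal ((norm (red I ** S x))\<^sup>2) * indicator I x
              \<le> ennreal (2 * ?N) * (ennreal ((norm (red Q ** S x))\<^sup>2) * indicator Q x)"
            using mon[OF I False, of x]
            by (auto split: split_indicator simp: ennreal_leI simp flip: ennreal_mult)
          then show ?thesis by (simp add: add_increasing2)
        qed
      qed
    qed
    also have "\<dots> = ennreal (2 * ?N) * (\<integral>\<^sup>+x\<in>Q. ennreal ((norm (red Q ** S x))\<^sup>2) \<partial>lebesgue)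
        + (\<integral>\<^sup>+J. (\<integral>\<^sup>+x. local_max m J x \<partial>lebesgue) \<partial>count_space (maximal F))"
    proof -
      have m2: "(\<lambda>x. \<integral>\<^sup>+J. local_max m J x \<partial>count_space (maximal F)) \<in> borel_measurable lebesgue"
        using countable_maximal[OF F] by (intro borel_measurable_nn_integral_count_space) auto
      show ?thesis
        by (subst nn_integral_add[OF _ m2], measurable, subst nn_integral_cmult, measurable,
            subst nn_integral_count_space_nn_integral[OF countable_maximal[OF F]], auto)
    qed
    also have "\<dots> \<le> ennreal (2 * ?N) * ennreal (?N * A * vol Q) + ennreal (4 * ?N\<^sup>2 * A) * ennreal (vol Q / 2)"
    proof (intro add_mono mult_left_mono nn_integral_red_S Q)
      have "(\<integral>\<^sup>+J. (\<integral>\<^sup>+x. local_max m J x \<partial>lebesgue) \<partial>count_space (maximal F))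
         \<le> (\<integral>\<^sup>+J. ennreal (4 * ?N\<^sup>2 * A) * emeasure lebesgue J \<partial>count_space (maximal F))"
      proof (rule nn_integral_mono)
        fix J assume "J \<in> space (count_space (maximal F))"
        then have JD: "J \<in> D" using mxD by auto
        show "(\<integral>\<^sup>+x. local_max m J x \<partial>lebesgue) \<le> ennreal (4 * ?N\<^sup>2 * A) * emeasure lebesgue J"
          using Suc.IH[OF JD] one_le_A by (simp add: emeasure_D[OF JD] flip: ennreal_mult)
      qed
      also have "\<dots> = ennreal (4 * ?N\<^sup>2 * A) * emeasure lebesgue (\<Union>(maximal F))"
        by (simp add: nn_integral_cmult sum_emeasure_maximal[OF F F F])
      also have "\<dots> \<le> ennreal (4 * ?N\<^sup>2 * A) * ennreal (vol Q / 2)"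
        by (intro mult_left_mono half) simp
      finally show "(\<integral>\<^sup>+J. (\<integral>\<^sup>+x. local_max m J x \<partial>lebesgue) \<partial>count_space (maximal F))
        \<le> ennreal (4 * ?N\<^sup>2 * A) * ennreal (vol Q / 2)" .
    qed simp
    also have "\<dots> = ennreal (4 * ?N\<^sup>2 * A * vol Q)"
      using one_le_A by (simp add: power2_eq_square flip: ennreal_mult ennreal_plus)
    finally show ?case .
  }
qed

definition full_max :: "(real^'d) set \<Rightarrow> real^'d \<Rightarrow> ennreal" where
  "full_max Q x = (SUP m. local_max m Q x)"

lemma full_max_measurable [measurable]: "full_max Q \<in> borel_measurable lebesgue"
  unfolding full_max_def by (intro borel_measurable_SUP) auto

lemma full_max_upper:
  assumes "Q \<in> D" "I \<in> D" "I \<subseteq> Q" "x \<in> I"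
  shows "ennreal ((norm (red I ** S x))\<^sup>2) \<le> full_max Q x"
proof -
  have "ennreal ((norm (red I ** S x))\<^sup>2) * indicator I x \<le> local_max (nat (lev Q - lev I)) Q x"
    unfolding local_max_def by (rule SUP_upper[OF in_below[OF assms(1-3)]])
  also have "\<dots> \<le> full_max Q x" unfolding full_max_def by (rule SUP_upper) simp
  finally show ?thesis using assms(4) by simp
qed

lemma nn_integral_full_max:
  assumes "Q \<in> D"
  shows "(\<integral>\<^sup>+x. full_max Q x \<partial>lebesgue) \<le> ennreal (4 * (real CARD('n))\<^sup>2 * A * vol Q)"
proof -
  have "local_max m Q x \<le> local_max (Suc m) Q x" for m x
    unfolding local_max_def using below_mono[of m "Suc m" Q] by (intro SUP_subset_mono) auto
  then have "(\<integral>\<^sup>+x. full_max Q x \<partial>lebesgue) = (SUP m. \<integral>\<^sup>+x. local_max m Q x \<partial>lebesgue)"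
    unfolding full_max_def
    by (intro nn_integral_monotone_convergence_SUP incseq_SucI le_funI) auto
  also have "\<dots> \<le> ennreal (4 * (real CARD('n))\<^sup>2 * A * vol Q)"
    by (intro SUP_least nn_integral_local_max_step assms)
  finally show ?thesis .
qed

end

section \<open>The weak type estimate for reduced averages\<close>

text \<open>This is convexity of \<open>t \<mapsto> b\<^sup>t\<close> between \<open>0\<close> and \<open>1\<close>.\<close>

lemma powr_le_linear_interpolation:
  fixes b t :: real
  assumes "0 < b" "0 \<le> t" "t \<le> 1"
  shows "b powr t \<le> 1 - t + t * b"
proof -
  have "convex_on UNIV (exp :: real \<Rightarrow> real)" by (rule exp_convex)
  then have "exp ((1 - t) *\<^sub>R 0 + t *\<^sub>R ln b) \<le> (1 - t) * exp 0 + t * exp (ln b)"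
    using assms by (intro convex_onD) auto
  then show ?thesis using assms by (simp add: powr_def)
qed

lemma ex_dyadic_scale:
  fixes X :: real
  assumes "0 < X"
  obtains k :: int where "2 powi k < X" "X \<le> 2 powi (k + 1)"
proof
  define k where "k = \<lceil>log 2 X\<rceil> - 1"
  have eq: "(2::real) powi j = 2 powr real_of_int j" for j :: int by (simp add: powr_real_of_int')
  have X: "X = 2 powr (log 2 X)" using assms by simp
  have "real_of_int k < log 2 X" "log 2 X \<le> real_of_int (k + 1)" unfolding k_def by linarith+
  then show "2 powi k < X" "X \<le> 2 powi (k + 1)"
    unfolding eq by (subst X, simp)+
qed

lemma nn_integral_dyadic_powers_le:
  fixes X e :: real
  assumes "0 < X" "0 < e" "e \<le> 1"
  shows "(\<integral>\<^sup>+k. ennreal ((2 powi k) powr e) * indicator {k. 2 powi k < X} k \<partial>count_space UNIV)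
    \<le> ennreal (X powr e * (2 / e))"
proof -
  obtain k0 :: int where k0: "2 powi k0 < X" "X \<le> 2 powi (k0 + 1)" using ex_dyadic_scale[OF assms(1)] .
  have set_eq: "{k. 2 powi k < X} = {..k0}"
  proof (intro set_eqI iffI; simp)
    fix k :: int
    show "k \<le> k0" if "2 powi k < X"
    proof -
      have "\<not> (2::real) powi (k0 + 1) \<le> 2 powi k" using that k0(2) by simp
      then show ?thesis by (simp add: two_powi_le_iff)
    qed
    show "2 powi k < X" if "k \<le> k0"
    proof -
      have "(2::real) powi k \<le> 2 powi k0" using that by (simp add: two_powi_le_iff)
      then show ?thesis using k0(1) by simp
    qed
  qed
  have bij: "bij_betw (\<lambda>j. k0 - int j) UNIV {..k0}"
    by (rule bij_betwI[where g="\<lambda>k. nat (k0 - k)"]) auto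
  define r where "r = (1/2::real) powr e"
  have "r \<le> 1 - e + e * (1/2)" unfolding r_def using assms by (intro powr_le_linear_interpolation) auto
  then have r: "0 < r" "e / 2 \<le> 1 - r" by (auto simp: r_def)
  have geom: "(2 powi (k0 - int j)) powr e = (2 powi k0) powr e * r ^ j" for j
  proof -
    have "(2::real) powi (k0 - int j) = 2 powi k0 * (1/2) ^ j"
      by (simp add: power_int_diff power_divide)
    then show ?thesis by (simp add: powr_mult r_def powr_power powr_realpow[symmetric] powr_powr mult.commute)
  qed
  have "(\<integral>\<^sup>+k. ennreal ((2 powi k) powr e) * indicator {k. 2 powi k < X} k \<partial>count_space UNIV)
      = (\<integral>\<^sup>+k. ennreal ((2 powi k) powr e) \<partial>count_space {..k0})"
    unfolding set_eq by (subst nn_integral_count_space_indicator) auto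
  also have "\<dots> = (\<integral>\<^sup>+j. ennreal ((2 powi (k0 - int j)) powr e) \<partial>count_space UNIV)"
    by (rule nn_integral_bij_count_space[OF bij, symmetric])
  also have "\<dots> = (\<Sum>j. ennreal ((2 powi k0) powr e * r ^ j))"
    by (simp add: nn_integral_count_space_nat geom)
  also have "\<dots> = ennreal ((2 powi k0) powr e * (1 / (1 - r)))"
    using r assms(2) by (intro suminf_ennreal_eq sums_mult geometric_sums) auto
  also have "\<dots> \<le> ennreal (X powr e * (2 / e))"
  proof (intro ennreal_leI mult_mono)
    show "(2 powi k0) powr e \<le> X powr e" using k0(1) assms by (intro powr_mono2) auto
    show "1 / (1 - r) \<le> 2 / e" using r assms by (simp add: field_simps)
  qed (use r assms in auto)
  finally show ?thesis .
qed

text \<open>If \<open>s\<close> is small, the first term suffices. Otherwise compare \<open>16 N s\<close> with \<open>w\<^bsup>1 + 2 dl\<^esup>\<close>: in one case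
\<open>w s\<close> is at most the second term; in the other \<open>w \<le> (16 N s)\<^sup>p\<close>, which bounds \<open>w s\<close> by the third. The
coefficients are chosen so that after summation over \<open>N\<close> columns the first two terms absorb three quarters
of the volume of a cube in \<open>reduced_weak_bound\<close>.\<close>

lemma Young_split:
  fixes w s N dl :: real
  assumes "0 \<le> w" "0 \<le> s" "1 \<le> N" "0 < dl"
  defines "p \<equiv> 1 / (1 + 2 * dl)"
  shows "w * s \<le> w / (2 * N) + (w\<^sup>2) powr (1 + dl) / (16 * N)
    + 16 * N * (if 1 / (2 * N) < s then s powr (1 + p) else 0)"
proof (cases "1 / (2 * N) < s \<and> 0 < w")
  case False
  then have "w * s \<le> w / (2 * N)"
    using assms(1) mult_left_mono[of s "1 / (2 * N)" w] by (cases "w = 0") auto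
  moreover have "0 \<le> (w\<^sup>2) powr (1 + dl) / (16 * N)" using assms(3) by simp
  moreover have "0 \<le> 16 * N * (if 1 / (2 * N) < s then s powr (1 + p) else 0)" using assms(3) by simp
  ultimately show ?thesis by linarith
next
  case True
  then have s: "0 < s" "0 < w" using assms(3) by (auto intro: less_trans[rotated])
  have p: "0 < p" "p \<le> 1" using assms(4) by (auto simp: p_def)
  have nonneg: "0 \<le> w / (2 * N)" "0 \<le> (w\<^sup>2) powr (1 + dl) / (16 * N)" "0 \<le> 16 * N * s powr (1 + p)"
    using s assms(3) by auto
  have "w * s \<le> (w\<^sup>2) powr (1 + dl) / (16 * N) \<or> w * s \<le> 16 * N * s powr (1 + p)"
  proof (cases "16 * N * s \<le> w powr (1 + 2 * dl)")
    case True
    then have "w * (16 * N * s) \<le> w * w powr (1 + 2 * dl)" using s by (intro mult_left_mono) auto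
    also have "\<dots> = w powr (2 * (1 + dl))" using s by (simp add: powr_mult_base algebra_simps)
    also have "\<dots> = (w powr 2) powr (1 + dl)" by (simp only: powr_powr)
    also have "w powr 2 = w\<^sup>2" using s by simp
    finally show ?thesis using assms(3) by (auto simp: field_simps)
  next
    case False
    have "w = (w powr (1 + 2 * dl)) powr p" using s assms(4) by (simp add: powr_powr p_def)
    also have "\<dots> \<le> (16 * N * s) powr p" using False p by (intro powr_mono2) auto
    also have "\<dots> = (16 * N) powr p * s powr p" using s assms(3) by (simp add: powr_mult)
    also have "\<dots> \<le> (16 * N) powr 1 * s powr p" using p assms(3) by (intro mult_right_mono powr_mono) auto
    finally have "w * s \<le> (16 * N * s powr p) * s" using s assms(3) by (intro mult_right_mono) auto
    also have "\<dots> = 16 * N * s powr (1 + p)" using s by (simp add: powr_add mult.commute)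
    finally show ?thesis by simp
  qed
  then show ?thesis using True nonneg by auto
qed

lemma norm_matrix_le_sum_columns: "norm (A :: complex^'n^'n) \<le> (\<Sum>j\<in>UNIV. norm (A *v axis j 1))"
proof -
  have "norm A = L2_set (\<lambda>j. norm (A *v axis j 1)) UNIV"
    unfolding L2_set_def norm_matrix_columns[symmetric] by simp
  then show ?thesis by (simp add: L2_set_le_sum)
qed

context matrix_A2
begin

text \<open>Without normalization by the volume; \<open>reduced f I / vol I\<close> is the number \<open>a\<^sub>I\<close> of the introduction.\<close>

definition reduced :: "(real^'d \<Rightarrow> complex^'n) \<Rightarrow> (real^'d) set \<Rightarrow> ennreal" where
  "reduced f I = (\<integral>\<^sup>+y\<in>I. ennreal (norm (redinv I ** R y) * norm (f y)) \<partial>lebesgue)"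

text \<open>The power of \<open>|f| / l\<close> that remains once the values of \<open>f\<close> too small to contribute at the level
\<open>l\<close> have been discarded. This truncation makes the sum over all dyadic levels converge.\<close>

definition tail :: "real \<Rightarrow> (real^'d \<Rightarrow> complex^'n) \<Rightarrow> real \<Rightarrow> real^'d \<Rightarrow> real" where
  "tail p f l y = (if 1 / (2 * real CARD('n)) < norm (f y) / l then (norm (f y) / l) powr (1 + p) else 0)"

lemma tail_measurable [measurable]:
  assumes [measurable]: "f \<in> borel_measurable lebesgue"
  shows "tail p f l \<in> borel_measurable lebesgue"
  unfolding tail_def by measurable

lemma tail_nonneg: "0 \<le> tail p f l y"
  by (simp add: tail_def)

text \<open>The columns of \<open>R (red I)\<^sup>-\<^sup>1\<close> are normalized: their squared lengths have mean one over \<open>I\<close>.\<close>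

lemma column_weight:
  assumes "I \<in> D"
  defines "u \<equiv> \<lambda>j. redinv I *v axis j 1"
  shows "u j \<noteq> 0" and "scalar_A2.mass (\<lambda>t. (norm (R t *v u j))\<^sup>2) I = vol I"
    and "scalar_A2.mean D (\<lambda>t. (norm (R t *v u j))\<^sup>2) I = 1"
proof -
  have ru: "red I *v u j = axis j 1"
    using redinv(1)[OF assms(1)] by (simp add: u_def matrix_vector_mul_assoc)
  then show nz: "u j \<noteq> 0" using axis_1_nonzero[of j] by (metis matrix_vector_mult_0_right)
  interpret v: scalar_A2 D "\<lambda>t. (norm (R t *v u j))\<^sup>2" A by (rule scalar_A2[OF nz])
  show m: "v.mass I = vol I"
    using v.nn_integral_v[OF assms(1)] nn_integral_red[OF assms(1), of "u j"] v.mass_pos[OF assms(1)]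
    by (simp add: ru norm_axis_complex)
  show "v.mean I = 1" using vol_pos[of I] by (simp add: v.mean_def m)
qed

text \<open>Estimate \<open>\<parallel>(red I)\<^sup>-\<^sup>1 R\<parallel>\<close> by the sum of the lengths of the columns of \<open>R (red I)\<^sup>-\<^sup>1\<close>, split each product
with \<open>|f| / l\<close> by Young's inequality, and integrate. The linear terms add up to at most half of the volume,
the powers to at most a quarter by the reverse Hoelder inequality; as the sum exceeds the volume, the tail
term accounts for the remaining quarter.\<close>

lemma reduced_weak_bound:
  assumes [measurable]: "f \<in> borel_measurable lebesgue" and I: "I \<in> D" and l: "0 < l"
    and dl: "0 < dl" "dl \<le> 1" and rho: "(2 * 2 ^ CARD('d)) powr dl \<le> 1 + 1 / (8 * A)"
    and big: "ennreal (l * vol I) < reduced f I"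
  shows "ennreal (vol I) \<le> ennreal (64 * (real CARD('n))\<^sup>2) *
    (\<integral>\<^sup>+y\<in>I. ennreal (tail (1 / (1 + 2 * dl)) f l y) \<partial>lebesgue)"
proof -
  let ?N = "real CARD('n)" and ?t = "tail (1 / (1 + 2 * dl)) f l"
  let ?T = "\<integral>\<^sup>+y\<in>I. ennreal (?t y) \<partial>lebesgue"
  have N: "1 \<le> ?N" by (simp add: Suc_leI)
  define c1 where "c1 = l / (2 * ?N)"
  define c2 where "c2 = l / (16 * ?N)"
  define c3 where "c3 = 16 * ?N * l"
  note c_defs = c1_def c2_def c3_def
  have c: "0 \<le> c1" "0 \<le> c2" "0 \<le> c3" using l by (auto simp: c_defs)
  have [measurable]: "I \<in> sets lebesgue" using I by (rule sets_D)
  define w where "w j y = norm (R y *v (redinv I *v axis j 1))" for j y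
  have w_meas [measurable]: "w j \<in> borel_measurable lebesgue" for j unfolding w_def by measurable
  have w0: "0 \<le> w j y" for j y by (simp add: w_def)
  have pt: "norm (redinv I ** R y) * norm (f y)
      \<le> (\<Sum>j\<in>UNIV. c1 * w j y + c2 * ((w j y)\<^sup>2) powr (1 + dl) + c3 * ?t y)" for y
  proof -
    have "norm (redinv I ** R y) = norm (R y ** redinv I)"
      by (rule norm_hermitian_mult_commute[OF redinv(3)[OF I] hermitian_R])
    also have "\<dots> \<le> (\<Sum>j\<in>UNIV. w j y)"
      using norm_matrix_le_sum_columns[of "R y ** redinv I"] by (simp add: w_def matrix_vector_mul_assoc)
    finally have "norm (redinv I ** R y) * norm (f y) \<le> (\<Sum>j\<in>UNIV. w j y) * norm (f y)"
      by (rule mult_right_mono) simp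
    also have "\<dots> = (\<Sum>j\<in>UNIV. l * (w j y * (norm (f y) / l)))"
      using l by (simp add: sum_distrib_right)
    also have "\<dots> \<le> (\<Sum>j\<in>(UNIV::'n set). l * (w j y / (2 * ?N) + ((w j y)\<^sup>2) powr (1 + dl) / (16 * ?N) + 16 * ?N * ?t y))"
      unfolding tail_def using l N dl(1) by (intro sum_mono mult_left_mono Young_split w0) simp_all
    finally show ?thesis by (simp add: c_defs algebra_simps)
  qed
  have int_w: "(\<integral>\<^sup>+y\<in>I. ennreal (w j y) \<partial>lebesgue) \<le> ennreal (vol I)"
    and int_RH: "(\<integral>\<^sup>+y\<in>I. ennreal (((w j y)\<^sup>2) powr (1 + dl)) \<partial>lebesgue) \<le> ennreal (4 * vol I)" for j
  proof -
    note cw = column_weight[OF I, of j]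
    interpret v: scalar_A2 D "\<lambda>t. (norm (R t *v (redinv I *v axis j 1)))\<^sup>2" A by (rule scalar_A2[OF cw(1)])
    show "(\<integral>\<^sup>+y\<in>I. ennreal (((w j y)\<^sup>2) powr (1 + dl)) \<partial>lebesgue) \<le> ennreal (4 * vol I)"
      using v.reverse_Holder[OF dl rho I] unfolding cw w_def by simp
    have sq: "(\<integral>\<^sup>+y\<in>I. ennreal ((w j y)\<^sup>2) \<partial>lebesgue) = ennreal (vol I)"
      using v.nn_integral_v[OF I] unfolding cw w_def .
    define h :: real where "h = 1/2"
    have h: "0 \<le> h" by (simp add: h_def)
    have "(\<integral>\<^sup>+y\<in>I. ennreal (w j y) \<partial>lebesgue)
        \<le> (\<integral>\<^sup>+y. ennreal h * indicator I y + ennreal h * (ennreal ((w j y)\<^sup>2) * indicator I y) \<partial>lebesgue)"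
    proof (rule nn_integral_mono)
      fix y
      have "w j y \<le> h + h * (w j y)\<^sup>2" using sum_squares_bound[of 1 "w j y"] by (simp add: h_def)
      then show "ennreal (w j y) * indicator I y
          \<le> ennreal h * indicator I y + ennreal h * (ennreal ((w j y)\<^sup>2) * indicator I y)"
        using w0[of j y] h by (auto split: split_indicator simp: ennreal_leI simp flip: ennreal_mult ennreal_plus)
    qed
    also have "\<dots> = ennreal h * emeasure lebesgue I + ennreal h * (\<integral>\<^sup>+y\<in>I. ennreal ((w j y)\<^sup>2) \<partial>lebesgue)"
      by (subst nn_integral_add, measurable, subst nn_integral_cmult, measurable) (simp add: nn_integral_cmult_indicator)
    also have "\<dots> = ennreal (vol I)"
      unfolding sq emeasure_D[OF I] using h by (simp flip: ennreal_mult ennreal_plus) (simp add: h_def)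
    finally show "(\<integral>\<^sup>+y\<in>I. ennreal (w j y) \<partial>lebesgue) \<le> ennreal (vol I)" .
  qed
  have "reduced f I \<le> (\<integral>\<^sup>+y. (\<Sum>j\<in>(UNIV::'n set). ennreal c1 * (ennreal (w j y) * indicator I y)
      + ennreal c2 * (ennreal (((w j y)\<^sup>2) powr (1 + dl)) * indicator I y)
      + ennreal c3 * (ennreal (?t y) * indicator I y)) \<partial>lebesgue)"
    unfolding reduced_def
  proof (rule nn_integral_mono)
    fix y
    have "ennreal (norm (redinv I ** R y) * norm (f y))
        \<le> (\<Sum>j\<in>(UNIV::'n set). ennreal (c1 * w j y + c2 * ((w j y)\<^sup>2) powr (1 + dl) + c3 * ?t y))"
      using pt[of y] c w0 tail_nonneg by (subst sum_ennreal) (auto intro!: ennreal_leI add_nonneg_nonneg)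
    also have "\<dots> = (\<Sum>j\<in>(UNIV::'n set). ennreal c1 * ennreal (w j y)
      + ennreal c2 * ennreal (((w j y)\<^sup>2) powr (1 + dl)) + ennreal c3 * ennreal (?t y))"
      using c w0 tail_nonneg by (intro sum.cong refl) (simp add: ennreal_mult ennreal_plus)
    finally show "ennreal (norm (redinv I ** R y) * norm (f y)) * indicator I y
      \<le> (\<Sum>j\<in>(UNIV::'n set). ennreal c1 * (ennreal (w j y) * indicator I y)
      + ennreal c2 * (ennreal (((w j y)\<^sup>2) powr (1 + dl)) * indicator I y)
      + ennreal c3 * (ennreal (?t y) * indicator I y))"
      by (cases "y \<in> I") auto
  qed
  also have "\<dots> = (\<Sum>j\<in>(UNIV::'n set). ennreal c1 * (\<integral>\<^sup>+y\<in>I. ennreal (w j y) \<partial>lebesgue)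
      + ennreal c2 * (\<integral>\<^sup>+y\<in>I. ennreal (((w j y)\<^sup>2) powr (1 + dl)) \<partial>lebesgue)
      + ennreal c3 * ?T)"
    by (subst nn_integral_sum) (simp_all add: nn_integral_add nn_integral_cmult)
  also have "\<dots> \<le> (\<Sum>j\<in>(UNIV::'n set). ennreal c1 * ennreal (vol I)
      + ennreal c2 * ennreal (4 * vol I) + ennreal c3 * ?T)"
    by (intro sum_mono add_mono mult_left_mono int_w int_RH) auto
  finally have le: "reduced f I \<le> ennreal ?N * (ennreal c1 * ennreal (vol I)
      + ennreal c2 * ennreal (4 * vol I) + ennreal c3 * ?T)"
    by (simp add: ennreal_of_nat_eq_real_of_nat)
  show ?thesis
  proof (cases "?T = \<infinity>")
    case True
    then show ?thesis using N by (simp add: ennreal_mult_top)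
  next
    case False
    then have "?T < \<infinity>" by (simp add: less_top)
    then obtain T where T: "0 \<le> T" "?T = ennreal T" by (rule ennreal_finiteE)
    have "ennreal (l * vol I) < ennreal (?N * (c1 * vol I + c2 * (4 * vol I) + c3 * T))"
      using less_le_trans[OF big le] c T N by (simp add: ennreal_mult ennreal_plus)
    then have "l * vol I < ?N * (c1 * vol I + c2 * (4 * vol I) + c3 * T)"
      using l by (subst (asm) ennreal_less_iff) auto
    also have "\<dots> = l * (3/4 * vol I + 16 * ?N\<^sup>2 * T)" using N by (simp add: c_defs field_simps power2_eq_square)
    finally have "vol I < 3/4 * vol I + 16 * ?N\<^sup>2 * T" using l by simp
    then have "vol I \<le> 64 * ?N\<^sup>2 * T" by simp
    then show ?thesis unfolding T(2) using T(1) by (simp add: ennreal_leI flip: ennreal_mult)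
  qed
qed

text \<open>A crude bound by Cauchy--Schwarz. It shows that \<open>a\<^sub>I\<close> is finite and that it tends to zero as \<open>I\<close>
grows, so that maximal cubes exist at every level.\<close>

lemma reduced_square_le:
  assumes [measurable]: "f \<in> borel_measurable lebesgue" and I: "I \<in> D"
  shows "(reduced f I)\<^sup>2 \<le> ennreal (CARD('n) * vol I) * (\<integral>\<^sup>+y. ennreal ((norm (f y))\<^sup>2) \<partial>lebesgue)"
proof -
  have [measurable]: "I \<in> sets lebesgue" using I by (rule sets_D)
  have id: "(\<integral>\<^sup>+y\<in>I. ennreal ((norm (redinv I ** R y))\<^sup>2) \<partial>lebesgue) = ennreal (CARD('n) * vol I)"
    using nn_integral_red_matrix[OF I, of "redinv I"] norm_hermitian_mult_commute[OF redinv(3)[OF I] hermitian_R]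
    by (simp add: redinv(1)[OF I] norm_matrix_columns norm_axis_complex mult.commute)
  let ?g = "\<lambda>y. ennreal (norm (redinv I ** R y)) * indicator I y"
  have "(reduced f I)\<^sup>2 = (\<integral>\<^sup>+y. ?g y * ennreal (norm (f y)) \<partial>lebesgue)\<^sup>2"
    unfolding reduced_def
    by (intro arg_cong[where f="\<lambda>x. x\<^sup>2"] nn_integral_cong) (auto split: split_indicator simp: ennreal_mult)
  also have "\<dots> \<le> (\<integral>\<^sup>+y. (?g y)\<^sup>2 \<partial>lebesgue) * (\<integral>\<^sup>+y. (ennreal (norm (f y)))\<^sup>2 \<partial>lebesgue)"
    by (rule Cauchy_Schwarz_nn_integral) measurable
  also have "(\<integral>\<^sup>+y. (?g y)\<^sup>2 \<partial>lebesgue) = ennreal (CARD('n) * vol I)"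
    unfolding id[symmetric] by (intro nn_integral_cong) (auto split: split_indicator simp: ennreal_power)
  finally show ?thesis by (simp add: ennreal_power)
qed

end

section \<open>The square integral of the maximal function\<close>

lemma SUP_power2_le_ennreal:
  fixes f :: "'i \<Rightarrow> ennreal"
  assumes "\<And>i. i \<in> I \<Longrightarrow> (f i)\<^sup>2 \<le> B"
  shows "(SUP i\<in>I. f i)\<^sup>2 \<le> B"
proof -
  have "f i * f j \<le> B" if "i \<in> I" "j \<in> I" for i j
  proof (cases "f i \<le> f j")
    case True
    then have "f i * f j \<le> f j * f j" by (intro mult_right_mono) auto
    then show ?thesis using assms[OF that(2)] by (simp add: power2_eq_square)
  next
    case False
    then have "f i * f j \<le> f i * f i" by (intro mult_left_mono) auto
    then show ?thesis using assms[OF that(1)] by (simp add: power2_eq_square)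
  qed
  then show ?thesis
    unfolding power2_eq_square SUP_mult_left_ennreal SUP_mult_right_ennreal by (intro SUP_least)
qed

context matrix_A2
begin

definition max_fn :: "(real^'d \<Rightarrow> complex^'n) \<Rightarrow> real^'d \<Rightarrow> ennreal" where
  "max_fn f x = (SUP I\<in>{I\<in>D. x \<in> I}. avg I (\<lambda>y. ennreal (norm ((S x ** R y) *v f y))))"

text \<open>The supremum over the cubes containing \<open>x\<close> becomes a countable supremum of measurable functions once
each average is multiplied by the indicator of its cube.\<close>

lemma max_fn_measurable:
  assumes [measurable]: "f \<in> borel_measurable lebesgue"
  shows "max_fn f \<in> borel_measurable lebesgue"
proof -
  interpret L: sigma_finite_measure "lebesgue :: (real^'d) measure" by (rule sigma_finite_lebesgue)
  let ?g = "\<lambda>I x. avg I (\<lambda>y. ennreal (norm ((S x ** R y) *v f y))) * indicator I x"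
  have "max_fn f x = (SUP I\<in>D. ?g I x)" for x
    unfolding max_fn_def
  proof (rule antisym; rule SUP_least)
    fix I assume "I \<in> {I\<in>D. x \<in> I}"
    then show "avg I (\<lambda>y. ennreal (norm ((S x ** R y) *v f y))) \<le> (SUP I\<in>D. ?g I x)"
      by (intro SUP_upper2[of I]) auto
  next
    fix I assume I: "I \<in> D"
    show "?g I x \<le> (SUP I\<in>{I\<in>D. x \<in> I}. avg I (\<lambda>y. ennreal (norm ((S x ** R y) *v f y))))"
      using I by (cases "x \<in> I") (auto intro: SUP_upper)
  qed
  moreover have "?g I \<in> borel_measurable lebesgue" if I: "I \<in> D" for I
  proof -
    have [measurable]: "I \<in> sets lebesgue" using I by (rule sets_D)
    have "(\<lambda>x. \<integral>\<^sup>+y. ennreal (norm ((S x ** R y) *v f y)) * indicator I y \<partial>lebesgue) \<in> borel_measurable lebesgue"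
      by (rule L.borel_measurable_nn_integral) measurable
    then show ?thesis unfolding avg_def by measurable
  qed
  then have "(\<lambda>x. SUP I\<in>D. ?g I x) \<in> borel_measurable lebesgue"
    by (intro borel_measurable_SUP countable_D)
  ultimately show ?thesis by (simp add: fun_eq_iff cong: measurable_cong)
qed

lemma avg_le_reduced:
  assumes [measurable]: "f \<in> borel_measurable lebesgue" and I: "I \<in> D"
  shows "avg I (\<lambda>y. ennreal (norm ((S x ** R y) *v f y)))
    \<le> ennreal (norm (red I ** S x)) * (reduced f I / ennreal (vol I))"
proof -
  have [measurable]: "I \<in> sets lebesgue" using I by (rule sets_D)
  have "norm ((S x ** R y) *v f y) \<le> norm (red I ** S x) * (norm (redinv I ** R y) * norm (f y))" for y
  proof -
    have "S x ** R y = (S x ** red I) ** (redinv I ** R y)"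
      by (metis matrix_mul_assoc matrix_mul_lid redinv(1)[OF I])
    then have "norm (S x ** R y) \<le> norm (S x ** red I) * norm (redinv I ** R y)"
      using norm_matrix_mult_le by metis
    also have "norm (S x ** red I) = norm (red I ** S x)"
      by (rule norm_hermitian_mult_commute[OF hermitian_S redinv(4)[OF I]])
    finally have "norm (S x ** R y) * norm (f y) \<le> norm (red I ** S x) * norm (redinv I ** R y) * norm (f y)"
      by (intro mult_right_mono) auto
    then show ?thesis using norm_matrix_vector_le[of "S x ** R y" "f y"] by (simp add: mult.assoc)
  qed
  then have "(\<integral>\<^sup>+y\<in>I. ennreal (norm ((S x ** R y) *v f y)) \<partial>lebesgue)
      \<le> (\<integral>\<^sup>+y. ennreal (norm (red I ** S x)) * (ennreal (norm (redinv I ** R y) * norm (f y)) * indicator I y) \<partial>lebesgue)"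
    by (intro nn_integral_mono) (auto split: split_indicator simp: ennreal_leI simp flip: ennreal_mult)
  also have "\<dots> = ennreal (norm (red I ** S x)) * reduced f I"
    unfolding reduced_def by (subst nn_integral_cmult) auto
  finally show ?thesis
    unfolding avg_def emeasure_D[OF I] ennreal_times_divide by (rule divide_right_mono_ennreal)
qed

definition superlevel :: "(real^'d \<Rightarrow> complex^'n) \<Rightarrow> int \<Rightarrow> (real^'d) set set" where
  "superlevel f k = {I\<in>D. ennreal (2 powi k * vol I) < reduced f I}"

lemma superlevel_subset: "superlevel f k \<subseteq> D"
  by (auto simp: superlevel_def)

lemma lev_superlevel_bounded:
  assumes f: "f \<in> borel_measurable lebesgue" and fin: "(\<integral>\<^sup>+y. ennreal ((norm (f y))\<^sup>2) \<partial>lebesgue) < \<infinity>"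
  obtains K where "\<And>I. I \<in> superlevel f k \<Longrightarrow> lev I \<le> K"
proof -
  obtain P where P: "0 \<le> P" "(\<integral>\<^sup>+y. ennreal ((norm (f y))\<^sup>2) \<partial>lebesgue) = ennreal P"
    using fin by (rule ennreal_finiteE)
  define l :: real where "l = 2 powi k"
  have l: "0 < l" by (simp add: l_def)
  define C where "C = real CARD('n) * P / l\<^sup>2"
  have "lev I \<le> max 0 \<lceil>C\<rceil>" if I: "I \<in> superlevel f k" for I
  proof (cases "0 \<le> lev I")
    case True
    have ID: "I \<in> D" using I superlevel_subset by blast
    have "ennreal ((l * vol I)\<^sup>2) = (ennreal (l * vol I))\<^sup>2" using l by (simp add: ennreal_power)
    also have "\<dots> \<le> (reduced f I)\<^sup>2"
      using I by (intro power_mono) (auto simp: superlevel_def l_def)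
    also have "\<dots> \<le> ennreal (real CARD('n) * vol I * P)"
      using reduced_square_le[OF f ID] P(1) by (simp add: P(2) ennreal_mult)
    finally have "(l * vol I)\<^sup>2 \<le> real CARD('n) * vol I * P"
      using P(1) by (subst (asm) ennreal_le_iff) auto
    then have "vol I \<le> C"
      using l vol_pos[of I] by (simp add: C_def power2_eq_square field_simps)
    moreover have "real_of_int (lev I) \<le> vol I"
    proof -
      have eq: "(2::real) powi lev I = 2 ^ nat (lev I)" using True by (simp add: power_int_def)
      have "real_of_int (lev I) = real (nat (lev I))" using True by simp
      also have "\<dots> \<le> 2 ^ nat (lev I)" by (rule less_imp_le, rule of_nat_less_two_power)
      also have "\<dots> \<le> (2 ^ nat (lev I)) ^ CARD('d)" by (intro self_le_power) auto
      finally show ?thesis by (simp add: vol_def eq)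
    qed
    ultimately show ?thesis by linarith
  qed auto
  with that show ?thesis by blast
qed

text \<open>Choose \<open>k\<close> with \<open>2\<^sup>k < a\<^sub>I \<le> 2\<^sup>k\<^sup>+\<^sup>1\<close>. The cube \<open>I\<close> belongs to the superlevel family at \<open>k\<close>, hence lies in one
of its maximal cubes \<open>J\<close>, and \<open>\<parallel>red I S(x)\<parallel>\<^sup>2\<close> is one of the competitors in \<open>full_max J x\<close>.\<close>

lemma max_fn_square_le:
  assumes f [measurable]: "f \<in> borel_measurable lebesgue"
    and fin: "(\<integral>\<^sup>+y. ennreal ((norm (f y))\<^sup>2) \<partial>lebesgue) < \<infinity>"
  shows "(max_fn f x)\<^sup>2 \<le> (\<integral>\<^sup>+k. ennreal (4 * (2 powi k)\<^sup>2) *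
    (\<integral>\<^sup>+J. full_max J x \<partial>count_space (maximal (superlevel f k))) \<partial>count_space UNIV)" (is "_ \<le> ?B")
  unfolding max_fn_def
proof (rule SUP_power2_le_ennreal)
  fix I assume "I \<in> {I\<in>D. x \<in> I}"
  then have I: "I \<in> D" "x \<in> I" by auto
  have "(reduced f I)\<^sup>2 < \<infinity>"
    using le_less_trans[OF reduced_square_le[OF f I(1)], of \<infinity>] fin by (simp add: ennreal_mult_less_top)
  then have "reduced f I < \<infinity>" by (cases "reduced f I") (auto simp: power2_eq_square)
  then obtain r where r: "0 \<le> r" "reduced f I = ennreal r" by (rule ennreal_finiteE)
  define a where "a = r / vol I"
  have a0: "0 \<le> a" using r by (simp add: a_def)
  have "(avg I (\<lambda>y. ennreal (norm ((S x ** R y) *v f y))))\<^sup>2 \<le> (ennreal (norm (red I ** S x)) * ennreal a)\<^sup>2"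
    using avg_le_reduced[OF f I(1), of x] r vol_pos[of I] by (intro power_mono) (auto simp: divide_ennreal a_def)
  also have "\<dots> = ennreal (a\<^sup>2) * ennreal ((norm (red I ** S x))\<^sup>2)"
    using a0 by (simp add: power_mult_distrib ennreal_power mult.commute)
  also have "\<dots> \<le> ?B"
  proof (cases "a = 0")
    case False
    then have "0 < a" using a0 by simp
    then obtain k where k: "2 powi k < a" "a \<le> 2 powi (k + 1)" by (rule ex_dyadic_scale)
    have "2 powi k * vol I < r" using k(1) vol_pos[of I] by (simp add: a_def field_simps)
    then have IF: "I \<in> superlevel f k" using I r by (simp add: superlevel_def ennreal_less_iff)
    obtain K where "\<And>J. J \<in> superlevel f k \<Longrightarrow> lev J \<le> K" using lev_superlevel_bounded[OF f fin] by metis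
    then obtain J where J: "J \<in> maximal (superlevel f k)" "I \<subseteq> J"
      using maximal_cover[OF superlevel_subset IF] by metis
    have JD: "J \<in> D" using J(1) maximal_subset superlevel_subset by blast
    have "a\<^sup>2 \<le> (2 * 2 powi k)\<^sup>2" using k(2) a0 by (intro power_mono) (auto simp: power_int_add)
    then have "ennreal (a\<^sup>2) * ennreal ((norm (red I ** S x))\<^sup>2) \<le> ennreal (4 * (2 powi k)\<^sup>2) * full_max J x"
      by (intro mult_mono ennreal_leI full_max_upper[OF JD I(1) J(2) I(2)]) (auto simp: power_mult_distrib)
    also have "\<dots> \<le> ennreal (4 * (2 powi k)\<^sup>2) *
        (\<integral>\<^sup>+J. full_max J x \<partial>count_space (maximal (superlevel f k)))"
      by (intro mult_left_mono nn_integral_ge_point J(1)) auto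
    also have "\<dots> \<le> ?B" by (rule nn_integral_ge_point) simp
    finally show ?thesis .
  qed simp
  finally show "(avg I (\<lambda>y. ennreal (norm ((S x ** R y) *v f y))))\<^sup>2 \<le> ?B" .
qed

text \<open>With \<open>e = 1 - p\<close>, which is comparable to \<open>dl\<close>, the summand is \<open>|f|\<^bsup>1 + p\<^esup> (2\<^sup>k)\<^sup>e\<close> for \<open>2\<^sup>k < 2 n |f|\<close> and zero
otherwise: a geometric series whose sum is of the order \<open>|f|\<^sup>2 / e\<close>.\<close>

lemma tail_sum_le:
  assumes dl: "0 < dl" "dl \<le> 1"
  defines "p \<equiv> 1 / (1 + 2 * dl)"
  shows "(\<integral>\<^sup>+k. ennreal ((2 powi k)\<^sup>2 * tail p f (2 powi k) y) \<partial>count_space UNIV)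
    \<le> ennreal (6 * real CARD('n) / dl * (norm (f y))\<^sup>2)"
proof (cases "f y = 0")
  case True
  then have "tail p f (2 powi k) y = 0" for k by (simp add: tail_def)
  then show ?thesis by simp
next
  case False
  let ?N = "real CARD('n)"
  have N: "1 \<le> ?N" by (simp add: Suc_leI)
  define s where "s = norm (f y)"
  define X where "X = 2 * ?N * s"
  define e where "e = 1 - p"
  have s: "0 < s" using False by (simp add: s_def)
  have X: "0 < X" using s N by (simp add: X_def)
  have p: "0 < p" "p < 1" using dl by (auto simp: p_def)
  have e: "0 < e" "e \<le> 1" using p by (auto simp: e_def)
  have e_lower: "2 * dl / 3 \<le> e"
  proof -
    have "e = 2 * dl / (1 + 2 * dl)" using dl by (simp add: e_def p_def field_simps)
    also have "\<dots> \<ge> 2 * dl / 3" using dl by (intro divide_left_mono) auto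
    finally show ?thesis .
  qed
  have sc: "(2 powi k)\<^sup>2 * tail p f (2 powi k) y
      = s powr (1 + p) * ((2 powi k) powr e * indicator {k. 2 powi k < X} k)" for k :: int
  proof -
    define l :: real where "l = 2 powi k"
    have l: "0 < l" by (simp add: l_def)
    have cond: "1 / (2 * ?N) < s / l \<longleftrightarrow> l < X" using l N by (simp add: X_def field_simps)
    have "l\<^sup>2 * (s / l) powr (1 + p) = s powr (1 + p) * (l powr 2 / l powr (1 + p))"
      using l s by (simp add: powr_divide)
    also have "l powr 2 / l powr (1 + p) = l powr e" by (simp add: powr_diff[symmetric] e_def)
    finally show ?thesis
      unfolding l_def[symmetric] tail_def s_def[symmetric] cond by (auto simp: l_def)
  qed
  have "(\<integral>\<^sup>+k. ennreal ((2 powi k)\<^sup>2 * tail p f (2 powi k) y) \<partial>count_space UNIV)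
      = (\<integral>\<^sup>+k. ennreal (s powr (1 + p)) * (ennreal ((2 powi k) powr e) * indicator {k. 2 powi k < X} k) \<partial>count_space UNIV)"
    unfolding sc by (intro nn_integral_cong) (auto simp: ennreal_mult split: split_indicator)
  also have "\<dots> = ennreal (s powr (1 + p)) *
      (\<integral>\<^sup>+k. ennreal ((2 powi k) powr e) * indicator {k. 2 powi k < X} k \<partial>count_space UNIV)"
    by (rule nn_integral_cmult) simp
  also have "\<dots> \<le> ennreal (s powr (1 + p)) * ennreal (X powr e * (2 / e))"
    by (intro mult_left_mono nn_integral_dyadic_powers_le X e) simp
  also have "\<dots> = ennreal (s powr (1 + p) * (X powr e * (2 / e)))"
    using e by (intro ennreal_mult[symmetric]) auto
  also have "\<dots> \<le> ennreal (6 * ?N / dl * s\<^sup>2)"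
  proof (rule ennreal_leI)
    have "X powr e = (2 * ?N) powr e * s powr e" using s N by (simp add: X_def powr_mult)
    also have "\<dots> \<le> (2 * ?N) powr 1 * s powr e" using e N by (intro mult_right_mono powr_mono) (linarith | simp)+
    finally have Xe: "X powr e \<le> 2 * ?N * s powr e" by simp
    have "2 / e \<le> 2 / (2 * dl / 3)" using e_lower dl e by (intro divide_left_mono) auto
    then have e2: "2 / e \<le> 3 / dl" by simp
    have "s powr (1 + p) * (X powr e * (2 / e)) \<le> s powr (1 + p) * ((2 * ?N * s powr e) * (3 / dl))"
      using Xe e2 e s by (intro mult_left_mono mult_mono) auto
    also have "\<dots> = 6 * ?N / dl * (s powr (1 + p) * s powr e)" by (simp add: field_simps)
    also have "s powr (1 + p) * s powr e = s\<^sup>2" using s by (simp add: powr_add[symmetric] e_def)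
    finally show "s powr (1 + p) * (X powr e * (2 / e)) \<le> 6 * ?N / dl * s\<^sup>2" .
  qed
  finally show ?thesis by (simp add: s_def)
qed

text \<open>The choice of \<open>dl\<close> makes the reverse Hoelder inequality applicable: \<open>(2 \<cdot> 2\<^sup>d)\<^bsup>dl\<^esup> = 2\<^bsup>1 / (8 A)\<^esup>\<close>. One factor
\<open>A\<close> comes from the localized suprema and the other from \<open>1 / dl\<close>. The numerical constant collects \<open>4\<close> from the
dyadic levels, \<open>4 n\<^sup>2\<close> from the localized suprema, \<open>64 n\<^sup>2\<close> from the weak type estimate, \<open>6 n\<close> from the sum
of the tails and \<open>8 (d + 1)\<close> from \<open>1 / dl\<close>.\<close>

lemma nn_integral_max_fn_square_le:
  assumes f [measurable]: "f \<in> borel_measurable lebesgue"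
    and fin: "(\<integral>\<^sup>+y. ennreal ((norm (f y))\<^sup>2) \<partial>lebesgue) < \<infinity>"
  shows "(\<integral>\<^sup>+x. (max_fn f x)\<^sup>2 \<partial>lebesgue)
    \<le> ennreal (49152 * (real CARD('d) + 1) * real CARD('n) ^ 5 * A\<^sup>2) * (\<integral>\<^sup>+y. ennreal ((norm (f y))\<^sup>2) \<partial>lebesgue)"
proof -
  let ?N = "real CARD('n)"
  have N: "1 \<le> ?N" by (simp add: Suc_leI)
  define d1 where "d1 = real CARD('d) + 1"
  define dl where "dl = 1 / (8 * A * d1)"
  have d1: "1 \<le> d1" by (simp add: d1_def)
  have A: "1 \<le> A" by (rule one_le_A)
  have "1 * 1 \<le> (8 * A) * d1" using A d1 by (intro mult_mono) auto
  then have dl: "0 < dl" "dl \<le> 1" using A d1 by (auto simp: dl_def)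
  have rho: "(2 * 2 ^ CARD('d)) powr dl \<le> 1 + 1 / (8 * A)"
  proof -
    have "(2 * 2 ^ CARD('d) :: real) = 2 powr d1"
      by (simp add: d1_def powr_add powr_realpow)
    then have "(2 * 2 ^ CARD('d) :: real) powr dl = 2 powr (d1 * dl)" by (simp add: powr_powr)
    also have "d1 * dl = 1 / (8 * A)" using A d1 by (simp add: dl_def)
    also have "2 powr (1 / (8 * A)) \<le> 1 - 1 / (8 * A) + 1 / (8 * A) * 2"
      using A by (intro powr_le_linear_interpolation) auto
    finally show ?thesis by simp
  qed
  define p where "p = 1 / (1 + 2 * dl)"
  let ?F = "\<lambda>k. maximal (superlevel f k)"
  have cnt: "countable (?F k)" for k by (rule countable_maximal[OF superlevel_subset])
  have FD: "J \<in> D" "J \<in> superlevel f k" if "J \<in> ?F k" for J k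
    using that maximal_subset superlevel_subset by blast+
  have level: "(\<integral>\<^sup>+x. ennreal (4 * (2 powi k)\<^sup>2) * (\<integral>\<^sup>+J. full_max J x \<partial>count_space (?F k)) \<partial>lebesgue)
      \<le> ennreal (1024 * ?N ^ 4 * A) * (\<integral>\<^sup>+y. ennreal ((2 powi k)\<^sup>2 * tail p f (2 powi k) y) \<partial>lebesgue)" for k :: int
  proof -
    define l :: real where "l = 2 powi k"
    have l: "0 < l" by (simp add: l_def)
    let ?t = "\<lambda>y. ennreal (tail p f l y)"
    have "(\<integral>\<^sup>+x. (\<integral>\<^sup>+J. full_max J x \<partial>count_space (?F k)) \<partial>lebesgue)
        = (\<integral>\<^sup>+J. (\<integral>\<^sup>+x. full_max J x \<partial>lebesgue) \<partial>count_space (?F k))"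
      by (rule nn_integral_count_space_nn_integral[OF cnt]) measurable
    also have "\<dots> \<le> (\<integral>\<^sup>+J. ennreal (256 * ?N ^ 4 * A) * (\<integral>\<^sup>+y\<in>J. ?t y \<partial>lebesgue) \<partial>count_space (?F k))"
    proof (rule nn_integral_mono)
      fix J assume "J \<in> space (count_space (?F k))"
      then have J: "J \<in> D" "J \<in> superlevel f k" using FD by auto
      have "(\<integral>\<^sup>+x. full_max J x \<partial>lebesgue) \<le> ennreal (4 * ?N\<^sup>2 * A) * ennreal (vol J)"
        using nn_integral_full_max[OF J(1)] A by (simp flip: ennreal_mult)
      also have "\<dots> \<le> ennreal (4 * ?N\<^sup>2 * A) * (ennreal (64 * ?N\<^sup>2) * (\<integral>\<^sup>+y\<in>J. ?t y \<partial>lebesgue))"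
        using J l dl rho unfolding p_def
        by (intro mult_left_mono reduced_weak_bound f) (auto simp: superlevel_def l_def)
      also have "\<dots> = ennreal (256 * ?N ^ 4 * A) * (\<integral>\<^sup>+y\<in>J. ?t y \<partial>lebesgue)"
      proof -
        have "ennreal (4 * ?N\<^sup>2 * A) * ennreal (64 * ?N\<^sup>2) = ennreal (256 * ?N ^ 4 * A)"
          using A by (simp add: ennreal_mult[symmetric] power2_eq_square power4_eq_xxxx mult_ac)
        then show ?thesis by (simp only: mult.assoc[symmetric])
      qed
      finally show "(\<integral>\<^sup>+x. full_max J x \<partial>lebesgue) \<le> ennreal (256 * ?N ^ 4 * A) * (\<integral>\<^sup>+y\<in>J. ?t y \<partial>lebesgue)" .
    qed
    also have "\<dots> = ennreal (256 * ?N ^ 4 * A) * (\<integral>\<^sup>+y\<in>\<Union>(?F k). ?t y \<partial>lebesgue)"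
      by (subst nn_integral_cmult)
        (auto simp: sum_nn_integral_maximal[OF superlevel_subset superlevel_subset superlevel_subset])
    also have "\<dots> \<le> ennreal (256 * ?N ^ 4 * A) * (\<integral>\<^sup>+y. ?t y \<partial>lebesgue)"
      by (intro mult_left_mono nn_integral_mono) (auto split: split_indicator)
    finally have le: "(\<integral>\<^sup>+x. (\<integral>\<^sup>+J. full_max J x \<partial>count_space (?F k)) \<partial>lebesgue)
        \<le> ennreal (256 * ?N ^ 4 * A) * (\<integral>\<^sup>+y. ?t y \<partial>lebesgue)" .
    have m: "(\<lambda>x. \<integral>\<^sup>+J. full_max J x \<partial>count_space (?F k)) \<in> borel_measurable lebesgue"
      by (intro borel_measurable_nn_integral_count_space cnt) measurable
    have "(\<integral>\<^sup>+x. ennreal (4 * l\<^sup>2) * (\<integral>\<^sup>+J. full_max J x \<partial>count_space (?F k)) \<partial>lebesgue)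
        = ennreal (4 * l\<^sup>2) * (\<integral>\<^sup>+x. (\<integral>\<^sup>+J. full_max J x \<partial>count_space (?F k)) \<partial>lebesgue)"
      by (rule nn_integral_cmult[OF m])
    also have "\<dots> \<le> ennreal (4 * l\<^sup>2) * (ennreal (256 * ?N ^ 4 * A) * (\<integral>\<^sup>+y. ?t y \<partial>lebesgue))"
      by (intro mult_left_mono le) simp
    also have "\<dots> = ennreal (1024 * ?N ^ 4 * A) * (ennreal (l\<^sup>2) * (\<integral>\<^sup>+y. ?t y \<partial>lebesgue))"
    proof -
      have "ennreal (4 * l\<^sup>2) * ennreal (256 * ?N ^ 4 * A) = ennreal (1024 * ?N ^ 4 * A) * ennreal (l\<^sup>2)"
        using A by (simp add: ennreal_mult[symmetric] mult_ac)
      then show ?thesis by (simp only: mult.assoc[symmetric])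
    qed
    also have "ennreal (l\<^sup>2) * (\<integral>\<^sup>+y. ?t y \<partial>lebesgue) = (\<integral>\<^sup>+y. ennreal (l\<^sup>2 * tail p f l y) \<partial>lebesgue)"
      using tail_nonneg by (subst nn_integral_cmult[symmetric]) (auto simp: ennreal_mult)
    finally show ?thesis unfolding l_def .
  qed
  have "(\<integral>\<^sup>+x. (max_fn f x)\<^sup>2 \<partial>lebesgue)
      \<le> (\<integral>\<^sup>+x. (\<integral>\<^sup>+k. ennreal (4 * (2 powi k)\<^sup>2) * (\<integral>\<^sup>+J. full_max J x \<partial>count_space (?F k)) \<partial>count_space UNIV) \<partial>lebesgue)"
    by (intro nn_integral_mono max_fn_square_le f fin)
  also have "\<dots> = (\<integral>\<^sup>+k. (\<integral>\<^sup>+x. ennreal (4 * (2 powi k)\<^sup>2) * (\<integral>\<^sup>+J. full_max J x \<partial>count_space (?F k)) \<partial>lebesgue) \<partial>count_space UNIV)"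
  proof (rule nn_integral_count_space_nn_integral)
    fix k :: int
    have "(\<lambda>x. \<integral>\<^sup>+J. full_max J x \<partial>count_space (?F k)) \<in> borel_measurable lebesgue"
      by (intro borel_measurable_nn_integral_count_space cnt) measurable
    then show "(\<lambda>x. ennreal (4 * (2 powi k)\<^sup>2) * (\<integral>\<^sup>+J. full_max J x \<partial>count_space (?F k))) \<in> borel_measurable lebesgue"
      by measurable
  qed simp
  also have "\<dots> \<le> (\<integral>\<^sup>+k. ennreal (1024 * ?N ^ 4 * A) *
      (\<integral>\<^sup>+y. ennreal ((2 powi k)\<^sup>2 * tail p f (2 powi k) y) \<partial>lebesgue) \<partial>count_space UNIV)"
    by (intro nn_integral_mono level)
  also have "\<dots> = ennreal (1024 * ?N ^ 4 * A) *
      (\<integral>\<^sup>+y. (\<integral>\<^sup>+k. ennreal ((2 powi k)\<^sup>2 * tail p f (2 powi k) y) \<partial>count_space UNIV) \<partial>lebesgue)"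
    by (subst nn_integral_cmult, simp, subst nn_integral_count_space_nn_integral) auto
  also have "\<dots> \<le> ennreal (1024 * ?N ^ 4 * A) * (\<integral>\<^sup>+y. ennreal (6 * ?N / dl * (norm (f y))\<^sup>2) \<partial>lebesgue)"
    by (intro mult_left_mono nn_integral_mono tail_sum_le[OF dl, folded p_def]) simp
  also have "(\<integral>\<^sup>+y. ennreal (6 * ?N / dl * (norm (f y))\<^sup>2) \<partial>lebesgue)
      = ennreal (6 * ?N / dl) * (\<integral>\<^sup>+y. ennreal ((norm (f y))\<^sup>2) \<partial>lebesgue)"
    using dl by (subst nn_integral_cmult[symmetric]) (auto simp: ennreal_mult[symmetric])
  also have "ennreal (1024 * ?N ^ 4 * A) * (ennreal (6 * ?N / dl) * (\<integral>\<^sup>+y. ennreal ((norm (f y))\<^sup>2) \<partial>lebesgue))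
      = ennreal (49152 * (real CARD('d) + 1) * real CARD('n) ^ 5 * A\<^sup>2) * (\<integral>\<^sup>+y. ennreal ((norm (f y))\<^sup>2) \<partial>lebesgue)"
  proof -
    have "1024 * ?N ^ 4 * A * (6 * ?N / dl) = 49152 * (real CARD('d) + 1) * real CARD('n) ^ 5 * A\<^sup>2"
      using A by (simp add: dl_def d1_def[symmetric] power2_eq_square eval_nat_numeral)
    moreover have "ennreal (1024 * ?N ^ 4 * A) * ennreal (6 * ?N / dl) = ennreal (1024 * ?N ^ 4 * A * (6 * ?N / dl))"
      using A dl by (intro ennreal_mult[symmetric]) auto
    ultimately show ?thesis by (simp only: mult.assoc[symmetric])
  qed
  finally show ?thesis .
qed

end

section \<open>The maximal theorem\<close>

text \<open>This is completeness of Lebesgue measure.\<close>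

lemma borel_measurable_lebesgue_AE_cong:
  fixes f g :: "'a::euclidean_space \<Rightarrow> ennreal"
  assumes f: "f \<in> borel_measurable lebesgue" and ae: "AE x in lebesgue. f x = g x"
  shows "g \<in> borel_measurable lebesgue"
proof (rule measurableI)
  obtain Z where Z: "Z \<in> null_sets lebesgue" "{x\<in>space lebesgue. f x \<noteq> g x} \<subseteq> Z"
    using ae by (auto simp: eventually_ae_filter)
  fix B :: "ennreal set" assume "B \<in> sets borel"
  then have 1: "f -` B \<inter> space lebesgue \<in> sets lebesgue" using f by (rule measurable_sets[rotated])
  have 2: "g -` B \<inter> Z \<in> sets lebesgue"
    using null_sets_completion_subset[of "g -` B \<inter> Z" Z lborel] Z(1) by auto
  have "f x = g x" if "x \<notin> Z" for x using Z(2) that by auto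
  then have "g -` B \<inter> space lebesgue = ((f -` B \<inter> space lebesgue) - Z) \<union> (g -` B \<inter> Z)"
    by auto
  also have "\<dots> \<in> sets lebesgue" using 1 2 Z(1) by (intro sets.Un sets.Diff) auto
  finally show "g -` B \<inter> space lebesgue \<in> sets lebesgue" .
qed auto

lemma measurable_on_pos_def:
  fixes W :: "real^'d \<Rightarrow> complex^'n^'n" and h :: "complex^'n^'n \<Rightarrow> complex^'n^'n"
  assumes W: "W \<in> borel_measurable lebesgue" and h: "continuous_on {A. pos_def A} h"
  shows "(\<lambda>x. if pos_def (W x) then h (W x) else mat 1) \<in> borel_measurable lebesgue"
proof -
  have "(\<lambda>A. if A \<in> {A. pos_def A} then h A else mat 1) \<in> borel_measurable borel"
    by (intro borel_measurable_continuous_on_if pos_def_borel h continuous_on_const)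
  from measurable_compose[OF W this] show ?thesis by simp
qed

lemma nn_integral_le_of_avg_avg_le:
  fixes h :: "real^'d \<Rightarrow> real^'d \<Rightarrow> ennreal"
  assumes [measurable]: "I \<in> sets lebesgue" and vol: "emeasure lebesgue I = ennreal V" "0 < V"
    and h: "(\<lambda>x. \<integral>\<^sup>+t\<in>I. h x t \<partial>lebesgue) \<in> borel_measurable lebesgue"
    and le: "avg I (\<lambda>x. avg I (h x)) \<le> ennreal A" and A: "0 \<le> A"
  shows "(\<integral>\<^sup>+x\<in>I. (\<integral>\<^sup>+t\<in>I. h x t \<partial>lebesgue) \<partial>lebesgue) \<le> ennreal (A * V\<^sup>2)"
proof -
  note [measurable] = h
  let ?X = "\<integral>\<^sup>+x\<in>I. (\<integral>\<^sup>+t\<in>I. h x t \<partial>lebesgue) \<partial>lebesgue"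
  have div: "a / ennreal V = ennreal (1 / V) * a" for a
    using vol(2) by (simp add: divide_ennreal_def inverse_ennreal mult.commute inverse_eq_divide)
  have "avg I (\<lambda>x. avg I (h x)) = ennreal (1 / V) * (ennreal (1 / V) * ?X)"
    unfolding avg_def vol(1) div
    by (subst nn_integral_cmult[symmetric]) (auto simp: mult.assoc)
  then have "ennreal (V\<^sup>2) * (ennreal (1 / V) * (ennreal (1 / V) * ?X)) \<le> ennreal (V\<^sup>2) * ennreal A"
    using le by (intro mult_left_mono) auto
  moreover have "ennreal (V\<^sup>2) * (ennreal (1 / V) * (ennreal (1 / V) * ?X)) = ?X"
  proof -
    have "ennreal (V\<^sup>2) * ennreal (1 / V) * ennreal (1 / V) = 1"
      using vol(2) by (simp add: power2_eq_square flip: ennreal_mult)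
    then show ?thesis by (simp only: mult.assoc[symmetric] mult_1_left)
  qed
  ultimately show ?thesis using A by (simp add: mult.commute flip: ennreal_mult)
qed

lemma ennsqrt_ennreal: "0 \<le> r \<Longrightarrow> ennsqrt (ennreal r) = ennreal (sqrt r)"
  by (simp add: ennsqrt_def)

lemma L2_vec_norm_ennreal:
  assumes "f \<in> L2_vec"
  obtains P where "0 \<le> P" "(\<integral>\<^sup>+y. ennreal ((norm (f y))\<^sup>2) \<partial>lebesgue) = ennreal P"
    "L2_vec_norm f = ennreal (sqrt P)"
proof -
  have eq: "(\<integral>\<^sup>+y. (ennreal (norm (f y)))\<^sup>2 \<partial>lebesgue) = (\<integral>\<^sup>+y. ennreal ((norm (f y))\<^sup>2) \<partial>lebesgue)"
    by (simp add: ennreal_power)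
  have "(\<integral>\<^sup>+y. (ennreal (norm (f y)))\<^sup>2 \<partial>lebesgue) < \<infinity>"
    using assms unfolding L2_vec_def L2_vec_norm_def L2_norm_def
    by (auto simp: ennsqrt_def less_top split: if_splits)
  then have "(\<integral>\<^sup>+y. ennreal ((norm (f y))\<^sup>2) \<partial>lebesgue) < \<infinity>"
    unfolding eq .
  then obtain P where P: "0 \<le> P" "(\<integral>\<^sup>+y. ennreal ((norm (f y))\<^sup>2) \<partial>lebesgue) = ennreal P"
    by (rule ennreal_finiteE)
  moreover have "L2_vec_norm f = ennreal (sqrt P)"
    unfolding L2_vec_norm_def L2_norm_def eq P(2) using P(1) by (rule ennsqrt_ennreal)
  ultimately show ?thesis by (rule that)
qed

theorem theorem4p5:
  "\<exists>c::real. 0 < c \<and>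
     (\<forall>(W :: real^'d \<Rightarrow> complex^'n^'n) (D :: (real^'d) set set).
        matrix_A2_weight W \<longrightarrow> dyadic_grid D \<longrightarrow>
          L2_bounded (maximal_fn D W) \<and>
          L2_op_norm (maximal_fn D W) \<le> ennreal c * A2_char W)"
proof -
  define K where "K = 49152 * (real CARD('d) + 1) * real CARD('n) ^ 5"
  have K: "0 < K" by (simp add: K_def add_pos_pos)
  have main: "L2_bounded (maximal_fn D W) \<and>
      L2_op_norm (maximal_fn D W) \<le> ennreal (sqrt K) * A2_char W"
    if W: "matrix_A2_weight W" and D: "dyadic_grid D"
    for W :: "real^'d \<Rightarrow> complex^'n^'n" and D :: "(real^'d) set set"
  proof -
    have Wm: "W \<in> borel_measurable lebesgue" and Wp: "AE x in lebesgue. pos_def (W x)"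
      and fin: "A2_char W < \<infinity>" using W by (auto simp: matrix_A2_weight_def)
    obtain A where A: "0 \<le> A" "A2_char W = ennreal A" using fin by (rule ennreal_finiteE)
    define S where "S x = (if pos_def (W x) then mat_sqrt (W x) else mat 1)" for x
    define R where "R x = (if pos_def (W x) then mat_inv_sqrt (W x) else mat 1)" for x
    interpret dyadic D by unfold_locales (rule D)
    have S_meas [measurable]: "S \<in> borel_measurable lebesgue"
      unfolding S_def by (rule measurable_on_pos_def[OF Wm continuous_on_mat_sqrt])
    have R_meas [measurable]: "R \<in> borel_measurable lebesgue"
      unfolding R_def by (rule measurable_on_pos_def[OF Wm continuous_on_mat_inv_sqrt])
    interpret L: sigma_finite_measure "lebesgue :: (real^'d) measure" by (rule sigma_finite_lebesgue)
    have hm: "(\<lambda>x. \<integral>\<^sup>+t\<in>I. ennreal ((op_norm (S x ** R t))\<^sup>2) \<partial>lebesgue) \<in> borel_measurable lebesgue"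
      if "I \<in> D" for I
    proof -
      have [measurable]: "I \<in> sets lebesgue" using that by (rule sets_D)
      have [measurable]: "(\<lambda>z. op_norm (S (fst z) ** R (snd z))) \<in> borel_measurable (lebesgue \<Otimes>\<^sub>M lebesgue)"
        by (intro measurable_compose[OF _ borel_measurable_continuous_onI[OF continuous_op_norm]]) measurable
      show ?thesis by (rule L.borel_measurable_nn_integral) (simp add: split_def)
    qed
    interpret matrix_A2 D S R A
    proof
      show "hermitian (S x)" "hermitian (R x)" "S x ** R x = mat 1" for x
        by (auto simp: S_def R_def mat_inv_sqrt hermitian_mat_1)
      fix I assume I: "I \<in> D"
      then obtain a where a: "I = cube a (2 powi lev I)" using gen_lev[OF I] by (auto simp: gen_def)
      have "avg I (\<lambda>x. avg I (\<lambda>t. ennreal ((op_norm (S x ** R t))\<^sup>2)))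
          = avg I (\<lambda>x. avg I (\<lambda>t. ennreal ((op_norm (mat_sqrt (W x) ** mat_inv_sqrt (W t)))\<^sup>2)))"
      proof -
        have "(\<integral>\<^sup>+t\<in>I. ennreal ((op_norm (S x ** R t))\<^sup>2) \<partial>lebesgue)
            = (\<integral>\<^sup>+t\<in>I. ennreal ((op_norm (mat_sqrt (W x) ** mat_inv_sqrt (W t)))\<^sup>2) \<partial>lebesgue)"
          if "pos_def (W x)" for x
          using Wp that by (intro nn_integral_cong_AE) (auto simp: S_def R_def elim!: eventually_mono)
        then show ?thesis
          unfolding avg_def using Wp
          by (intro arg_cong2[where f="(/)"] nn_integral_cong_AE refl) (auto elim!: eventually_mono)
      qed
      also have "\<dots> \<le> A2_char W"
        unfolding A2_char_def by (rule SUP_upper) (use a in \<open>auto intro!: exI[of _ a] exI[of _ "2 powi lev I"]\<close>)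
      finally have "avg I (\<lambda>x. avg I (\<lambda>t. ennreal ((op_norm (S x ** R t))\<^sup>2))) \<le> ennreal A"
        by (simp add: A(2))
      then show "(\<integral>\<^sup>+x\<in>I. (\<integral>\<^sup>+t\<in>I. ennreal ((op_norm (S x ** R t))\<^sup>2) \<partial>lebesgue) \<partial>lebesgue) \<le> ennreal (A * (vol I)\<^sup>2)"
        by (intro nn_integral_le_of_avg_avg_le sets_D[OF I] emeasure_D[OF I] vol_pos hm[OF I] A(1))
    qed (rule S_meas R_meas)+
    have bound: "maximal_fn D W f \<in> borel_measurable lebesgue \<and>
        L2_norm (maximal_fn D W f) \<le> ennreal (sqrt K * A) * L2_vec_norm f"
      if f: "f \<in> L2_vec" for f :: "real^'d \<Rightarrow> complex^'n"
    proof -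
      have fm: "f \<in> borel_measurable lebesgue" using f by (simp add: L2_vec_def)
      have eq: "max_fn f x = maximal_fn D W f x" if "pos_def (W x)" for x
        unfolding max_fn_def maximal_fn_def avg_def using Wp that
        by (intro SUP_cong arg_cong2[where f="(/)"] nn_integral_cong_AE refl)
          (auto simp: S_def R_def elim!: eventually_mono)
      then have ae: "AE x in lebesgue. max_fn f x = maximal_fn D W f x"
        using Wp by (rule eventually_mono[rotated])
      obtain P where P: "0 \<le> P" "(\<integral>\<^sup>+y. ennreal ((norm (f y))\<^sup>2) \<partial>lebesgue) = ennreal P"
        "L2_vec_norm f = ennreal (sqrt P)" using L2_vec_norm_ennreal[OF f] .
      have "(\<integral>\<^sup>+x. (maximal_fn D W f x)\<^sup>2 \<partial>lebesgue) = (\<integral>\<^sup>+x. (max_fn f x)\<^sup>2 \<partial>lebesgue)"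
        using ae by (intro nn_integral_cong_AE) (auto elim!: eventually_mono)
      also have "\<dots> \<le> ennreal (K * A\<^sup>2) * ennreal P"
        using nn_integral_max_fn_square_le[OF fm] P(1) unfolding P(2) K_def by simp
      also have "\<dots> = ennreal (K * A\<^sup>2 * P)" using K P(1) by (intro ennreal_mult[symmetric]) auto
      finally have le: "(\<integral>\<^sup>+x. (maximal_fn D W f x)\<^sup>2 \<partial>lebesgue) \<le> ennreal (K * A\<^sup>2 * P)" .
      then have "(\<integral>\<^sup>+x. (maximal_fn D W f x)\<^sup>2 \<partial>lebesgue) < \<infinity>" by (rule le_less_trans) simp
      then obtain m where m: "0 \<le> m" "(\<integral>\<^sup>+x. (maximal_fn D W f x)\<^sup>2 \<partial>lebesgue) = ennreal m"
        by (rule ennreal_finiteE)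
      have "L2_norm (maximal_fn D W f) = ennreal (sqrt m)"
        unfolding L2_norm_def m(2) using m(1) by (rule ennsqrt_ennreal)
      also have "\<dots> \<le> ennreal (sqrt (K * A\<^sup>2 * P))"
        using le m K P(1) by (intro ennreal_leI real_sqrt_le_mono) (simp add: ennreal_le_iff)
      also have "\<dots> = ennreal (sqrt K * A) * L2_vec_norm f"
        using A(1) K P(1) by (simp add: P(3) real_sqrt_mult flip: ennreal_mult)
      finally show ?thesis
        using borel_measurable_lebesgue_AE_cong[OF max_fn_measurable[OF fm] ae] by simp
    qed
    have "L2_bounded (maximal_fn D W)"
      unfolding L2_bounded_def
    proof (intro conjI ballI exI)
      fix f :: "real^'d \<Rightarrow> complex^'n" assume f: "f \<in> L2_vec"
      have "ennreal (sqrt K * A) * L2_vec_norm f < \<infinity>"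
        using f by (simp add: L2_vec_def ennreal_mult_less_top)
      then show "maximal_fn D W f \<in> L2_scalar"
        using bound[OF f] by (auto simp: L2_scalar_def intro: le_less_trans)
    qed (use bound in blast)
    moreover have "L2_op_norm (maximal_fn D W) \<le> ennreal (sqrt K * A)"
      unfolding L2_op_norm_def using bound by (intro Inf_lower) blast
    then have "L2_op_norm (maximal_fn D W) \<le> ennreal (sqrt K) * A2_char W"
      using A K by (simp add: ennreal_mult)
    ultimately show ?thesis by blast
  qed
  show ?thesis using K main by (intro exI[of _ "sqrt K"]) auto
qed

end
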